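(* On $I\times S$ with the metric $\bar G = ds^2 + a(s)\langle d\varphi,d\varphi\rangle$, where $I=(W_-,W_+)$, the following hold. (i) For smooth vector fields $f\partial_s+X$ and $g\partial_s+Y$, where $f,g$ are smooth functions of $(s,\varphi)$ and $X(s,\cdot),Y(s,\cdot)$ are vector fields on $S$ depending smoothly on $s$, the Levi-Civita covariant derivative of $\bar G$ is $$\nabla_{f\partial_s+X}(g\partial_s+Y)=\Big(f g_s+dg(X)-\frac{a_s}{2}\langle X,Y\rangle\Big)\partial_s+\frac{a_s}{2a}(fY+gX)+fY_s+\nabla^S_XY .$$ (ii) The curvature tensor is $$\begin{aligned}\mathcal R(f\partial_s+X,g\partial_s+Y)(h\partial_s+Z)&=\Big(\frac{a_{ss}}{2}-\frac{a_s^2}{4a}\Big)\langle gX-fY,Z\rangle\,\partial_s+\mathcal R^S(X,Y)Z\\&\quad-\Big(\Big(\frac{a_s}{2a}\Big)_s+\frac{a_s^2}{4a^2}\Big)h(gX-fY)+\frac{a_s^2}{4a}\big(\langle X,Z\rangle Y-\langle Y,Z\rangle X\big),\end{aligned}$$ and the numerator for sectional curvature is $$\begin{aligned}\bar G\big(\mathcal R(f\partial_s+X,g\partial_s+Y)(g\partial_s+Y),f\partial_s+X\big)&=a\langle\mathcal R^S(X,Y)Y,X\rangle-\Big(\frac{a_{ss}}{2}-\frac{a_s^2}{4a}\Big)\langle gX-fY,gX-fY\rangle\\&\quad+\frac{a_s^2}{4}\big(\langle X,Y\rangle^2-\langle Y,Y\rangle\langle X,X\rangle\big).\end{aligned}$$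 (iii) If $X,Y\in T_\varphi S$ satisfy $\langle X,Y\rangle=0$ and $\langle X,X\rangle=\langle Y,Y\rangle=1/a(s)$, then $$\mathrm{Sec}_{(s,\varphi)}(\mathrm{span}(X,Y))=\frac1a-\frac{a_s^2}{4a^2},\qquad \mathrm{Sec}_{(s,\varphi)}(\mathrm{span}(\partial_s,Y))=-\frac{a_{ss}}{2a}+\frac{a_s^2}{4a^2}$$ are all the possible sectional curvatures.
   Context: $M$ is a smooth compact manifold (possibly with boundary or corners), and $\mu_0$ is a fixed smooth positive density on $M$ with $\int_M\mu_0=1$. $\langle f,h\rangle=\int_M fh\,\mu_0$ is the $L^2(\mu_0)$ inner product, $\|\cdot\|$ its norm, and $S=\{\varphi\in L^2(M,\mathbb{R}):\int_M\varphi^2\mu_0=1\}$ is the Hilbert sphere, with its standard metric $\langle d\varphi,d\varphi\rangle$, Levi-Civita covariant derivative $\nabla^S$ and curvature tensor $\mathcal R^S$. $C_1,C_2:(0,\infty)\to\mathbb{R}$ are smooth with $C_1(m)>0$ and $C_2(m)>-\frac1mC_1(m)$ for all $m>0$. Put $g_2(r)=4(C_1(r^2)+C_2(r^2)r^2)$, $W(r)=\int_1^r\sqrt{g_2(\rho)}\,d\rho$, $W_-=\lim_{r\to0+}W(r)$, $W_+=\lim_{r\to\infty}W(r)$; let $s\mapsto r(s)$, $(W_-,W_+)\to\mathbb{R}_{>0}$, be the inverse of $W$ and $a(s)=4C_1(r(s)^2)r(s)^2$. The metric $\bar G$ is the representation, in the coordinates $s=W(\|f\|)$, $\varphi=f/\|f\|$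 with $f=\sqrt{\mu/\mu_0}$, of the metric $$G_\mu(\alpha,\beta)=C_1(\mu(M))\int_M\frac{\alpha}{\mu}\frac{\beta}{\mu}\,\mu+C_2(\mu(M))\int_M\alpha\cdot\int_M\beta$$ on the space of smooth positive densities on $M$ (extended to $I\times S$ by the same formula). Subscripts $s$ denote derivatives with respect to $s$, and $\langle X,Y\rangle$ for tangent vectors of $S$ is the $L^2(\mu_0)$ inner product. In (ii), at a point $(s,\varphi)$, $f,g,h$ are real numbers and $X,Y,Z\in T_\varphi S$ (curvature is tensorial). The curvature convention is $\mathcal R(U,V)W=\nabla_U\nabla_VW-\nabla_V\nabla_UW-\nabla_{[U,V]}W$ (same for $\mathcal R^S$), and $\mathrm{Sec}$ of the plane spanned by a $\bar G$-orthonormal pair $U,V$ is $\bar G(\mathcal R(U,V)V,U)$.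
   Formalization: In (iii), "are all the possible sectional curvatures" is false literally, since mixed planes give intermediate values; it is replaced by: the sectional curvatures at a point form exactly the closed segment between the two displayed values. *)

theory Defs
  imports "HOL-Probability.Probability"
begin

section \<open>The Hilbert space of square-integrable functions\<close>

text \<open>
  HOL has no types depending on a measure, so the measure is attached to the underlying space by a
  type class.  The class only says that \<open>mu0\<close> is a Borel measure: that it is a smooth positive
  density of total mass 1 has to be assumed separately.
\<close>

class borel_measure_space = topological_space +
  fixes mu0 :: "'a measure"
  assumes sets_mu0: "sets mu0 = sets borel"

definition square_integrable :: "('a::borel_measure_space \<Rightarrow> real) \<Rightarrow> bool" where
  "square_integrable f \<longleftrightarrow> f \<in> borel_measurable mu0 \<and> integrable mu0 (\<lambda>x. (f x)\<^sup>2)"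

definition L2_rel :: "('a::borel_measure_space \<Rightarrow> real) \<Rightarrow> ('a \<Rightarrow> real) \<Rightarrow> bool" where
  "L2_rel f g \<longleftrightarrow> square_integrable f \<and> square_integrable g \<and> (AE x in mu0. f x = g x)"

lemma square_integrable_zero: "square_integrable (\<lambda>_. 0)"
  by (simp add: square_integrable_def)

lemma square_integrable_mult:
  assumes "square_integrable f" "square_integrable g"
  shows "integrable mu0 (\<lambda>x. f x * g x)"
proof (rule Bochner_Integration.integrable_bound)
  show "integrable mu0 (\<lambda>x. (f x)\<^sup>2 + (g x)\<^sup>2)"
    using assms by (simp add: square_integrable_def)
  show "(\<lambda>x. f x * g x) \<in> borel_measurable mu0"
    using assms by (auto simp: square_integrable_def intro: borel_measurable_times)
  have "norm (f x * g x) \<le> norm ((f x)\<^sup>2 + (g x)\<^sup>2)" for x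
  proof -
    have "2 * (\<bar>f x\<bar> * \<bar>g x\<bar>) \<le> (f x)\<^sup>2 + (g x)\<^sup>2"
      using sum_squares_bound[of "\<bar>f x\<bar>" "\<bar>g x\<bar>"] by simp
    moreover have "0 \<le> \<bar>f x\<bar> * \<bar>g x\<bar>" by simp
    ultimately have "\<bar>f x\<bar> * \<bar>g x\<bar> \<le> (f x)\<^sup>2 + (g x)\<^sup>2" by linarith
    then show ?thesis by (simp add: abs_mult)
  qed
  then show "AE x in mu0. norm (f x * g x) \<le> norm ((f x)\<^sup>2 + (g x)\<^sup>2)" by simp
qed

lemma square_integrable_add:
  assumes "square_integrable f" "square_integrable g"
  shows "square_integrable (\<lambda>x. f x + g x)"
proof -
  have "integrable mu0 (\<lambda>x. (f x)\<^sup>2 + (g x)\<^sup>2 + 2 * (f x * g x))"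
    using assms square_integrable_mult[OF assms] by (simp add: square_integrable_def)
  moreover have "(\<lambda>x. (f x + g x)\<^sup>2) = (\<lambda>x. (f x)\<^sup>2 + (g x)\<^sup>2 + 2 * (f x * g x))"
    by (auto simp: power2_eq_square algebra_simps)
  ultimately show ?thesis
    using assms by (auto simp: square_integrable_def intro: borel_measurable_add)
qed

lemma square_integrable_scale:
  "square_integrable f \<Longrightarrow> square_integrable (\<lambda>x. c * f x)"
  by (auto simp: square_integrable_def power_mult_distrib
      intro: borel_measurable_times borel_measurable_const)

lemma square_integrable_uminus:
  "square_integrable f \<Longrightarrow> square_integrable (\<lambda>x. - f x)"
  using square_integrable_scale[of f "-1"] by simp

lemma square_integrable_diff:
  "square_integrable f \<Longrightarrow> square_integrable g \<Longrightarrow> square_integrable (\<lambda>x. f x - g x)"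
  using square_integrable_add[OF _ square_integrable_uminus] by fastforce

quotient_type (overloaded) 'a L2 = "'a::borel_measure_space \<Rightarrow> real" / partial: L2_rel
proof (rule part_equivpI)
  show "\<exists>f. L2_rel f f"
    by (rule exI[of _ "\<lambda>_. 0"]) (simp add: L2_rel_def square_integrable_zero)
  show "symp L2_rel" by (auto simp: symp_def L2_rel_def)
  show "transp L2_rel" by (auto simp: transp_def L2_rel_def)
qed

instantiation L2 :: (borel_measure_space) real_vector
begin

lift_definition zero_L2 :: "'a L2" is "\<lambda>_. 0"
  by (simp add: L2_rel_def square_integrable_zero)

lift_definition plus_L2 :: "'a L2 \<Rightarrow> 'a L2 \<Rightarrow> 'a L2" is "\<lambda>f g x. f x + g x"
  by (auto simp: L2_rel_def square_integrable_add)

lift_definition scaleR_L2 :: "real \<Rightarrow> 'a L2 \<Rightarrow> 'a L2" is "\<lambda>c f x. c * f x"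
  by (auto simp: L2_rel_def square_integrable_scale)

lift_definition uminus_L2 :: "'a L2 \<Rightarrow> 'a L2" is "\<lambda>f x. - f x"
  by (auto simp: L2_rel_def square_integrable_uminus)

lift_definition minus_L2 :: "'a L2 \<Rightarrow> 'a L2 \<Rightarrow> 'a L2" is "\<lambda>f g x. f x - g x"
  by (auto simp: L2_rel_def square_integrable_diff)

instance
proof
  fix f g h :: "'a L2" and b c :: real
  show "f + g + h = f + (g + h)"
    by transfer (auto simp: L2_rel_def square_integrable_add add.assoc)
  show "f + g = g + f"
    by transfer (auto simp: L2_rel_def square_integrable_add add.commute)
  show "0 + f = f"
    by transfer (auto simp: L2_rel_def)
  show "- f + f = 0"
    by transfer (auto simp: L2_rel_def square_integrable_zero)
  show "f - g = f + - g"
    by transfer (auto simp: L2_rel_def square_integrable_diff)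
  show "c *\<^sub>R (f + g) = c *\<^sub>R f + c *\<^sub>R g"
    by transfer (auto simp: L2_rel_def distrib_left square_integrable_add square_integrable_scale)
  show "(b + c) *\<^sub>R f = b *\<^sub>R f + c *\<^sub>R f"
    by transfer (auto simp: L2_rel_def distrib_right square_integrable_add square_integrable_scale)
  show "b *\<^sub>R c *\<^sub>R f = (b * c) *\<^sub>R f"
    by transfer (auto simp: L2_rel_def mult.assoc square_integrable_scale)
  show "1 *\<^sub>R f = f"
    by transfer (auto simp: L2_rel_def)
qed

end

lift_definition L2_inner :: "'a::borel_measure_space L2 \<Rightarrow> 'a L2 \<Rightarrow> real" is "\<lambda>f g. \<integral>x. f x * g x \<partial>mu0"
proof -
  fix f f' g g' :: "'a \<Rightarrow> real"
  assume A: "L2_rel f f'" "L2_rel g g'"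
  show "(\<integral>x. f x * g x \<partial>mu0) = (\<integral>x. f' x * g' x \<partial>mu0)"
  proof (rule integral_cong_AE)
    show "AE x in mu0. f x * g x = f' x * g' x"
      using A by (auto simp: L2_rel_def)
  qed (use A in \<open>auto simp: L2_rel_def square_integrable_def intro: borel_measurable_times\<close>)
qed

instantiation L2 :: (borel_measure_space) real_inner
begin

definition inner_L2 :: "'a L2 \<Rightarrow> 'a L2 \<Rightarrow> real" where
  "inner_L2 = L2_inner"
definition norm_L2 :: "'a L2 \<Rightarrow> real" where
  "norm_L2 f = sqrt (L2_inner f f)"
definition sgn_L2 :: "'a L2 \<Rightarrow> 'a L2" where
  "sgn_L2 f = f /\<^sub>R sqrt (L2_inner f f)"
definition dist_L2 :: "'a L2 \<Rightarrow> 'a L2 \<Rightarrow> real" where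
  "dist_L2 f g = sqrt (L2_inner (f - g) (f - g))"
definition uniformity_L2 :: "('a L2 \<times> 'a L2) filter" where
  "uniformity_L2 = (INF e\<in>{0<..}. principal {(f, g). sqrt (L2_inner (f - g) (f - g)) < e})"
definition open_L2 :: "'a L2 set \<Rightarrow> bool" where
  "open_L2 U \<longleftrightarrow> (\<forall>f\<in>U. \<forall>\<^sub>F (f', g) in
     (INF e\<in>{0<..}. principal {(f, g). sqrt (L2_inner (f - g) (f - g)) < e}). f' = f \<longrightarrow> g \<in> U)"

instance
proof
  fix f g h :: "'a L2" and c :: real
  show "dist f g = norm (f - g)" by (simp add: dist_L2_def norm_L2_def)
  show "sgn f = f /\<^sub>R norm f" by (simp add: sgn_L2_def norm_L2_def)
  show "uniformity = (INF e\<in>{0<..}. principal {(f :: 'a L2, g). dist f g < e})"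
    by (simp add: uniformity_L2_def dist_L2_def)
  show "norm f = sqrt (f \<bullet> f)" by (simp add: norm_L2_def inner_L2_def)
  show "f \<bullet> g = g \<bullet> f"
    unfolding inner_L2_def by transfer (simp add: mult.commute)
  show "(f + g) \<bullet> h = f \<bullet> h + g \<bullet> h"
    unfolding inner_L2_def by transfer (simp add: L2_rel_def distrib_right square_integrable_mult)
  show "(c *\<^sub>R f) \<bullet> g = c * (f \<bullet> g)"
    unfolding inner_L2_def by transfer (simp add: mult.assoc)
  show "0 \<le> f \<bullet> f"
    unfolding inner_L2_def by transfer simp
  show "f \<bullet> f = 0 \<longleftrightarrow> f = 0"
  unfolding inner_L2_def
  proof transfer
    fix f :: "'a \<Rightarrow> real"
    assume "L2_rel f f"
    then have sq: "square_integrable f" by (simp add: L2_rel_def)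
    then have "(\<integral>x. f x * f x \<partial>mu0) = 0 \<longleftrightarrow> (AE x in mu0. f x * f x = 0)"
      by (intro integral_nonneg_eq_0_iff_AE)
        (auto simp: square_integrable_def power2_eq_square)
    then show "(\<integral>x. f x * f x \<partial>mu0) = 0 \<longleftrightarrow> L2_rel f (\<lambda>_. 0)"
      using sq by (simp add: L2_rel_def square_integrable_zero)
  qed
next
  fix U :: "'a L2 set"
  show "open U \<longleftrightarrow> (\<forall>f\<in>U. \<forall>\<^sub>F (f', g) in uniformity. f' = f \<longrightarrow> g \<in> U)"
    by (simp add: open_L2_def uniformity_L2_def)
qed

end

section \<open>Smooth maps\<close>

text \<open>
  Frechet smoothness: \<open>D x vs\<close> is the \<open>length vs\<close>-th derivative at \<open>x\<close>, a bounded multilinear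
  map, evaluated at the list of directions \<open>vs\<close>; each derivative has the next one as its
  derivative with respect to the operator norm.
\<close>

definition bounded_multilinear ::
    "nat \<Rightarrow> ('a::real_normed_vector list \<Rightarrow> 'b::real_normed_vector) \<Rightarrow> bool" where
  "bounded_multilinear k T \<longleftrightarrow>
     (\<forall>us ws. length us + 1 + length ws = k \<longrightarrow> linear (\<lambda>v. T (us @ v # ws))) \<and>
     (\<exists>K. \<forall>vs. length vs = k \<longrightarrow> norm (T vs) \<le> K * prod_list (map norm vs))"

definition smooth_on_open ::
    "'a::real_normed_vector set \<Rightarrow> ('a \<Rightarrow> 'b::real_normed_vector) \<Rightarrow> bool" where
  "smooth_on_open U f \<longleftrightarrow> open U \<and>
     (\<exists>D :: 'a \<Rightarrow> 'a list \<Rightarrow> 'b. \<forall>x\<in>U. D x [] = f x \<and>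
        (\<forall>k. bounded_multilinear k (D x) \<and>
          (\<forall>\<epsilon>>0. \<exists>\<delta>>0. \<forall>y\<in>U. dist y x < \<delta> \<longrightarrow>
             (\<forall>vs. length vs = k \<longrightarrow>
               norm (D y vs - D x vs - D x ((y - x) # vs))
                 \<le> \<epsilon> * norm (y - x) * prod_list (map norm vs)))))"

text \<open>For an arbitrary subset, smooth means locally the restriction of a smooth map.\<close>

definition smooth_on ::
    "'a::real_normed_vector set \<Rightarrow> ('a \<Rightarrow> 'b::real_normed_vector) \<Rightarrow> bool" where
  "smooth_on N f \<longleftrightarrow>
     (\<forall>p\<in>N. \<exists>U g. p \<in> U \<and> smooth_on_open U g \<and> (\<forall>x\<in>N \<inter> U. f x = g x))"

section \<open>Compact manifolds with corners and smooth positive densities\<close>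

definition corner_model :: "'e::euclidean_space set" where
  "corner_model = {x. \<forall>b\<in>Basis. 0 \<le> x \<bullet> b}"

text \<open>
  Since open subsets of half-spaces and of the whole space are diffeomorphic to open subsets of the
  quadrant, manifolds without boundary and with boundary are included.
\<close>

type_synonym ('m, 'e) atlas = "('m set \<times> ('m \<Rightarrow> 'e)) set"

definition corner_chart :: "'m::topological_space set \<times> ('m \<Rightarrow> 'e::euclidean_space) \<Rightarrow> bool" where
  "corner_chart c \<longleftrightarrow> (case c of (U, x) \<Rightarrow>
     open U \<and> openin (top_of_set corner_model) (x ` U) \<and>
     homeomorphism U (x ` U) x (inv_into U x))"

definition compact_manifold_with_corners ::
    "('m::t2_space, 'e::euclidean_space) atlas \<Rightarrow> bool" where
  "compact_manifold_with_corners A \<longleftrightarrow>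
     compact (UNIV :: 'm set) \<and> (\<Union>(U, x)\<in>A. U) = UNIV \<and> (\<forall>c\<in>A. corner_chart c) \<and>
     (\<forall>(U, x)\<in>A. \<forall>(V, y)\<in>A. smooth_on (x ` (U \<inter> V)) (y \<circ> inv_into U x))"

definition smooth_positive_density ::
    "('m::t2_space, 'e::euclidean_space) atlas \<Rightarrow> 'm measure \<Rightarrow> bool" where
  "smooth_positive_density A \<mu> \<longleftrightarrow> sets \<mu> = sets borel \<and>
     (\<forall>(U, x)\<in>A. \<exists>\<rho> :: 'e \<Rightarrow> real.
        smooth_on (x ` U) \<rho> \<and> (\<forall>z\<in>x ` U. 0 < \<rho> z) \<and>
        (\<forall>B\<in>sets borel. B \<subseteq> U \<longrightarrow>
           emeasure \<mu> B = (\<integral>\<^sup>+z. ennreal (\<rho> z) * indicator (x ` B) z \<partial>lborel)))"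

section \<open>Riemannian geometry of submanifolds of a normed space\<close>

text \<open>
  A submanifold is given by its underlying set \<open>N\<close>, a metric by its values \<open>G p u v\<close>.  Functions and
  vector fields on \<open>N\<close> are total functions, of which only the values on \<open>N\<close> matter.
\<close>

definition tangent_space :: "'a::real_normed_vector set \<Rightarrow> 'a \<Rightarrow> 'a set" where
  "tangent_space N p = {v. \<exists>c. c 0 = p \<and> (c has_vector_derivative v) (at 0) \<and>
     (\<forall>\<^sub>F t in at 0. c t \<in> N)}"

definition vector_fields :: "'a::real_normed_vector set \<Rightarrow> ('a \<Rightarrow> 'a) set" where
  "vector_fields N = {X. smooth_on N X \<and> (\<forall>p\<in>N. X p \<in> tangent_space N p)}"

text \<open>
  The value of \<open>frechet_derivative f (at p within N)\<close> is determined only on tangent vectors, and is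
  only used there.
\<close>

definition deriv_on ::
    "'a::real_normed_vector set \<Rightarrow> ('a \<Rightarrow> 'b::real_normed_vector) \<Rightarrow> 'a \<Rightarrow> 'a \<Rightarrow> 'b" where
  "deriv_on N f p v = frechet_derivative f (at p within N) v"

definition lie_bracket ::
    "'a::real_normed_vector set \<Rightarrow> ('a \<Rightarrow> 'a) \<Rightarrow> ('a \<Rightarrow> 'a) \<Rightarrow> 'a \<Rightarrow> 'a" where
  "lie_bracket N U V p = deriv_on N V p (U p) - deriv_on N U p (V p)"

definition is_levi_civita ::
    "'a::real_normed_vector set \<Rightarrow> ('a \<Rightarrow> 'a \<Rightarrow> 'a \<Rightarrow> real) \<Rightarrow>
     (('a \<Rightarrow> 'a) \<Rightarrow> ('a \<Rightarrow> 'a) \<Rightarrow> 'a \<Rightarrow> 'a) \<Rightarrow> bool" where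
  "is_levi_civita N G nab \<longleftrightarrow>
     \<comment> \<open>well defined as a map on vector fields on \<open>N\<close>\<close>
     (\<forall>U\<in>vector_fields N. \<forall>V\<in>vector_fields N. nab U V \<in> vector_fields N) \<and>
     (\<forall>U\<in>vector_fields N. \<forall>U'\<in>vector_fields N. \<forall>V\<in>vector_fields N. \<forall>V'\<in>vector_fields N.
        (\<forall>p\<in>N. U p = U' p \<and> V p = V' p) \<longrightarrow> (\<forall>p\<in>N. nab U V p = nab U' V' p)) \<and>
     \<comment> \<open>linear over smooth functions in the first argument\<close>
     (\<forall>U\<in>vector_fields N. \<forall>U'\<in>vector_fields N. \<forall>V\<in>vector_fields N. \<forall>p\<in>N.
        nab (\<lambda>q. U q + U' q) V p = nab U V p + nab U' V p) \<and>
     (\<forall>f. smooth_on N f \<longrightarrow> (\<forall>U\<in>vector_fields N. \<forall>V\<in>vector_fields N. \<forall>p\<in>N.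
        nab (\<lambda>q. f q *\<^sub>R U q) V p = f p *\<^sub>R nab U V p)) \<and>
     \<comment> \<open>a derivation in the second argument\<close>
     (\<forall>U\<in>vector_fields N. \<forall>V\<in>vector_fields N. \<forall>V'\<in>vector_fields N. \<forall>p\<in>N.
        nab U (\<lambda>q. V q + V' q) p = nab U V p + nab U V' p) \<and>
     (\<forall>f. smooth_on N f \<longrightarrow> (\<forall>U\<in>vector_fields N. \<forall>V\<in>vector_fields N. \<forall>p\<in>N.
        nab U (\<lambda>q. f q *\<^sub>R V q) p = deriv_on N f p (U p) *\<^sub>R V p + f p *\<^sub>R nab U V p)) \<and>
     \<comment> \<open>torsion-free\<close>
     (\<forall>U\<in>vector_fields N. \<forall>V\<in>vector_fields N. \<forall>p\<in>N.
        nab U V p - nab V U p = lie_bracket N U V p) \<and>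
     \<comment> \<open>metric\<close>
     (\<forall>U\<in>vector_fields N. \<forall>V\<in>vector_fields N. \<forall>Z\<in>vector_fields N. \<forall>p\<in>N.
        deriv_on N (\<lambda>q. G q (V q) (Z q)) p (U p) = G p (nab U V p) (Z p) + G p (V p) (nab U Z p))"

definition levi_civita ::
    "'a::real_normed_vector set \<Rightarrow> ('a \<Rightarrow> 'a \<Rightarrow> 'a \<Rightarrow> real) \<Rightarrow>
     ('a \<Rightarrow> 'a) \<Rightarrow> ('a \<Rightarrow> 'a) \<Rightarrow> 'a \<Rightarrow> 'a" where
  "levi_civita N G = (SOME nab. is_levi_civita N G nab)"

definition curvature_fields ::
    "'a::real_normed_vector set \<Rightarrow> ('a \<Rightarrow> 'a \<Rightarrow> 'a \<Rightarrow> real) \<Rightarrow>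
     ('a \<Rightarrow> 'a) \<Rightarrow> ('a \<Rightarrow> 'a) \<Rightarrow> ('a \<Rightarrow> 'a) \<Rightarrow> 'a \<Rightarrow> 'a" where
  "curvature_fields N G U V Z p =
     (let nab = levi_civita N G
      in nab U (nab V Z) p - nab V (nab U Z) p - nab (lie_bracket N U V) Z p)"

text \<open>The curvature tensor at a point: the common value over all extensions to vector fields.\<close>

definition curvature ::
    "'a::real_normed_vector set \<Rightarrow> ('a \<Rightarrow> 'a \<Rightarrow> 'a \<Rightarrow> real) \<Rightarrow> 'a \<Rightarrow> 'a \<Rightarrow> 'a \<Rightarrow> 'a \<Rightarrow> 'a" where
  "curvature N G p u v z = (THE r. \<exists>U\<in>vector_fields N. \<exists>V\<in>vector_fields N. \<exists>Z\<in>vector_fields N.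
     U p = u \<and> V p = v \<and> Z p = z \<and> r = curvature_fields N G U V Z p)"

definition tangent_planes :: "'a::real_normed_vector set \<Rightarrow> 'a \<Rightarrow> 'a set set" where
  "tangent_planes N p = {P. subspace P \<and> P \<subseteq> tangent_space N p \<and> dim P = 2}"

definition sectional_curvature ::
    "'a::real_normed_vector set \<Rightarrow> ('a \<Rightarrow> 'a \<Rightarrow> 'a \<Rightarrow> real) \<Rightarrow> 'a \<Rightarrow> 'a set \<Rightarrow> real" where
  "sectional_curvature N G p P = (THE k. \<exists>u v. span {u, v} = P \<and>
     G p u u = 1 \<and> G p v v = 1 \<and> G p u v = 0 \<and> k = G p (curvature N G p u v v) u)"

section \<open>The metric on $I\times S$\<close>

abbreviation L2_sphere :: "'m::borel_measure_space L2 set" where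
  "L2_sphere \<equiv> sphere 0 1"

definition sphere_metric :: "'m::borel_measure_space L2 \<Rightarrow> 'm L2 \<Rightarrow> 'm L2 \<Rightarrow> real" where
  "sphere_metric \<phi> X Y = X \<bullet> Y"

definition g2 :: "(real \<Rightarrow> real) \<Rightarrow> (real \<Rightarrow> real) \<Rightarrow> real \<Rightarrow> real" where
  "g2 C1 C2 r = 4 * (C1 (r\<^sup>2) + C2 (r\<^sup>2) * r\<^sup>2)"

definition W_fun :: "(real \<Rightarrow> real) \<Rightarrow> (real \<Rightarrow> real) \<Rightarrow> real \<Rightarrow> real" where
  "W_fun C1 C2 r = (LBINT \<rho>=ereal 1..ereal r. sqrt (g2 C1 C2 \<rho>))"

definition W_minus :: "(real \<Rightarrow> real) \<Rightarrow> (real \<Rightarrow> real) \<Rightarrow> ereal" where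
  "W_minus C1 C2 = Lim (at_right 0) (\<lambda>r. ereal (W_fun C1 C2 r))"

definition W_plus :: "(real \<Rightarrow> real) \<Rightarrow> (real \<Rightarrow> real) \<Rightarrow> ereal" where
  "W_plus C1 C2 = Lim at_top (\<lambda>r. ereal (W_fun C1 C2 r))"

definition W_interval :: "(real \<Rightarrow> real) \<Rightarrow> (real \<Rightarrow> real) \<Rightarrow> real set" where
  "W_interval C1 C2 = {s. W_minus C1 C2 < ereal s \<and> ereal s < W_plus C1 C2}"

definition r_fun :: "(real \<Rightarrow> real) \<Rightarrow> (real \<Rightarrow> real) \<Rightarrow> real \<Rightarrow> real" where
  "r_fun C1 C2 s = inv_into {0<..} (W_fun C1 C2) s"

definition a_fun :: "(real \<Rightarrow> real) \<Rightarrow> (real \<Rightarrow> real) \<Rightarrow> real \<Rightarrow> real" where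
  "a_fun C1 C2 s = 4 * C1 ((r_fun C1 C2 s)\<^sup>2) * (r_fun C1 C2 s)\<^sup>2"

text \<open>The metric $ds^2 + a(s)\langle d\varphi, d\varphi\rangle$; the tangent vector
  $f\partial_s + X$ is the pair \<open>(f, X)\<close>.\<close>

definition warped_metric ::
    "(real \<Rightarrow> real) \<Rightarrow> real \<times> 'm::borel_measure_space L2 \<Rightarrow> real \<times> 'm L2 \<Rightarrow> real \<times> 'm L2 \<Rightarrow> real" where
  "warped_metric a p u v = fst u * fst v + a (fst p) * (snd u \<bullet> snd v)"

end

theory Submission
  imports Defs
begin

text \<open>
  The manifold \<open>I \<times> S\<close> lies in the inner product space \<open>\<real> \<times> L\<^sup>2\<close>, and everything can be computed in the
  ambient linear coordinates.  On both \<open>S\<close> and \<open>I \<times> S\<close> the Levi-Civita derivative is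
  \<open>\<nabla>\<^sub>U V = DV(U) + \<Gamma>(U, V)\<close> with a symmetric bilinear \<open>\<Gamma>\<close> that depends smoothly on the point.  On the sphere
  \<open>\<Gamma>(X, Y) = \<langle>X, Y\<rangle> \<phi>\<close> compensates the normal component of \<open>DY(X)\<close>; on the warped product the Christoffel
  symbols of \<open>ds\<^sup>2 + a \<langle>d\<phi>, d\<phi>\<rangle>\<close> are added.  That this is the only torsion-free metric connection follows from
  the symmetries of the difference of two of them (\<open>is_levi_civita_unique\<close>), and splitting \<open>DV(U)\<close> into the
  derivatives along the slices gives part (i) (\<open>levi_civita_warped\<close>).
  
  In the curvature of such a connection all derivatives of the vector fields cancel, because second
  derivatives of smooth maps are symmetric (\<open>deriv_on_commutator\<close>).  What remains is an algebraic expression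
  in \<open>\<Gamma>\<close> and its derivative (\<open>curvature_fields_eq\<close>); evaluating it gives part (ii) (\<open>curvature_warped\<close>,
  \<open>curvature_numerator_warped\<close>).  As the unit sphere has curvature \<open>\<langle>Y, Z\<rangle> X - \<langle>X, Z\<rangle> Y\<close>, the
  numerator of the sectional curvature is a combination of the two parts into which the squared area of
  the parallelogram of the two vectors decomposes, one tangential to the sphere and one that involves the direction of \<open>s\<close>
  (\<open>curvature_numerator_area\<close>).  The coefficients are the two values in part (iii), and since the weights of
  an orthonormal pair are nonnegative with sum 1, the sectional curvatures fill the segment between these
  values (\<open>sectional_curvatures_warped\<close>).
  
  Two facts connect this with the given data.  The arc length coordinate \<open>s = W(r)\<close> has an inverse that
  satisfies \<open>r' = 1 / sqrt (g\<^sub>2 r)\<close>, so \<open>r\<close> and hence \<open>a\<close> are smooth by bootstrapping (\<open>n_differentiable_r_fun\<close>);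
  and a positive density on a manifold of positive dimension leaves room for three orthonormal functions
  (\<open>L2_three_orthonormal\<close>), so \<open>S\<close> has enough tangent directions.
  
  Smooth maps are handled through their families of multilinear derivatives; products are differentiated
  by a general Leibniz formula (\<open>deriv_family_leibniz\<close>), and the passage to the derivative is again such a
  family (\<open>deriv_family_derivative\<close>).
\<close>

section \<open>Smooth maps and their derivatives\<close>

abbreviation norm_prod :: "'a::real_normed_vector list \<Rightarrow> real" where
  "norm_prod vs \<equiv> prod_list (map norm vs)"

abbreviation remainder ::
    "('a::real_normed_vector \<Rightarrow> 'a list \<Rightarrow> 'b::real_normed_vector) \<Rightarrow> 'a \<Rightarrow> 'a \<Rightarrow> 'a list \<Rightarrow> 'b" where
  "remainder D x y vs \<equiv> D y vs - D x vs - D x ((y - x) # vs)"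

text \<open>
  All derivatives of a smooth map, with the requirements that \<open>smooth_on_open\<close> imposes on them.
\<close>

definition deriv_family ::
    "'a::real_normed_vector set \<Rightarrow> ('a \<Rightarrow> 'a list \<Rightarrow> 'b::real_normed_vector) \<Rightarrow> bool" where
  "deriv_family U D \<longleftrightarrow> (\<forall>x\<in>U. \<forall>k. bounded_multilinear k (D x) \<and>
     (\<forall>\<epsilon>>0. \<exists>\<delta>>0. \<forall>y\<in>U. dist y x < \<delta> \<longrightarrow>
        (\<forall>vs. length vs = k \<longrightarrow>
          norm (remainder D x y vs)
            \<le> \<epsilon> * norm (y - x) * norm_prod vs)))"

lemma smooth_on_open_iff:
  "smooth_on_open U f \<longleftrightarrow> open U \<and> (\<exists>D. (\<forall>x\<in>U. D x [] = f x) \<and> deriv_family U D)"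
  unfolding smooth_on_open_def deriv_family_def by blast

lemma smooth_on_openI:
  assumes "open U" "\<And>x. x \<in> U \<Longrightarrow> D x [] = f x" "deriv_family U D"
  shows "smooth_on_open U f"
  using assms smooth_on_open_iff by blast

lemma smooth_on_openE:
  assumes "smooth_on_open U f"
  obtains D where "open U" "\<forall>x\<in>U. D x [] = f x" "deriv_family U D"
  using assms smooth_on_open_iff by blast

lemma prod_list_norm_nonneg: "0 \<le> norm_prod vs"
  by (induction vs) auto

lemma bounded_multilinearD_linear:
  "bounded_multilinear k T \<Longrightarrow> length us + 1 + length ws = k \<Longrightarrow> linear (\<lambda>v. T (us @ v # ws))"
  unfolding bounded_multilinear_def by blast

lemma bounded_multilinearD_bound:
  assumes "bounded_multilinear k T"
  obtains K where "0 \<le> K" "\<And>vs. length vs = k \<Longrightarrow> norm (T vs) \<le> K * norm_prod vs"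
proof -
  obtain K where K: "\<And>vs. length vs = k \<Longrightarrow> norm (T vs) \<le> K * norm_prod vs"
    using assms unfolding bounded_multilinear_def by blast
  have "norm (T vs) \<le> \<bar>K\<bar> * norm_prod vs" if "length vs = k" for vs
    using K[OF that] mult_right_mono[OF abs_ge_self[of K] prod_list_norm_nonneg[of vs]] by linarith
  then show ?thesis using that[of "\<bar>K\<bar>"] by auto
qed

text \<open>
  The estimates for products involve the derivatives of all orders up to that of the product, so
  bounds and moduli of differentiability that are uniform in the order, up to any given order, are
  needed throughout.
\<close>

lemma bounded_multilinear_bound_upto:
  assumes "\<And>k. bounded_multilinear k T"
  obtains K where "0 \<le> K" "\<And>vs. length vs \<le> n \<Longrightarrow> norm (T vs) \<le> K * norm_prod vs"
proof -
  have "\<exists>K\<ge>0. \<forall>vs. length vs \<le> n \<longrightarrow> norm (T vs) \<le> K * norm_prod vs"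
  proof (induction n)
    case 0
    show ?case by (rule exI[of _ "norm (T [])"]) auto
  next
    case (Suc n)
    then obtain K where K: "0 \<le> K" "\<And>vs. length vs \<le> n \<Longrightarrow> norm (T vs) \<le> K * norm_prod vs"
      by blast
    obtain K' where K': "0 \<le> K'" "\<And>vs. length vs = Suc n \<Longrightarrow> norm (T vs) \<le> K' * norm_prod vs"
      using bounded_multilinearD_bound[OF assms] by blast
    have "norm (T vs) \<le> max K K' * norm_prod vs" if "length vs \<le> Suc n" for vs
    proof (cases "length vs = Suc n")
      case True
      then show ?thesis
        using K'(2)[OF True] mult_right_mono[OF max.cobounded2[of K' K] prod_list_norm_nonneg[of vs]]
        by linarith
    next
      case False
      then have "length vs \<le> n" using that by simp
      then show ?thesis
        using K(2)[of vs] mult_right_mono[OF max.cobounded1[of K K'] prod_list_norm_nonneg[of vs]]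
        by linarith
    qed
    then show ?case using K(1) by (intro exI[of _ "max K K'"]) auto
  qed
  then show ?thesis using that by blast
qed

lemma deriv_family_multilinear: "deriv_family U D \<Longrightarrow> x \<in> U \<Longrightarrow> bounded_multilinear k (D x)"
  unfolding deriv_family_def by blast

lemma deriv_family_estimate:
  assumes "deriv_family U D" "x \<in> U" "0 < \<epsilon>"
  obtains \<delta> where "0 < \<delta>" "\<And>y vs. y \<in> U \<Longrightarrow> dist y x < \<delta> \<Longrightarrow> length vs = k \<Longrightarrow>
     norm (remainder D x y vs) \<le> \<epsilon> * norm (y - x) * norm_prod vs"
proof -
  have "\<exists>\<delta>>0. \<forall>y\<in>U. dist y x < \<delta> \<longrightarrow> (\<forall>vs. length vs = k \<longrightarrow>
     norm (remainder D x y vs) \<le> \<epsilon> * norm (y - x) * norm_prod vs)"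
    using assms unfolding deriv_family_def by blast
  then show ?thesis using that by blast
qed

lemma deriv_family_estimate_upto:
  assumes D: "deriv_family U D" "x \<in> U" "0 < \<epsilon>"
  obtains \<delta> where "0 < \<delta>" "\<And>y vs. y \<in> U \<Longrightarrow> dist y x < \<delta> \<Longrightarrow> length vs \<le> n \<Longrightarrow>
     norm (remainder D x y vs) \<le> \<epsilon> * norm (y - x) * norm_prod vs"
proof -
  have "\<exists>\<delta>>0. \<forall>y vs. y \<in> U \<longrightarrow> dist y x < \<delta> \<longrightarrow> length vs \<le> n \<longrightarrow>
     norm (remainder D x y vs) \<le> \<epsilon> * norm (y - x) * norm_prod vs"
  proof (induction n)
    case 0
    obtain d where "0 < d" "\<And>y vs. y \<in> U \<Longrightarrow> dist y x < d \<Longrightarrow> length vs = 0 \<Longrightarrow>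
     norm (remainder D x y vs) \<le> \<epsilon> * norm (y - x) * norm_prod vs"
      using deriv_family_estimate[OF D] by blast
    then show ?case by (intro exI[of _ d]) auto
  next
    case (Suc n)
    then obtain d1 where d1: "0 < d1" "\<And>y vs. y \<in> U \<Longrightarrow> dist y x < d1 \<Longrightarrow> length vs \<le> n \<Longrightarrow>
     norm (remainder D x y vs) \<le> \<epsilon> * norm (y - x) * norm_prod vs"
      by blast
    obtain d2 where d2: "0 < d2" "\<And>y vs. y \<in> U \<Longrightarrow> dist y x < d2 \<Longrightarrow> length vs = Suc n \<Longrightarrow>
     norm (remainder D x y vs) \<le> \<epsilon> * norm (y - x) * norm_prod vs"
      using deriv_family_estimate[OF D, of "Suc n"] by blast
    show ?case
      by (rule exI[of _ "min d1 d2"]) (use d1 d2 in \<open>auto simp: le_Suc_eq\<close>)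
  qed
  then show ?thesis using that by blast
qed

lemma bounded_multilinear_head:
  assumes "bounded_multilinear (Suc (length vs)) T"
  shows "bounded_linear (\<lambda>h. T (h # vs))"
proof -
  obtain K where K: "\<And>us. length us = Suc (length vs) \<Longrightarrow> norm (T us) \<le> K * norm_prod us"
    using bounded_multilinearD_bound[OF assms] by blast
  have lin: "linear (\<lambda>h. T (h # vs))"
    using bounded_multilinearD_linear[OF assms, of "[]" vs] by simp
  show ?thesis
  proof (rule bounded_linear_intro[where K = "K * norm_prod vs"])
    show "norm (T (h # vs)) \<le> norm h * (K * norm_prod vs)" for h
      using K[of "h # vs"] by (simp add: ac_simps)
  qed (use linear_add[OF lin] linear_scale[OF lin] in auto)
qed

lemma deriv_family_has_derivative:
  assumes D: "deriv_family U D" and "open U" "x \<in> U"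
  shows "((\<lambda>y. D y vs) has_derivative (\<lambda>h. D x (h # vs))) (at x)"
proof -
  have "((\<lambda>y. D y vs) has_derivative (\<lambda>h. D x (h # vs))) (at x within U)"
    unfolding has_derivative_within_alt
  proof (intro conjI allI impI)
    show "bounded_linear (\<lambda>h. D x (h # vs))"
      by (rule bounded_multilinear_head) (use D \<open>x \<in> U\<close> deriv_family_multilinear in blast)
    fix e :: real assume "0 < e"
    define P where "P = norm_prod vs + 1"
    have P: "0 < P" "norm_prod vs \<le> P"
      using prod_list_norm_nonneg[of vs] by (simp_all add: P_def)
    obtain \<delta> where d: "0 < \<delta>" "\<And>y us. y \<in> U \<Longrightarrow> dist y x < \<delta> \<Longrightarrow> length us = length vs \<Longrightarrow>
     norm (D y us - D x us - D x ((y - x) # us)) \<le> (e / P) * norm (y - x) * norm_prod us"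
      using deriv_family_estimate[OF D \<open>x \<in> U\<close>, of "e / P" "length vs"] \<open>0 < e\<close> P by auto
    have "norm (remainder D x y vs) \<le> e * norm (y - x)"
      if "y \<in> U" "norm (y - x) < \<delta>" for y
    proof -
      have "norm (remainder D x y vs) \<le> (e / P) * norm (y - x) * norm_prod vs"
        using d(2) that by (simp add: dist_norm)
      also have "\<dots> \<le> (e / P) * norm (y - x) * P"
        using P \<open>0 < e\<close> by (intro mult_left_mono) auto
      finally show ?thesis using P by simp
    qed
    then show "\<exists>d>0. \<forall>y\<in>U. norm (y - x) < d \<longrightarrow>
        norm (remainder D x y vs) \<le> e * norm (y - x)"
      using d(1) by blast
  qed
  then show ?thesis by (simp only: at_within_open[OF \<open>x \<in> U\<close> \<open>open U\<close>])
qed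

lemma deriv_family_subset:
  assumes D: "deriv_family U D" and "V \<subseteq> U"
  shows "deriv_family V D"
  unfolding deriv_family_def
proof (intro ballI allI conjI impI)
  fix x k assume "x \<in> V"
  then have x: "x \<in> U" using \<open>V \<subseteq> U\<close> by blast
  show "bounded_multilinear k (D x)" by (rule deriv_family_multilinear[OF D x])
  fix \<epsilon> :: real assume "0 < \<epsilon>"
  obtain \<delta> where d: "0 < \<delta>" "\<And>y vs. y \<in> U \<Longrightarrow> dist y x < \<delta> \<Longrightarrow> length vs = k \<Longrightarrow>
     norm (remainder D x y vs) \<le> \<epsilon> * norm (y - x) * norm_prod vs"
    using deriv_family_estimate[OF D x \<open>0 < \<epsilon>\<close>, of k] by blast
  show "\<exists>\<delta>>0. \<forall>y\<in>V. dist y x < \<delta> \<longrightarrow> (\<forall>vs. length vs = k \<longrightarrow>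
     norm (remainder D x y vs) \<le> \<epsilon> * norm (y - x) * norm_prod vs)"
    by (rule exI[of _ \<delta>]) (use d \<open>V \<subseteq> U\<close> in auto)
qed

lemma smooth_on_open_subset:
  assumes f: "smooth_on_open U f" and V: "open V" "V \<subseteq> U"
  shows "smooth_on_open V f"
proof -
  obtain D where "open U" and D: "\<forall>x\<in>U. D x [] = f x" "deriv_family U D"
    using smooth_on_openE[OF f] by blast
  show ?thesis
    by (rule smooth_on_openI[OF V(1) _ deriv_family_subset[OF D(2) V(2)]]) (use D(1) V(2) in blast)
qed

lemma smooth_on_open_const:
  assumes "open U"
  shows "smooth_on_open U (\<lambda>x. c)"
proof -
  define D :: "'a \<Rightarrow> 'a list \<Rightarrow> 'b" where "D x vs = (if vs = [] then c else 0)" for x vs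
  have lin: "linear (\<lambda>v. D x (us @ v # ws))" for x us ws
    by (simp add: D_def linear_zero)
  have bnd: "norm (D x vs) \<le> norm c * norm_prod vs" for x vs
    using prod_list_norm_nonneg[of vs] by (cases vs) (auto simp: D_def)
  have zero: "remainder D x y vs = 0" for x y vs
    by (simp add: D_def)
  have "deriv_family U D"
    unfolding deriv_family_def bounded_multilinear_def zero norm_zero
  proof (intro ballI allI conjI impI)
    show "\<exists>K. \<forall>vs. length vs = k \<longrightarrow> norm (D x vs) \<le> K * norm_prod vs" for x k
      using bnd by blast
    show "\<exists>\<delta>>0. \<forall>y\<in>U. dist y x < \<delta> \<longrightarrow> (\<forall>vs. length vs = k \<longrightarrow>
        0 \<le> \<epsilon> * norm (y - x) * norm_prod vs)" if "0 < \<epsilon>" for \<epsilon> :: real and x k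
      using that by (intro exI[of _ 1]) (simp add: prod_list_norm_nonneg)
  qed (rule lin)
  then show ?thesis
    by (rule smooth_on_openI[OF assms, rotated]) (simp add: D_def)
qed

lemma smooth_on_open_bounded_linear:
  assumes L: "bounded_linear L" and "open U"
  shows "smooth_on_open U L"
proof -
  define D where "D x vs = (case vs of [] \<Rightarrow> L x | [v] \<Rightarrow> L v | _ \<Rightarrow> 0)" for x vs
  interpret bounded_linear L by fact
  obtain K where K: "0 \<le> K" "\<And>x. norm (L x) \<le> norm x * K"
    using nonneg_bounded by blast
  have lin: "linear (\<lambda>v. D x (us @ v # ws))" for x us ws
    by (cases us; cases ws; cases "tl us")
      (auto simp: D_def linear_zero split: list.splits intro: linear_axioms)
  have bnd: "norm (D x vs) \<le> (norm (L x) + K) * norm_prod vs" for x vs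
  proof (cases vs rule: list.exhaust)
    case (Cons v ws)
    then show ?thesis
    proof (cases ws)
      case Nil
      have "norm (L v) \<le> K * norm v + norm (L x) * norm v"
        using K(2)[of v] by (simp add: add_increasing2 mult.commute)
      then have "norm (L v) \<le> (norm (L x) + K) * norm v"
        by (simp add: algebra_simps)
      then show ?thesis using Cons Nil by (simp add: D_def)
    next
      case (Cons w us)
      then show ?thesis using \<open>vs = v # ws\<close> K(1) prod_list_norm_nonneg[of vs] by (simp add: D_def)
    qed
  qed (use K in \<open>simp add: D_def\<close>)
  have zero: "remainder D x y vs = 0" for x y vs
    by (simp add: D_def diff split: list.splits)
  have "deriv_family U D"
    unfolding deriv_family_def bounded_multilinear_def zero norm_zero
  proof (intro ballI allI conjI impI)
    show "\<exists>K. \<forall>vs. length vs = k \<longrightarrow> norm (D x vs) \<le> K * norm_prod vs" for x k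
      using bnd by blast
    show "\<exists>\<delta>>0. \<forall>y\<in>U. dist y x < \<delta> \<longrightarrow> (\<forall>vs. length vs = k \<longrightarrow>
        0 \<le> \<epsilon> * norm (y - x) * norm_prod vs)" if "0 < \<epsilon>" for \<epsilon> :: real and x k
      using that by (intro exI[of _ 1]) (simp add: prod_list_norm_nonneg)
  qed (rule lin)
  then show ?thesis
    by (rule smooth_on_openI[OF \<open>open U\<close>, rotated]) (simp add: D_def)
qed

lemma smooth_on_open_add:
  assumes "smooth_on_open U f" "smooth_on_open U g"
  shows "smooth_on_open U (\<lambda>x. f x + g x)"
proof -
  obtain D1 where U: "open U" and D1: "\<forall>x\<in>U. D1 x [] = f x" "deriv_family U D1"
    using smooth_on_openE[OF assms(1)] by blast
  obtain D2 where D2: "\<forall>x\<in>U. D2 x [] = g x" "deriv_family U D2"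
    using smooth_on_openE[OF assms(2)] by blast
  have "deriv_family U (\<lambda>x vs. D1 x vs + D2 x vs)"
    unfolding deriv_family_def
  proof (intro ballI allI conjI impI)
    fix x k assume x: "x \<in> U"
    note B = deriv_family_multilinear[OF D1(2) x, of k] deriv_family_multilinear[OF D2(2) x, of k]
    show "bounded_multilinear k (\<lambda>vs. D1 x vs + D2 x vs)"
      unfolding bounded_multilinear_def
    proof (intro conjI allI impI)
      show "linear (\<lambda>v. D1 x (us @ v # ws) + D2 x (us @ v # ws))"
        if "length us + 1 + length ws = k" for us ws
        using linear_compose_add[OF bounded_multilinearD_linear[OF B(1) that] bounded_multilinearD_linear[OF B(2) that]] .
      obtain K1 where K1: "\<And>vs. length vs = k \<Longrightarrow> norm (D1 x vs) \<le> K1 * norm_prod vs"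
        using bounded_multilinearD_bound[OF B(1)] by blast
      obtain K2 where K2: "\<And>vs. length vs = k \<Longrightarrow> norm (D2 x vs) \<le> K2 * norm_prod vs"
        using bounded_multilinearD_bound[OF B(2)] by blast
      show "\<exists>K. \<forall>vs. length vs = k \<longrightarrow> norm (D1 x vs + D2 x vs) \<le> K * norm_prod vs"
        by (rule exI[of _ "K1 + K2"])
          (auto simp: distrib_right intro!: norm_triangle_le add_mono K1 K2)
    qed
    fix \<epsilon> :: real assume "0 < \<epsilon>"
    then have e2: "0 < \<epsilon> / 2" by simp
    obtain d1 where d1: "0 < d1" "\<And>y vs. y \<in> U \<Longrightarrow> dist y x < d1 \<Longrightarrow> length vs = k \<Longrightarrow>
     norm (remainder D1 x y vs) \<le> \<epsilon> / 2 * norm (y - x) * norm_prod vs"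
      using deriv_family_estimate[OF D1(2) x e2] by blast
    obtain d2 where d2: "0 < d2" "\<And>y vs. y \<in> U \<Longrightarrow> dist y x < d2 \<Longrightarrow> length vs = k \<Longrightarrow>
     norm (remainder D2 x y vs) \<le> \<epsilon> / 2 * norm (y - x) * norm_prod vs"
      using deriv_family_estimate[OF D2(2) x e2] by blast
    have "norm (D1 y vs + D2 y vs - (D1 x vs + D2 x vs) - (D1 x ((y - x) # vs) + D2 x ((y - x) # vs)))
       \<le> \<epsilon> * norm (y - x) * norm_prod vs"
      if "y \<in> U" "dist y x < min d1 d2" "length vs = k" for y vs
    proof -
      have "D1 y vs + D2 y vs - (D1 x vs + D2 x vs) - (D1 x ((y - x) # vs) + D2 x ((y - x) # vs))
        = (remainder D1 x y vs) + (remainder D2 x y vs)"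
        by simp
      also have "norm \<dots> \<le> \<epsilon> / 2 * norm (y - x) * norm_prod vs
          + \<epsilon> / 2 * norm (y - x) * norm_prod vs"
        using that d1(2) d2(2) by (intro norm_triangle_le add_mono) auto
      finally show ?thesis by (simp add: field_simps)
    qed
    then show "\<exists>\<delta>>0. \<forall>y\<in>U. dist y x < \<delta> \<longrightarrow> (\<forall>vs. length vs = k \<longrightarrow>
       norm (D1 y vs + D2 y vs - (D1 x vs + D2 x vs) - (D1 x ((y - x) # vs) + D2 x ((y - x) # vs)))
       \<le> \<epsilon> * norm (y - x) * norm_prod vs)"
      using d1(1) d2(1) by (intro exI[of _ "min d1 d2"]) auto
  qed
  then show ?thesis by (rule smooth_on_openI[OF U, rotated]) (simp add: D1 D2)
qed

text \<open>
  The derivative of order \<open>length vs\<close> of a bilinear product \<open>B f g\<close>, if \<open>P\<close> and \<open>Q\<close> are the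
  derivative families of \<open>f\<close> and \<open>g\<close> at a point: the sum, over all ways of distributing the directions
  \<open>vs\<close> among the two factors, of the products of the corresponding derivatives.  The recursion is
  chosen so that prefixing a direction, which is how a derivative family passes to the next order, is
  the product rule by definition.
\<close>

fun leibniz :: "('b \<Rightarrow> 'c \<Rightarrow> 'd::real_vector) \<Rightarrow> ('a list \<Rightarrow> 'b) \<Rightarrow> ('a list \<Rightarrow> 'c) \<Rightarrow> 'a list \<Rightarrow> 'd" where
  "leibniz B P Q [] = B (P []) (Q [])"
| "leibniz B P Q (v # vs) = leibniz B (\<lambda>us. P (v # us)) Q vs + leibniz B P (\<lambda>us. Q (v # us)) vs"

context bounded_bilinear
begin

lemma leibniz_add_left:
  "leibniz prod (\<lambda>us. P us + P' us) Q vs = leibniz prod P Q vs + leibniz prod P' Q vs"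
  by (induction vs arbitrary: P P' Q) (auto simp: add_left algebra_simps)

lemma leibniz_add_right:
  "leibniz prod P (\<lambda>us. Q us + Q' us) vs = leibniz prod P Q vs + leibniz prod P Q' vs"
  by (induction vs arbitrary: P Q Q') (auto simp: add_right algebra_simps)

lemma leibniz_scaleR_left:
  "leibniz prod (\<lambda>us. c *\<^sub>R P us) Q vs = c *\<^sub>R leibniz prod P Q vs"
  by (induction vs arbitrary: P Q) (auto simp: scaleR_left algebra_simps)

lemma leibniz_scaleR_right:
  "leibniz prod P (\<lambda>us. c *\<^sub>R Q us) vs = c *\<^sub>R leibniz prod P Q vs"
  by (induction vs arbitrary: P Q) (auto simp: scaleR_right algebra_simps)

lemma leibniz_diff_left:
  "leibniz prod (\<lambda>us. P us - P' us) Q vs = leibniz prod P Q vs - leibniz prod P' Q vs"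
  by (induction vs arbitrary: P P' Q) (auto simp: diff_left algebra_simps)

lemma leibniz_diff_right:
  "leibniz prod P (\<lambda>us. Q us - Q' us) vs = leibniz prod P Q vs - leibniz prod P Q' vs"
  by (induction vs arbitrary: P Q Q') (auto simp: diff_right algebra_simps)

text \<open>
  Each of the \<open>2 ^ length vs\<close> distributions of the directions contributes a term bounded by
  \<open>M * p * q\<close> times the product of all norms.
\<close>

lemma leibniz_bound:
  assumes "0 \<le> M" "\<And>a b. norm (prod a b) \<le> norm a * norm b * M"
    and "0 \<le> p" "0 \<le> q"
    and "\<And>us. length us \<le> length vs \<Longrightarrow> norm (P us) \<le> p * norm_prod us"
    and "\<And>us. length us \<le> length vs \<Longrightarrow> norm (Q us) \<le> q * norm_prod us"
  shows "norm (leibniz prod P Q vs) \<le> M * 2 ^ length vs * p * q * norm_prod vs"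
  using assms(3-)
proof (induction vs arbitrary: P Q p q)
  case Nil
  have "norm (prod (P []) (Q [])) \<le> norm (P []) * norm (Q []) * M" by (rule assms)
  also have "\<dots> \<le> p * q * M"
    using Nil(3)[of "[]"] Nil(4)[of "[]"] Nil(1,2) assms(1) by (intro mult_right_mono mult_mono) auto
  finally show ?case by (simp add: ac_simps)
next
  case (Cons v vs)
  have 1: "norm (leibniz prod (\<lambda>us. P (v # us)) Q vs)
      \<le> M * 2 ^ length vs * (p * norm v) * q * norm_prod vs"
  proof (rule Cons.IH)
    show "norm (P (v # us)) \<le> p * norm v * norm_prod us" if "length us \<le> length vs" for us
      using Cons.prems(3)[of "v # us"] that by (simp add: ac_simps)
  qed (use Cons.prems in auto)
  have 2: "norm (leibniz prod P (\<lambda>us. Q (v # us)) vs)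
      \<le> M * 2 ^ length vs * p * (q * norm v) * norm_prod vs"
  proof (rule Cons.IH)
    show "norm (Q (v # us)) \<le> q * norm v * norm_prod us" if "length us \<le> length vs" for us
      using Cons.prems(4)[of "v # us"] that by (simp add: ac_simps)
  qed (use Cons.prems in auto)
  have "norm (leibniz prod P Q (v # vs)) \<le>
     norm (leibniz prod (\<lambda>us. P (v # us)) Q vs) + norm (leibniz prod P (\<lambda>us. Q (v # us)) vs)"
    by (simp add: norm_triangle_ineq)
  also have "\<dots> \<le> M * 2 ^ length vs * (p * norm v) * q * norm_prod vs
     + M * 2 ^ length vs * p * (q * norm v) * norm_prod vs"
    using 1 2 by (rule add_mono)
  also have "\<dots> = M * 2 ^ length (v # vs) * p * q * norm_prod (v # vs)"
    by simp
  finally show ?case .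
qed

lemma leibniz_linear:
  assumes "\<And>us ws. linear (\<lambda>v. P (us @ v # ws))" "\<And>us ws. linear (\<lambda>v. Q (us @ v # ws))"
  shows "linear (\<lambda>v. leibniz prod P Q (us @ v # ws))"
  using assms
proof (induction us arbitrary: P Q)
  case Nil
  have "linear (\<lambda>v. P (v # us))" "linear (\<lambda>v. Q (v # us))" for us
    using Nil(1)[of "[]" us] Nil(2)[of "[]" us] by simp_all
  note PQ = linear_add[OF this(1)] linear_scale[OF this(1)] linear_add[OF this(2)] linear_scale[OF this(2)]
  show ?case
    by (intro linearI)
      (simp_all add: PQ leibniz_add_left leibniz_add_right leibniz_scaleR_left leibniz_scaleR_right
        algebra_simps)
next
  case (Cons u us)
  have "linear (\<lambda>v. leibniz prod (\<lambda>us. P (u # us)) Q (us @ v # ws))"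
    using Cons.prems(1)[of "u # _"] Cons.prems(2) by (intro Cons.IH) auto
  moreover have "linear (\<lambda>v. leibniz prod P (\<lambda>us. Q (u # us)) (us @ v # ws))"
    using Cons.prems(2)[of "u # _"] Cons.prems(1) by (intro Cons.IH) auto
  ultimately show ?case by (simp add: linear_compose_add)
qed

lemma leibniz_bounded_multilinear:
  assumes P: "\<And>k. bounded_multilinear k P" and Q: "\<And>k. bounded_multilinear k Q"
  shows "bounded_multilinear k (leibniz prod P Q)"
  unfolding bounded_multilinear_def
proof (intro conjI allI impI)
  show "linear (\<lambda>v. leibniz prod P Q (us @ v # ws))" for us ws
    by (rule leibniz_linear; rule bounded_multilinearD_linear[OF _ refl]; rule P Q)
  obtain M where M: "0 \<le> M" "\<And>a b. norm (prod a b) \<le> norm a * norm b * M"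
    using nonneg_bounded by blast
  obtain p where p: "0 \<le> p" "\<And>vs. length vs \<le> k \<Longrightarrow> norm (P vs) \<le> p * norm_prod vs"
    using bounded_multilinear_bound_upto[OF P] by blast
  obtain q where q: "0 \<le> q" "\<And>vs. length vs \<le> k \<Longrightarrow> norm (Q vs) \<le> q * norm_prod vs"
    using bounded_multilinear_bound_upto[OF Q] by blast
  show "\<exists>K. \<forall>vs. length vs = k \<longrightarrow> norm (leibniz prod P Q vs) \<le> K * norm_prod vs"
    by (rule exI[of _ "M * 2 ^ k * p * q"])
      (use leibniz_bound[OF M p(1) q(1), of _ P Q] p(2) q(2) in auto)
qed

text \<open>
  The remainder of the product splits into three Leibniz sums: remainder of \<open>f\<close> times \<open>g\<close>, \<open>f\<close> times
  remainder of \<open>g\<close>, and derivative of \<open>f\<close> times increment of \<open>g\<close>.  The last one is quadratic in the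
  increment of the argument, the other two are small by differentiability of the factors.
\<close>

lemma deriv_family_leibniz:
  assumes D1: "deriv_family U D1" and D2: "deriv_family U D2"
  shows "deriv_family U (\<lambda>x. leibniz prod (D1 x) (D2 x))"
  unfolding deriv_family_def
proof (intro ballI allI conjI impI)
  fix x k assume x: "x \<in> U"
  note B = deriv_family_multilinear[OF D1 x] deriv_family_multilinear[OF D2 x]
  show "bounded_multilinear k (leibniz prod (D1 x) (D2 x))"
    by (intro leibniz_bounded_multilinear B)
  fix \<epsilon> :: real assume "0 < \<epsilon>"
  obtain M where M: "0 \<le> M" "\<And>a b. norm (prod a b) \<le> norm a * norm b * M"
    using nonneg_bounded by blast
  obtain p where p: "0 \<le> p" "\<And>vs. length vs \<le> Suc k \<Longrightarrow> norm (D1 x vs) \<le> p * norm_prod vs"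
    using bounded_multilinear_bound_upto[OF B(1)] by blast
  obtain q where q: "0 \<le> q" "\<And>vs. length vs \<le> Suc k \<Longrightarrow> norm (D2 x vs) \<le> q * norm_prod vs"
    using bounded_multilinear_bound_upto[OF B(2)] by blast
  \<comment> \<open>\<open>A\<close> collects the constants of the three Leibniz sums, each of which is at most \<open>\<eta>\<close> times the
    corresponding summand, with \<open>\<eta>\<close> as modulus for both factors and also as bound for the increment\<close>
  define A where "A = M * 2 ^ k * ((2 * q + 1) + p + p * (1 + q)) + 1"
  have A: "0 < A" unfolding A_def using M(1) p(1) q(1)
    by (intro add_nonneg_pos mult_nonneg_nonneg) auto
  define \<eta> where "\<eta> = min 1 (\<epsilon> / A)"
  have eta: "0 < \<eta>" "\<eta> \<le> 1" "A * \<eta> \<le> \<epsilon>"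
    using A \<open>0 < \<epsilon>\<close> by (auto simp: \<eta>_def min_def field_simps)
  obtain d1 where d1: "0 < d1" "\<And>y vs. y \<in> U \<Longrightarrow> dist y x < d1 \<Longrightarrow> length vs \<le> k \<Longrightarrow>
     norm (remainder D1 x y vs) \<le> \<eta> * norm (y - x) * norm_prod vs"
    using deriv_family_estimate_upto[OF D1 x eta(1)] by blast
  obtain d2 where d2: "0 < d2" "\<And>y vs. y \<in> U \<Longrightarrow> dist y x < d2 \<Longrightarrow> length vs \<le> k \<Longrightarrow>
     norm (remainder D2 x y vs) \<le> \<eta> * norm (y - x) * norm_prod vs"
    using deriv_family_estimate_upto[OF D2 x eta(1)] by blast
  define d where "d = min \<eta> (min d1 d2)"
  have "norm (leibniz prod (D1 y) (D2 y) vs - leibniz prod (D1 x) (D2 x) vs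
        - leibniz prod (D1 x) (D2 x) ((y - x) # vs)) \<le> \<epsilon> * norm (y - x) * norm_prod vs"
    if y: "y \<in> U" "dist y x < d" and len: "length vs = k" for y vs
  proof -
    define h where "h = y - x"
    have h: "norm h \<le> \<eta>" "0 \<le> norm h" using y by (simp_all add: h_def d_def dist_norm)
    let ?P1 = "\<lambda>us. D1 y us - D1 x us - D1 x (h # us)" and ?Q1 = "\<lambda>us. D2 y us - D2 x us - D2 x (h # us)"
    have e1: "norm (?P1 us) \<le> (\<eta> * norm h) * norm_prod us" if "length us \<le> k" for us
      using d1(2)[OF y(1) _ that] y by (simp add: d_def h_def)
    have e2: "norm (?Q1 us) \<le> (\<eta> * norm h) * norm_prod us" if "length us \<le> k" for us
      using d2(2)[OF y(1) _ that] y by (simp add: d_def h_def)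
    have b1: "norm (D1 x (h # us)) \<le> (p * norm h) * norm_prod us" if "length us \<le> k" for us
      using p(2)[of "h # us"] that by (simp add: ac_simps)
    have b2: "norm (D2 x (h # us)) \<le> (q * norm h) * norm_prod us" if "length us \<le> k" for us
      using q(2)[of "h # us"] that by (simp add: ac_simps)
    have c2: "norm (D2 y us - D2 x us) \<le> ((1 + q) * norm h) * norm_prod us"
      if "length us \<le> k" for us
    proof -
      have "norm (D2 y us - D2 x us) \<le> norm (?Q1 us) + norm (D2 x (h # us))"
        by (metis diff_add_cancel norm_triangle_ineq)
      also have "\<dots> \<le> (\<eta> * norm h) * norm_prod us + (q * norm h) * norm_prod us"
        by (intro add_mono e2 b2 that)
      also have "\<dots> \<le> (1 * norm h) * norm_prod us + (q * norm h) * norm_prod us"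
        using eta by (intro add_right_mono mult_right_mono prod_list_norm_nonneg) auto
      finally show ?thesis by (simp add: algebra_simps)
    qed
    have a2: "norm (D2 y us) \<le> (2 * q + 1) * norm_prod us" if "length us \<le> k" for us
    proof -
      have "norm (D2 y us) \<le> norm (D2 y us - D2 x us) + norm (D2 x us)"
        by (metis diff_add_cancel norm_triangle_ineq)
      also have "\<dots> \<le> ((1 + q) * norm h) * norm_prod us + q * norm_prod us"
        using that by (intro add_mono c2 q(2)) auto
      also have "\<dots> \<le> ((1 + q) * 1) * norm_prod us + q * norm_prod us"
        using h eta q(1) by (intro add_right_mono mult_right_mono mult_left_mono prod_list_norm_nonneg) auto
      finally show ?thesis by (simp add: algebra_simps)
    qed
    have "leibniz prod (D1 y) (D2 y) vs - leibniz prod (D1 x) (D2 x) vs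
        - leibniz prod (D1 x) (D2 x) (h # vs)
      = leibniz prod ?P1 (D2 y) vs + leibniz prod (D1 x) ?Q1 vs
        + leibniz prod (\<lambda>us. D1 x (h # us)) (\<lambda>us. D2 y us - D2 x us) vs"
      unfolding leibniz_diff_left leibniz_diff_right by (simp add: algebra_simps)
    also have "norm \<dots> \<le> M * 2 ^ length vs * (\<eta> * norm h) * (2 * q + 1) * norm_prod vs
        + M * 2 ^ length vs * p * (\<eta> * norm h) * norm_prod vs
        + M * 2 ^ length vs * (p * norm h) * ((1 + q) * norm h) * norm_prod vs"
      using eta p(1) q(1) len
      by (intro norm_triangle_le add_mono leibniz_bound M e1 e2 a2 b1 c2 p(2)) auto
    also have "\<dots> \<le> M * 2 ^ length vs * (\<eta> * norm h) * (2 * q + 1) * norm_prod vs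
        + M * 2 ^ length vs * p * (\<eta> * norm h) * norm_prod vs
        + M * 2 ^ length vs * (p * norm h) * ((1 + q) * \<eta>) * norm_prod vs"
      using M(1) p(1) q(1) h
      by (intro add_left_mono mult_left_mono mult_right_mono prod_list_norm_nonneg mult_nonneg_nonneg) auto
    also have "\<dots> = ((A - 1) * \<eta>) * norm h * norm_prod vs"
      using len by (simp add: A_def algebra_simps)
    also have "\<dots> \<le> \<epsilon> * norm h * norm_prod vs"
      using eta by (intro mult_right_mono prod_list_norm_nonneg) (auto simp: algebra_simps)
    finally show ?thesis by (simp only: h_def)
  qed
  moreover have "0 < d" using d1 d2 eta by (simp add: d_def)
  ultimately show "\<exists>\<delta>>0. \<forall>y\<in>U. dist y x < \<delta> \<longrightarrow> (\<forall>vs. length vs = k \<longrightarrow>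
     norm (leibniz prod (D1 y) (D2 y) vs - leibniz prod (D1 x) (D2 x) vs
        - leibniz prod (D1 x) (D2 x) ((y - x) # vs)) \<le> \<epsilon> * norm (y - x) * norm_prod vs)"
    by blast
qed

lemma smooth_on_open_bilinear:
  assumes "smooth_on_open U f" "smooth_on_open U g"
  shows "smooth_on_open U (\<lambda>x. prod (f x) (g x))"
proof -
  obtain D1 where U: "open U" and D1: "\<forall>x\<in>U. D1 x [] = f x" "deriv_family U D1"
    using smooth_on_openE[OF assms(1)] by blast
  obtain D2 where D2: "\<forall>x\<in>U. D2 x [] = g x" "deriv_family U D2"
    using smooth_on_openE[OF assms(2)] by blast
  show ?thesis
    by (rule smooth_on_openI[OF U _ deriv_family_leibniz[OF D1(2) D2(2)]]) (simp add: D1 D2)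
qed

end

lemma smooth_on_open_linear_comp:
  assumes "bounded_linear L" "smooth_on_open U f"
  shows "smooth_on_open U (\<lambda>x. L (f x))"
proof -
  have "open U" using assms(2) smooth_on_open_iff by blast
  from bounded_bilinear.smooth_on_open_bilinear[OF bounded_bilinear_blinfun_apply
      smooth_on_open_const[OF this, of "Blinfun L"] assms(2)]
  show ?thesis by (simp add: bounded_linear_Blinfun_apply[OF assms(1)])
qed

lemma deriv_family_affine:
  assumes D: "deriv_family U D" and L: "bounded_linear L"
    and V: "V \<subseteq> (\<lambda>x. c + L x) -` U"
  shows "deriv_family V (\<lambda>x vs. D (c + L x) (map L vs))"
  unfolding deriv_family_def
proof (intro ballI allI conjI impI)
  interpret bounded_linear L by fact
  obtain K where K: "0 < K" "\<And>x. norm (L x) \<le> norm x * K" using pos_bounded by blast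
  have prodK: "norm_prod (map L vs) \<le> K ^ length vs * norm_prod vs" for vs
  proof (induction vs)
    case (Cons v vs)
    have "norm (L v) * norm_prod (map L vs)
        \<le> (norm v * K) * (K ^ length vs * norm_prod vs)"
      by (intro mult_mono K(2) Cons mult_nonneg_nonneg prod_list_norm_nonneg) (use K in auto)
    then show ?case by (simp add: ac_simps)
  qed auto
  fix x k assume x: "x \<in> V"
  then have x': "c + L x \<in> U" using V by auto
  note B = deriv_family_multilinear[OF D x', of k]
  show "bounded_multilinear k (\<lambda>vs. D (c + L x) (map L vs))"
    unfolding bounded_multilinear_def
  proof (intro conjI allI impI)
    show "linear (\<lambda>v. D (c + L x) (map L (us @ v # ws)))" if "length us + 1 + length ws = k" for us ws
      using linear_compose[OF linear_axioms bounded_multilinearD_linear[OF B, of "map L us" "map L ws"]] that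
      by (simp add: o_def)
    obtain K1 where K1: "0 \<le> K1" "\<And>vs. length vs = k \<Longrightarrow> norm (D (c + L x) vs) \<le> K1 * norm_prod vs"
      using bounded_multilinearD_bound[OF B] by blast
    have "norm (D (c + L x) (map L vs)) \<le> K1 * K ^ k * norm_prod vs" if "length vs = k" for vs
      using K1(2)[of "map L vs"] mult_left_mono[OF prodK[of vs] K1(1)] that by (simp add: mult.assoc)
    then show "\<exists>K. \<forall>vs. length vs = k \<longrightarrow> norm (D (c + L x) (map L vs)) \<le> K * norm_prod vs"
      by blast
  qed
  fix \<epsilon> :: real assume "0 < \<epsilon>"
  define e where "e = \<epsilon> / K ^ Suc k"
  have e: "0 < e" "e * K ^ Suc k = \<epsilon>" using \<open>0 < \<epsilon>\<close> K(1) by (simp_all add: e_def)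
  obtain d where d: "0 < d" "\<And>y vs. y \<in> U \<Longrightarrow> dist y (c + L x) < d \<Longrightarrow> length vs = k \<Longrightarrow>
     norm (D y vs - D (c + L x) vs - D (c + L x) ((y - (c + L x)) # vs))
       \<le> e * norm (y - (c + L x)) * norm_prod vs"
    using deriv_family_estimate[OF D x' e(1), of k] by blast
  have "norm (D (c + L y) (map L vs) - D (c + L x) (map L vs) - D (c + L x) (map L ((y - x) # vs)))
      \<le> \<epsilon> * norm (y - x) * norm_prod vs"
    if y: "y \<in> V" "dist y x < d / K" "length vs = k" for y vs
  proof -
    have "dist (c + L y) (c + L x) = norm (L (y - x))" by (simp add: dist_norm diff)
    also have "\<dots> \<le> norm (y - x) * K" by (rule K)
    also have "\<dots> < d" using y K(1) by (simp add: dist_norm field_simps)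
    finally have "dist (c + L y) (c + L x) < d" .
    moreover have "c + L y \<in> U" using y V by auto
    moreover have "c + L y - (c + L x) = L (y - x)" by (simp add: diff)
    ultimately have "norm (D (c + L y) (map L vs) - D (c + L x) (map L vs) - D (c + L x) (map L ((y - x) # vs)))
      \<le> e * norm (L (y - x)) * norm_prod (map L vs)"
      using d(2)[of "c + L y" "map L vs"] y(3) by (simp only: length_map list.map)
    also have "\<dots> \<le> e * (norm (y - x) * K) * (K ^ length vs * norm_prod vs)"
      by (intro mult_mono K(2) prodK prod_list_norm_nonneg mult_nonneg_nonneg) (use e K in auto)
    also have "\<dots> = (e * K ^ Suc k) * norm (y - x) * norm_prod vs"
      using y(3) by simp
    finally show ?thesis using e(2) by simp
  qed
  then show "\<exists>\<delta>>0. \<forall>y\<in>V. dist y x < \<delta> \<longrightarrow> (\<forall>vs. length vs = k \<longrightarrow>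
      norm (D (c + L y) (map L vs) - D (c + L x) (map L vs) - D (c + L x) (map L ((y - x) # vs)))
      \<le> \<epsilon> * norm (y - x) * norm_prod vs)"
    using d(1) K(1) by (intro exI[of _ "d / K"]) auto
qed

lemma smooth_on_open_affine:
  assumes f: "smooth_on_open U f" and L: "bounded_linear L"
  shows "smooth_on_open ((\<lambda>x. c + L x) -` U) (\<lambda>x. f (c + L x))"
proof -
  obtain D where U: "open U" and D: "\<forall>x\<in>U. D x [] = f x" "deriv_family U D"
    using smooth_on_openE[OF f] by blast
  have "open ((\<lambda>x. c + L x) -` U)"
    by (intro open_vimage U continuous_intros linear_continuous_on L)
  from smooth_on_openI[OF this _ deriv_family_affine[OF D(2) L subset_refl]] D(1) show ?thesis
    by simp
qed

lemma bounded_multilinear_last: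
  assumes "bounded_multilinear (Suc (length vs)) T"
  shows "bounded_linear (\<lambda>h. T (vs @ [h]))"
proof -
  obtain K where K: "\<And>us. length us = Suc (length vs) \<Longrightarrow> norm (T us) \<le> K * norm_prod us"
    using bounded_multilinearD_bound[OF assms] by blast
  have lin: "linear (\<lambda>h. T (vs @ [h]))"
    using bounded_multilinearD_linear[OF assms, of vs "[]"] by simp
  show ?thesis
  proof (rule bounded_linear_intro[where K = "K * norm_prod vs"])
    show "norm (T (vs @ [h])) \<le> norm h * (K * norm_prod vs)" for h
      using K[of "vs @ [h]"] by (simp add: ac_simps)
  qed (use linear_add[OF lin] linear_scale[OF lin] in auto)
qed

text \<open>
  The derivative of a smooth map, as a map into the bounded linear operators, is smooth again.  Its
  operator argument is put last: the leading positions of the list carry the directions in which the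
  family is differentiated, so no symmetry of the higher derivatives is involved.
\<close>

lemma deriv_family_derivative:
  assumes D: "deriv_family U D"
  shows "deriv_family U (\<lambda>x vs. Blinfun (\<lambda>h. D x (vs @ [h])))"
  unfolding deriv_family_def
proof (intro ballI allI conjI impI)
  have bl: "bounded_linear (\<lambda>h. D x (vs @ [h]))" if "x \<in> U" for x vs
    by (rule bounded_multilinear_last[OF deriv_family_multilinear[OF D that]])
  note app = bounded_linear_Blinfun_apply[OF bl]
  fix x k assume x: "x \<in> U"
  note B = deriv_family_multilinear[OF D x, of "Suc k"]
  show "bounded_multilinear k (\<lambda>vs. Blinfun (\<lambda>h. D x (vs @ [h])))"
    unfolding bounded_multilinear_def
  proof (intro conjI allI impI)
    fix us ws :: "'a list" assume len: "length us + 1 + length ws = k"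
    have lin: "linear (\<lambda>v. D x (us @ v # (ws @ [h])))" for h
      by (rule bounded_multilinearD_linear[OF B]) (use len in simp)
    show "linear (\<lambda>v. Blinfun (\<lambda>h. D x ((us @ v # ws) @ [h])))"
    proof (intro linearI blinfun_eqI)
      have A: "blinfun_apply (Blinfun (\<lambda>h. D x ((us @ v # ws) @ [h]))) i = D x (us @ v # (ws @ [i]))" for v i
        using app[OF x, of "us @ v # ws"] by simp
      fix v w i and c :: real
      show "blinfun_apply (Blinfun (\<lambda>h. D x ((us @ (v + w) # ws) @ [h]))) i =
        blinfun_apply (Blinfun (\<lambda>h. D x ((us @ v # ws) @ [h])) + Blinfun (\<lambda>h. D x ((us @ w # ws) @ [h]))) i"
        unfolding A blinfun.add_left by (rule linear_add[OF lin])
      show "blinfun_apply (Blinfun (\<lambda>h. D x ((us @ (c *\<^sub>R v) # ws) @ [h]))) i =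
        blinfun_apply (c *\<^sub>R Blinfun (\<lambda>h. D x ((us @ v # ws) @ [h]))) i"
        unfolding A blinfun.scaleR_left by (rule linear_scale[OF lin])
    qed
  next
    obtain K where K: "0 \<le> K" "\<And>vs. length vs = Suc k \<Longrightarrow> norm (D x vs) \<le> K * norm_prod vs"
      using bounded_multilinearD_bound[OF B] by blast
    have "norm (Blinfun (\<lambda>h. D x (vs @ [h]))) \<le> K * norm_prod vs" if "length vs = k" for vs
    proof (rule norm_blinfun_bound)
      show "norm (blinfun_apply (Blinfun (\<lambda>h. D x (vs @ [h]))) h) \<le> K * norm_prod vs * norm h" for h
        using K(2)[of "vs @ [h]"] that by (simp add: app[OF x] mult.assoc)
    qed (intro mult_nonneg_nonneg K prod_list_norm_nonneg)
    then show "\<exists>K. \<forall>vs. length vs = k \<longrightarrow> norm (Blinfun (\<lambda>h. D x (vs @ [h]))) \<le> K * norm_prod vs"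
      by blast
  qed
  fix \<epsilon> :: real assume "0 < \<epsilon>"
  obtain d where d: "0 < d" "\<And>y vs. y \<in> U \<Longrightarrow> dist y x < d \<Longrightarrow> length vs = Suc k \<Longrightarrow>
     norm (remainder D x y vs) \<le> \<epsilon> * norm (y - x) * norm_prod vs"
    using deriv_family_estimate[OF D x \<open>0 < \<epsilon>\<close>, of "Suc k"] by blast
  have "norm (Blinfun (\<lambda>h. D y (vs @ [h])) - Blinfun (\<lambda>h. D x (vs @ [h])) - Blinfun (\<lambda>h. D x (((y - x) # vs) @ [h])))
      \<le> \<epsilon> * norm (y - x) * norm_prod vs"
    if y: "y \<in> U" "dist y x < d" "length vs = k" for y vs
  proof (rule norm_blinfun_bound)
    show "norm (blinfun_apply (Blinfun (\<lambda>h. D y (vs @ [h])) - Blinfun (\<lambda>h. D x (vs @ [h])) - Blinfun (\<lambda>h. D x (((y - x) # vs) @ [h]))) h)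
        \<le> \<epsilon> * norm (y - x) * norm_prod vs * norm h" for h
      using d(2)[OF y(1,2), of "vs @ [h]"] y(3) app[OF x, of "(y - x) # vs"]
      by (simp add: app[OF x] app[OF y(1)] blinfun.diff_left mult.assoc)
  qed (use \<open>0 < \<epsilon>\<close> in \<open>intro mult_nonneg_nonneg prod_list_norm_nonneg; simp\<close>)
  then show "\<exists>\<delta>>0. \<forall>y\<in>U. dist y x < \<delta> \<longrightarrow> (\<forall>vs. length vs = k \<longrightarrow>
     norm (Blinfun (\<lambda>h. D y (vs @ [h])) - Blinfun (\<lambda>h. D x (vs @ [h])) - Blinfun (\<lambda>h. D x (((y - x) # vs) @ [h])))
      \<le> \<epsilon> * norm (y - x) * norm_prod vs)"
    using d(1) by blast
qed

lemma smooth_on_open_has_derivative: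
  assumes U: "open U" and D: "\<forall>x\<in>U. D x [] = f x" "deriv_family U D" and x: "x \<in> U"
  shows "(f has_derivative (\<lambda>h. D x [h])) (at x)"
proof -
  have "((\<lambda>y. D y []) has_derivative (\<lambda>h. D x [h])) (at x)"
    by (rule deriv_family_has_derivative[OF D(2) U x])
  then show ?thesis
    by (rule has_derivative_transform_within_open[OF _ U x]) (simp add: D(1))
qed

text \<open>
  Applying an operator to a vector is bilinear, so this is the product rule for the operator-valued
  derivative and the vector field.
\<close>

lemma smooth_on_open_apply_derivative:
  assumes f: "smooth_on_open U f" and X: "smooth_on_open U X"
  shows "smooth_on_open U (\<lambda>x. frechet_derivative f (at x) (X x))"
proof -
  obtain D where U: "open U" and D: "\<forall>x\<in>U. D x [] = f x" "deriv_family U D"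
    using smooth_on_openE[OF f] by blast
  define D' where "D' x vs = Blinfun (\<lambda>h. D x (vs @ [h]))" for x vs
  have D': "deriv_family U D'"
    unfolding D'_def by (rule deriv_family_derivative[OF D(2)])
  have "smooth_on_open U (\<lambda>x. D' x [])"
    by (rule smooth_on_openI[OF U refl D'])
  from bounded_bilinear.smooth_on_open_bilinear[OF bounded_bilinear_blinfun_apply this X]
  have "smooth_on_open U (\<lambda>x. blinfun_apply (D' x []) (X x))" .
  moreover have "blinfun_apply (D' x []) (X x) = frechet_derivative f (at x) (X x)" if x: "x \<in> U" for x
  proof -
    have "(f has_derivative (\<lambda>h. D x [h])) (at x)"
      by (rule smooth_on_open_has_derivative[OF U D x])
    then have "frechet_derivative f (at x) = (\<lambda>h. D x [h])"
      by (simp add: frechet_derivative_at[symmetric])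
    moreover have "bounded_linear (\<lambda>h. D x ([] @ [h]))"
      by (rule bounded_multilinear_last) (rule deriv_family_multilinear[OF D(2) x])
    ultimately show ?thesis
      by (simp add: D'_def bounded_linear_Blinfun_apply)
  qed
  ultimately show ?thesis
    unfolding smooth_on_open_iff by metis
qed

section \<open>Symmetry of the second derivative\<close>

text \<open>
  The function \<open>k t\<close> below is the difference of \<open>f\<close> along two parallel segments in direction \<open>u\<close>, a
  distance \<open>v\<close> apart, minus its expected linear growth.  Differentiability of the first derivative
  bounds \<open>k'\<close>, and the mean value inequality then bounds the second difference.
\<close>

lemma second_difference_estimate:
  assumes D: "deriv_family U D" and U: "open U" and x: "x \<in> U" and "0 < \<epsilon>"
  obtains \<delta> where "0 < \<delta>" "\<And>u v. norm u + norm v < \<delta> \<Longrightarrow>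
    norm (D (x + u + v) [] - D (x + u) [] - D (x + v) [] + D x [] - D x [v, u])
      \<le> 2 * \<epsilon> * (norm u + norm v)\<^sup>2"
proof -
  obtain r where r: "0 < r" "ball x r \<subseteq> U" using U x open_contains_ball by blast
  obtain d where d: "0 < d" "\<And>y vs. y \<in> U \<Longrightarrow> dist y x < d \<Longrightarrow> length vs = 1 \<Longrightarrow>
     norm (remainder D x y vs) \<le> \<epsilon> * norm (y - x) * norm_prod vs"
    using deriv_family_estimate[OF D x \<open>0 < \<epsilon>\<close>, of 1] by blast
  have lin2: "linear (\<lambda>h. D x (h # [u]))" for u
    using bounded_multilinear_head[OF deriv_family_multilinear[OF D x], of "[u]"]
    by (rule bounded_linear.linear)
  have "norm (D (x + u + v) [] - D (x + u) [] - D (x + v) [] + D x [] - D x [v, u])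
      \<le> 2 * \<epsilon> * (norm u + norm v)\<^sup>2" if small: "norm u + norm v < min r d" for u v
  proof -
    have pos: "norm (t *\<^sub>R u) \<le> norm u" "norm (t *\<^sub>R u + v) \<le> norm u + norm v" if "t \<in> {0..1}" for t :: real
    proof -
      show 1: "norm (t *\<^sub>R u) \<le> norm u" using that by (simp add: mult_left_le_one_le)
      show "norm (t *\<^sub>R u + v) \<le> norm u + norm v" using norm_triangle_ineq[of "t *\<^sub>R u" v] 1 by linarith
    qed
    have near: "x + (t *\<^sub>R u + v) \<in> U" "x + t *\<^sub>R u \<in> U" if "t \<in> {0..1}" for t
    proof -
      have "x + w \<in> U" if "norm w < r" for w
        using r(2) that by (auto simp: subset_iff dist_norm)
      moreover have "norm (t *\<^sub>R u + v) < r" "norm (t *\<^sub>R u) < r"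
        using pos[OF that] small norm_ge_zero[of v] by linarith+
      ultimately show "x + (t *\<^sub>R u + v) \<in> U" "x + t *\<^sub>R u \<in> U"
        by blast+
    qed
    define k where "k t = D (x + (t *\<^sub>R u + v)) [] - D (x + t *\<^sub>R u) [] - t *\<^sub>R D x [v, u]" for t :: real
    define k' where "k' t = D (x + (t *\<^sub>R u + v)) [u] - D (x + t *\<^sub>R u) [u] - D x [v, u]" for t :: real
    have der: "(k has_derivative (\<lambda>h. h *\<^sub>R k' t)) (at t within {0..1})" if t: "t \<in> {0..1}" for t
    proof -
      have l: "D y [h *\<^sub>R u] = h *\<^sub>R D y [u]" if "y \<in> U" for h y
      proof -
        have "linear (\<lambda>w. D y (w # []))"
          using bounded_multilinear_head[of "[]", OF deriv_family_multilinear[OF D that]]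
          by (rule bounded_linear.linear)
        from linear_scale[OF this] show ?thesis .
      qed
      have 1: "((\<lambda>y. D y []) has_derivative (\<lambda>h. D (x + (t *\<^sub>R u + v)) [h])) (at (x + (t *\<^sub>R u + v)))"
        by (rule deriv_family_has_derivative[OF D U near(1)[OF t]])
      have 2: "((\<lambda>y. D y []) has_derivative (\<lambda>h. D (x + t *\<^sub>R u) [h])) (at (x + t *\<^sub>R u))"
        by (rule deriv_family_has_derivative[OF D U near(2)[OF t]])
      have "((\<lambda>t. D (x + (t *\<^sub>R u + v)) []) has_derivative (\<lambda>h. D (x + (t *\<^sub>R u + v)) [h *\<^sub>R u])) (at t within {0..1})"
        by (rule has_derivative_compose[where f = "\<lambda>t. x + (t *\<^sub>R u + v)" and x = t, OF _ 1]) (auto intro!: derivative_eq_intros)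
      moreover have "((\<lambda>t. D (x + t *\<^sub>R u) []) has_derivative (\<lambda>h. D (x + t *\<^sub>R u) [h *\<^sub>R u])) (at t within {0..1})"
        by (rule has_derivative_compose[where f = "\<lambda>t. x + t *\<^sub>R u" and x = t, OF _ 2]) (auto intro!: derivative_eq_intros)
      moreover have "((\<lambda>t. t *\<^sub>R D x [v, u]) has_derivative (\<lambda>h. h *\<^sub>R D x [v, u])) (at t within {0..1})"
        by (auto intro!: derivative_eq_intros)
      ultimately have "(k has_derivative (\<lambda>h. D (x + (t *\<^sub>R u + v)) [h *\<^sub>R u] - D (x + t *\<^sub>R u) [h *\<^sub>R u]
          - h *\<^sub>R D x [v, u])) (at t within {0..1})"
        unfolding k_def by (intro has_derivative_diff)
      then show ?thesis
        unfolding l[OF near(1)[OF t]] l[OF near(2)[OF t]] k'_def scaleR_diff_right .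
    qed
    have bnd: "norm (k' t) \<le> 2 * \<epsilon> * (norm u + norm v)\<^sup>2" if t: "t \<in> {0..1}" for t
    proof -
      have "dist (x + (t *\<^sub>R u + v)) x < d" "dist (x + t *\<^sub>R u) x < d"
        using pos[OF t] small norm_ge_zero[of v] unfolding dist_norm add_diff_cancel_left' by linarith+
      then have 1: "norm (D (x + (t *\<^sub>R u + v)) [u] - D x [u] - D x [t *\<^sub>R u + v, u])
             \<le> \<epsilon> * norm (t *\<^sub>R u + v) * norm u"
        and 2: "norm (D (x + t *\<^sub>R u) [u] - D x [u] - D x [t *\<^sub>R u, u]) \<le> \<epsilon> * norm (t *\<^sub>R u) * norm u"
        using d(2)[OF near(1)[OF t], of "[u]"] d(2)[OF near(2)[OF t], of "[u]"] by simp_all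
      have "D x [t *\<^sub>R u + v, u] = D x [t *\<^sub>R u, u] + D x [v, u]"
        by (rule linear_add[OF lin2])
      then have "k' t = (D (x + (t *\<^sub>R u + v)) [u] - D x [u] - D x [t *\<^sub>R u + v, u])
          - (D (x + t *\<^sub>R u) [u] - D x [u] - D x [t *\<^sub>R u, u])"
        by (simp add: k'_def)
      also have "norm \<dots> \<le> \<epsilon> * norm (t *\<^sub>R u + v) * norm u + \<epsilon> * norm (t *\<^sub>R u) * norm u"
        using norm_triangle_ineq4 1 2 by (meson add_mono order_trans)
      also have "\<dots> \<le> \<epsilon> * (norm u + norm v) * (norm u + norm v) + \<epsilon> * (norm u + norm v) * (norm u + norm v)"
        using \<open>0 < \<epsilon>\<close> pos[OF t] norm_ge_zero[of v] norm_ge_zero[of u]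
        by (intro add_mono mult_mono) (auto intro: add_increasing2)
      finally show ?thesis by (simp add: power2_eq_square mult.assoc)
    qed
    have "norm (k 1 - k 0) \<le> 2 * \<epsilon> * (norm u + norm v)\<^sup>2 * norm (1 - 0 :: real)"
    proof (rule differentiable_bound[OF _ der])
      show "onorm (\<lambda>h. h *\<^sub>R k' t) \<le> 2 * \<epsilon> * (norm u + norm v)\<^sup>2" if "t \<in> {0..1}" for t
        by (rule onorm_bound) (use bnd[OF that] \<open>0 < \<epsilon>\<close> in \<open>auto simp: mult.commute[of "\<bar>_\<bar>"] intro: mult_right_mono\<close>)
    qed auto
    moreover have "k 1 - k 0 = D (x + u + v) [] - D (x + u) [] - D (x + v) [] + D x [] - D x [v, u]"
      by (simp add: k_def add.assoc)
    ultimately show ?thesis by simp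
  qed
  then show ?thesis using that[of "min r d"] r(1) d(1) by auto
qed

text \<open>
  The second difference is symmetric in the two directions and approximates both values of the second
  derivative, up to an error that is small compared with the square of the scale.
\<close>

lemma deriv_family_symmetric:
  assumes D: "deriv_family U D" and U: "open U" and x: "x \<in> U"
  shows "D x [u, v] = D x [v, u]"
proof -
  define C where "C = norm u + norm v + 1"
  have C: "0 < C" "norm u + norm v \<le> C" by (simp_all add: C_def add_nonneg_pos)
  have sc: "D x [s *\<^sub>R a, s *\<^sub>R b] = (s * s) *\<^sub>R D x [a, b]" for s a b
  proof -
    note m = deriv_family_multilinear[OF D x, of 2]
    have "linear (\<lambda>h. D x ([] @ h # [s *\<^sub>R b]))" "linear (\<lambda>h. D x ([a] @ h # []))"
      by (rule bounded_multilinearD_linear[OF m], simp)+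
    from linear_scale[OF this(1)] linear_scale[OF this(2)] show ?thesis by simp
  qed
  have "norm (D x [u, v] - D x [v, u]) \<le> e" if "0 < e" for e
  proof -
    define \<epsilon> where "\<epsilon> = e / (4 * C\<^sup>2)"
    have \<epsilon>: "0 < \<epsilon>" "4 * \<epsilon> * C\<^sup>2 = e" using that C by (simp_all add: \<epsilon>_def)
    obtain d where d: "0 < d" "\<And>u v. norm u + norm v < d \<Longrightarrow>
      norm (D (x + u + v) [] - D (x + u) [] - D (x + v) [] + D x [] - D x [v, u])
        \<le> 2 * \<epsilon> * (norm u + norm v)\<^sup>2"
      using second_difference_estimate[OF D U x \<epsilon>(1)] by blast
    define s where "s = d / (2 * C)"
    have s: "0 < s" "s * C < d" using C d by (simp_all add: s_def)
    have sm: "norm (s *\<^sub>R u) + norm (s *\<^sub>R v) \<le> s * C"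
      using s C by (simp add: distrib_left[symmetric])
    let ?F = "D (x + s *\<^sub>R u + s *\<^sub>R v) [] - D (x + s *\<^sub>R u) [] - D (x + s *\<^sub>R v) [] + D x []"
    have sq: "2 * \<epsilon> * (norm (s *\<^sub>R u) + norm (s *\<^sub>R v))\<^sup>2 \<le> 2 * \<epsilon> * (s * C)\<^sup>2"
      using sm \<epsilon> by (intro mult_left_mono power_mono) auto
    have 1: "norm (?F - D x [s *\<^sub>R v, s *\<^sub>R u]) \<le> 2 * \<epsilon> * (s * C)\<^sup>2"
      using d(2)[of "s *\<^sub>R u" "s *\<^sub>R v"] sm s sq by linarith
    have F: "D (x + s *\<^sub>R v + s *\<^sub>R u) [] - D (x + s *\<^sub>R v) [] - D (x + s *\<^sub>R u) [] + D x [] = ?F"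
      by (simp add: algebra_simps)
    have "norm (s *\<^sub>R v) + norm (s *\<^sub>R u) < d" using sm s by linarith
    from d(2)[OF this]
    have "norm (?F - D x [s *\<^sub>R u, s *\<^sub>R v]) \<le> 2 * \<epsilon> * (norm (s *\<^sub>R v) + norm (s *\<^sub>R u))\<^sup>2"
      unfolding F .
    also have "\<dots> \<le> 2 * \<epsilon> * (s * C)\<^sup>2"
      using sq unfolding add.commute[of "norm (s *\<^sub>R u)"] .
    finally have 2: "norm (?F - D x [s *\<^sub>R u, s *\<^sub>R v]) \<le> 2 * \<epsilon> * (s * C)\<^sup>2" .
    have "s\<^sup>2 * norm (D x [u, v] - D x [v, u]) = norm (D x [s *\<^sub>R u, s *\<^sub>R v] - D x [s *\<^sub>R v, s *\<^sub>R u])"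
      unfolding sc scaleR_diff_right[symmetric] by (simp add: power2_eq_square)
    also have "\<dots> = norm ((?F - D x [s *\<^sub>R v, s *\<^sub>R u]) - (?F - D x [s *\<^sub>R u, s *\<^sub>R v]))"
      by simp
    also have "\<dots> \<le> 2 * \<epsilon> * (s * C)\<^sup>2 + 2 * \<epsilon> * (s * C)\<^sup>2"
      using norm_triangle_ineq4 1 2 by (meson add_mono order_trans)
    also have "\<dots> = s\<^sup>2 * e" using \<epsilon>(2) by (simp add: power_mult_distrib)
    finally show ?thesis using s by simp
  qed
  then have "norm (D x [u, v] - D x [v, u]) \<le> 0" by (rule field_le_epsilon[where y = 0, simplified])
  then show ?thesis by simp
qed

section \<open>Derivatives along a subset\<close>

text \<open>
  A derivative within \<open>N\<close> is in general not unique, but the chain rule along curves in \<open>N\<close> determines it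
  on tangent vectors.  All computations with \<open>deriv_on\<close> rest on this.
\<close>

lemma has_vector_derivative_along_curve:
  assumes f: "(f has_derivative f') (at p within N)"
    and c: "c 0 = p" "(c has_vector_derivative v) (at 0)" "\<forall>\<^sub>F t in at 0. c t \<in> N"
  shows "((\<lambda>t. f (c t)) has_vector_derivative f' v) (at 0)"
proof -
  define T where "T = {t. c t \<in> N}"
  have at: "at 0 within T = at (0::real)"
    unfolding filter_eq_iff eventually_at_filter
  proof (intro allI iffI)
    have T: "\<forall>\<^sub>F t in nhds 0. t \<noteq> 0 \<longrightarrow> t \<in> T"
      using c(3) by (simp add: T_def eventually_at_filter)
    show "\<forall>\<^sub>F t in nhds 0. t \<noteq> 0 \<longrightarrow> t \<in> UNIV \<longrightarrow> P t"
      if "\<forall>\<^sub>F t in nhds 0. t \<noteq> 0 \<longrightarrow> t \<in> T \<longrightarrow> P t" for P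
      using T that by eventually_elim auto
    show "\<forall>\<^sub>F t in nhds 0. t \<noteq> 0 \<longrightarrow> t \<in> T \<longrightarrow> P t"
      if "\<forall>\<^sub>F t in nhds 0. t \<noteq> 0 \<longrightarrow> t \<in> UNIV \<longrightarrow> P t" for P
      using that by eventually_elim auto
  qed
  have "(c has_derivative (\<lambda>h. h *\<^sub>R v)) (at 0 within T)"
    using c(2) at by (simp add: has_vector_derivative_def)
  moreover have "(f has_derivative f') (at (c 0) within c ` T)"
    unfolding c(1) by (rule has_derivative_subset[OF f]) (auto simp: T_def)
  ultimately have "((\<lambda>t. f (c t)) has_derivative (\<lambda>h. f' (h *\<^sub>R v))) (at 0 within T)"
    by (rule has_derivative_in_compose)
  moreover have "f' (h *\<^sub>R v) = h *\<^sub>R f' v" for h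
    using has_derivative_linear[OF f] by (rule linear_scale)
  ultimately show ?thesis by (simp add: at has_vector_derivative_def)
qed

lemma deriv_on_eq:
  assumes f: "(f has_derivative f') (at p within N)" and v: "v \<in> tangent_space N p"
  shows "deriv_on N f p v = f' v"
proof -
  obtain c where c: "c 0 = p" "(c has_vector_derivative v) (at 0)" "\<forall>\<^sub>F t in at 0. c t \<in> N"
    using v unfolding tangent_space_def by blast
  have "(f has_derivative frechet_derivative f (at p within N)) (at p within N)"
    using f frechet_derivative_works differentiable_def by blast
  from has_vector_derivative_along_curve[OF this c] has_vector_derivative_along_curve[OF f c]
  show ?thesis unfolding deriv_on_def by (rule vector_derivative_unique_at)
qed

lemma has_derivative_within_cong:
  assumes "\<And>q. q \<in> N \<Longrightarrow> f q = g q" "p \<in> N"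
  shows "(f has_derivative f') (at p within N) \<longleftrightarrow> (g has_derivative f') (at p within N)"
proof
  show "(g has_derivative f') (at p within N)" if "(f has_derivative f') (at p within N)"
    by (rule has_derivative_transform[OF assms(2) _ that]) (simp add: assms(1))
  show "(f has_derivative f') (at p within N)" if "(g has_derivative f') (at p within N)"
    by (rule has_derivative_transform[OF assms(2) _ that]) (simp add: assms(1))
qed

lemma deriv_on_cong:
  assumes "\<And>q. q \<in> N \<Longrightarrow> f q = g q" "p \<in> N"
  shows "deriv_on N f p = deriv_on N g p"
proof -
  have "(\<lambda>f'. (f has_derivative f') (at p within N)) = (\<lambda>f'. (g has_derivative f') (at p within N))"
    using has_derivative_within_cong[of N f g, OF assms] by blast
  then show ?thesis by (simp add: deriv_on_def frechet_derivative_def fun_eq_iff)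
qed

lemma smooth_onE:
  assumes "smooth_on N f" "p \<in> N"
  obtains U g where "p \<in> U" "smooth_on_open U g" "\<forall>x\<in>N \<inter> U. f x = g x"
  using assms unfolding smooth_on_def by blast

lemma smooth_on_open_imp_differentiable:
  assumes "smooth_on_open U f" "x \<in> U"
  shows "(f has_derivative frechet_derivative f (at x)) (at x)"
proof -
  obtain D where U: "open U" and D: "\<forall>x\<in>U. D x [] = f x" "deriv_family U D"
    using smooth_on_openE[OF assms(1)] by blast
  from smooth_on_open_has_derivative[OF U D assms(2)] show ?thesis
    by (simp add: frechet_derivative_at[symmetric])
qed

lemma has_derivative_local_extension:
  assumes "(g has_derivative g') (at p)" "open U" "p \<in> U" "p \<in> N" "\<forall>x\<in>N \<inter> U. f x = g x"
  shows "(f has_derivative g') (at p within N)"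
proof -
  obtain d where d: "0 < d" "ball p d \<subseteq> U" using assms(2,3) open_contains_ball by blast
  have "(g has_derivative g') (at p within N)" using assms(1) by (rule has_derivative_at_withinI)
  then show ?thesis
    by (rule has_derivative_transform_within[OF _ d(1) assms(4)])
      (use d(2) assms(5) in \<open>auto simp: subset_iff dist_commute\<close>)
qed

lemma smooth_on_has_derivative:
  assumes "smooth_on N f" "p \<in> N"
  shows "(f has_derivative deriv_on N f p) (at p within N)"
proof -
  obtain U g where U: "p \<in> U" "smooth_on_open U g" "\<forall>x\<in>N \<inter> U. f x = g x"
    using smooth_onE[OF assms] by blast
  then have "open U" by (simp add: smooth_on_open_iff)
  from has_derivative_local_extension[OF smooth_on_open_imp_differentiable[OF U(2,1)] this U(1) assms(2) U(3)]
  have "f differentiable (at p within N)" unfolding differentiable_def by blast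
  then have "(f has_derivative frechet_derivative f (at p within N)) (at p within N)"
    by (simp add: frechet_derivative_works)
  moreover have "deriv_on N f p = frechet_derivative f (at p within N)"
    by (simp add: deriv_on_def fun_eq_iff)
  ultimately show ?thesis by simp
qed

lemma linear_deriv_on: "smooth_on N f \<Longrightarrow> p \<in> N \<Longrightarrow> linear (deriv_on N f p)"
  by (rule has_derivative_linear[OF smooth_on_has_derivative])

lemma smooth_on_open_imp_smooth_on: "smooth_on_open U f \<Longrightarrow> N \<subseteq> U \<Longrightarrow> smooth_on N f"
  unfolding smooth_on_def by blast

lemma smooth_on_const: "smooth_on N (\<lambda>x. c)"
  by (rule smooth_on_open_imp_smooth_on[OF smooth_on_open_const[OF open_UNIV]]) simp

lemma smooth_on_bounded_linear: "bounded_linear L \<Longrightarrow> smooth_on N L"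
  by (rule smooth_on_open_imp_smooth_on[OF smooth_on_open_bounded_linear[OF _ open_UNIV]]) simp_all

lemma smooth_on_ident: "smooth_on N (\<lambda>x. x)"
  by (rule smooth_on_bounded_linear[OF bounded_linear_ident])

lemma smooth_on_common:
  assumes "smooth_on N f" "smooth_on N g" "p \<in> N"
  shows "\<exists>U f' g'. p \<in> U \<and> open U \<and> smooth_on_open U f' \<and> smooth_on_open U g' \<and>
    (\<forall>x\<in>N \<inter> U. f x = f' x) \<and> (\<forall>x\<in>N \<inter> U. g x = g' x)"
proof -
  obtain U f' where U: "p \<in> U" "smooth_on_open U f'" "\<forall>x\<in>N \<inter> U. f x = f' x"
    using smooth_onE[OF assms(1,3)] by blast
  obtain V g' where V: "p \<in> V" "smooth_on_open V g'" "\<forall>x\<in>N \<inter> V. g x = g' x"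
    using smooth_onE[OF assms(2,3)] by blast
  have o: "open (U \<inter> V)" using U(2) V(2) by (auto simp: smooth_on_open_iff)
  show ?thesis
  proof (intro exI[of _ "U \<inter> V"] exI[of _ f'] exI[of _ g'] conjI)
    show "smooth_on_open (U \<inter> V) f'" by (rule smooth_on_open_subset[OF U(2) o]) blast
    show "smooth_on_open (U \<inter> V) g'" by (rule smooth_on_open_subset[OF V(2) o]) blast
    show "\<forall>x\<in>N \<inter> (U \<inter> V). f x = f' x" by (intro ballI bspec[OF U(3)]) blast
    show "\<forall>x\<in>N \<inter> (U \<inter> V). g x = g' x" by (intro ballI bspec[OF V(3)]) blast
  qed (use U(1) V(1) o in simp_all)
qed

lemma smooth_on_add:
  assumes "smooth_on N f" "smooth_on N g"
  shows "smooth_on N (\<lambda>x. f x + g x)"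
  unfolding smooth_on_def
proof
  fix p assume "p \<in> N"
  then obtain U f' g' where "p \<in> U" "smooth_on_open U f'" "smooth_on_open U g'"
    "\<forall>x\<in>N \<inter> U. f x = f' x" "\<forall>x\<in>N \<inter> U. g x = g' x"
    using smooth_on_common[OF assms] by meson
  then show "\<exists>U h. p \<in> U \<and> smooth_on_open U h \<and> (\<forall>x\<in>N \<inter> U. f x + g x = h x)"
    by (intro exI[of _ U] exI[of _ "\<lambda>x. f' x + g' x"]) (auto intro: smooth_on_open_add)
qed

lemma (in bounded_bilinear) smooth_on_bilinear:
  assumes "smooth_on N f" "smooth_on N g"
  shows "smooth_on N (\<lambda>x. prod (f x) (g x))"
  unfolding smooth_on_def
proof
  fix p assume "p \<in> N"
  then obtain U f' g' where "p \<in> U" "smooth_on_open U f'" "smooth_on_open U g'"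
    "\<forall>x\<in>N \<inter> U. f x = f' x" "\<forall>x\<in>N \<inter> U. g x = g' x"
    using smooth_on_common[OF assms] by meson
  then show "\<exists>U h. p \<in> U \<and> smooth_on_open U h \<and> (\<forall>x\<in>N \<inter> U. prod (f x) (g x) = h x)"
    by (intro exI[of _ U] exI[of _ "\<lambda>x. prod (f' x) (g' x)"]) (auto intro: smooth_on_open_bilinear)
qed

lemmas smooth_on_scaleR = bounded_bilinear.smooth_on_bilinear[OF bounded_bilinear_scaleR]
lemmas smooth_on_mult = bounded_bilinear.smooth_on_bilinear[OF bounded_bilinear_mult]
lemmas smooth_on_inner = bounded_bilinear.smooth_on_bilinear[OF bounded_bilinear_inner]

lemma smooth_on_linear_comp:
  assumes "bounded_linear L" "smooth_on N f"
  shows "smooth_on N (\<lambda>x. L (f x))"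
  unfolding smooth_on_def
proof
  fix p assume "p \<in> N"
  then obtain U f' where "p \<in> U" "smooth_on_open U f'" "\<forall>x\<in>N \<inter> U. f x = f' x"
    using smooth_onE[OF assms(2)] by blast
  then show "\<exists>U h. p \<in> U \<and> smooth_on_open U h \<and> (\<forall>x\<in>N \<inter> U. L (f x) = h x)"
    by (intro exI[of _ U] exI[of _ "\<lambda>x. L (f' x)"]) (auto intro: smooth_on_open_linear_comp[OF assms(1)])
qed

lemma smooth_on_diff:
  fixes f g :: "'a::real_normed_vector \<Rightarrow> 'b::real_normed_vector"
  assumes "smooth_on N f" "smooth_on N g"
  shows "smooth_on N (\<lambda>x. f x - g x)"
  using smooth_on_add[OF assms(1) smooth_on_linear_comp[OF bounded_linear_minus[OF bounded_linear_ident] assms(2)]]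
  by simp

lemma smooth_on_fst: "smooth_on N f \<Longrightarrow> smooth_on N (\<lambda>x. fst (f x))"
  by (rule smooth_on_linear_comp[OF bounded_linear_fst])

lemma smooth_on_snd: "smooth_on N f \<Longrightarrow> smooth_on N (\<lambda>x. snd (f x))"
  by (rule smooth_on_linear_comp[OF bounded_linear_snd])

lemma smooth_on_Pair:
  assumes "smooth_on N f" "smooth_on N g"
  shows "smooth_on N (\<lambda>x. (f x, g x))"
proof -
  have "bounded_linear (\<lambda>u. (u, 0))" "bounded_linear (\<lambda>u. (0, u))"
    by (intro bounded_linear_Pair bounded_linear_ident bounded_linear_zero)+
  from smooth_on_add[OF smooth_on_linear_comp[OF this(1) assms(1)] smooth_on_linear_comp[OF this(2) assms(2)]]
  show ?thesis by simp
qed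

lemma smooth_on_affine_comp:
  assumes f: "smooth_on M f" and L: "bounded_linear L" and M: "\<And>x. x \<in> N \<Longrightarrow> c + L x \<in> M"
  shows "smooth_on N (\<lambda>x. f (c + L x))"
  unfolding smooth_on_def
proof
  fix p assume "p \<in> N"
  then obtain U g where U: "c + L p \<in> U" "smooth_on_open U g" "\<forall>x\<in>M \<inter> U. f x = g x"
    using smooth_onE[OF f M] by blast
  from smooth_on_open_affine[OF U(2) L, of c] U(1,3) M
  show "\<exists>U h. p \<in> U \<and> smooth_on_open U h \<and> (\<forall>x\<in>N \<inter> U. f (c + L x) = h x)"
    by (intro exI[of _ "(\<lambda>x. c + L x) -` U"] exI[of _ "\<lambda>x. g (c + L x)"]) auto
qed

lemma smooth_on_deriv_on:
  assumes f: "smooth_on N f" and X: "smooth_on N X" and T: "\<And>q. q \<in> N \<Longrightarrow> X q \<in> tangent_space N q"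
  shows "smooth_on N (\<lambda>q. deriv_on N f q (X q))"
  unfolding smooth_on_def
proof
  fix p assume "p \<in> N"
  then obtain U f' X' where U: "p \<in> U" "open U" and f': "smooth_on_open U f'" and X': "smooth_on_open U X'"
    and eq: "\<forall>x\<in>N \<inter> U. f x = f' x" "\<forall>x\<in>N \<inter> U. X x = X' x"
    using smooth_on_common[OF f X] by meson
  have "deriv_on N f q (X q) = frechet_derivative f' (at q) (X' q)" if q: "q \<in> N \<inter> U" for q
  proof -
    have "(f has_derivative frechet_derivative f' (at q)) (at q within N)"
      by (rule has_derivative_local_extension[OF smooth_on_open_imp_differentiable[OF f'] U(2) _ _ eq(1)])
        (use q in auto)
    from deriv_on_eq[OF this T] eq(2) q show ?thesis by simp
  qed
  then show "\<exists>U h. p \<in> U \<and> smooth_on_open U h \<and> (\<forall>x\<in>N \<inter> U. deriv_on N f x (X x) = h x)"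
    using U(1) smooth_on_open_apply_derivative[OF f' X'] by blast
qed

lemma deriv_on_add:
  assumes "smooth_on N f" "smooth_on N g" "p \<in> N" "v \<in> tangent_space N p"
  shows "deriv_on N (\<lambda>q. f q + g q) p v = deriv_on N f p v + deriv_on N g p v"
  using has_derivative_add[OF smooth_on_has_derivative[OF assms(1,3)] smooth_on_has_derivative[OF assms(2,3)]]
  by (rule deriv_on_eq[OF _ assms(4)])

lemma (in bounded_bilinear) deriv_on_bilinear:
  assumes "smooth_on N f" "smooth_on N g" "p \<in> N" "v \<in> tangent_space N p"
  shows "deriv_on N (\<lambda>q. prod (f q) (g q)) p v = prod (deriv_on N f p v) (g p) + prod (f p) (deriv_on N g p v)"
  using deriv_on_eq[OF FDERIV[OF smooth_on_has_derivative[OF assms(1,3)] smooth_on_has_derivative[OF assms(2,3)]] assms(4)]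
  by (simp add: add.commute)

lemmas deriv_on_scaleR = bounded_bilinear.deriv_on_bilinear[OF bounded_bilinear_scaleR]
lemmas deriv_on_inner = bounded_bilinear.deriv_on_bilinear[OF bounded_bilinear_inner]

lemma deriv_on_Pair:
  assumes "smooth_on N f" "smooth_on N g" "p \<in> N" "v \<in> tangent_space N p"
  shows "deriv_on N (\<lambda>q. (f q, g q)) p v = (deriv_on N f p v, deriv_on N g p v)"
  using has_derivative_Pair[OF smooth_on_has_derivative[OF assms(1,3)] smooth_on_has_derivative[OF assms(2,3)]]
  by (rule deriv_on_eq[OF _ assms(4)])

lemma deriv_on_bounded_linear:
  assumes "bounded_linear L" "v \<in> tangent_space N p"
  shows "deriv_on N L p v = L v"
  using bounded_linear_imp_has_derivative[OF assms(1)] by (rule deriv_on_eq[OF _ assms(2)])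

text \<open>
  Writing \<open>Z\<close> as the restriction of a smooth map of the ambient space, both iterated derivatives
  consist of a second derivative, which is symmetric and cancels, and a first derivative applied to the
  derivative of a vector field.  The latter vectors need not be tangent, and their images are not
  determined by \<open>Z\<close> on \<open>N\<close> alone; only their difference, the Lie bracket, is tangent.
\<close>

lemma deriv_on_commutator:
  assumes Z: "smooth_on N Z" and U: "smooth_on N U" "\<And>q. q \<in> N \<Longrightarrow> U q \<in> tangent_space N q"
    and V: "smooth_on N V" "\<And>q. q \<in> N \<Longrightarrow> V q \<in> tangent_space N q" and p: "p \<in> N"
    and br: "lie_bracket N U V p \<in> tangent_space N p"
  shows "deriv_on N (\<lambda>q. deriv_on N Z q (V q)) p (U p) - deriv_on N (\<lambda>q. deriv_on N Z q (U q)) p (V p)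
    = deriv_on N Z p (lie_bracket N U V p)"
proof -
  obtain W Z' where pW: "p \<in> W" and Z': "smooth_on_open W Z'" "\<forall>x\<in>N \<inter> W. Z x = Z' x"
    using smooth_onE[OF Z p] by blast
  obtain D where W: "open W" and D: "\<forall>x\<in>W. D x [] = Z' x" "deriv_family W D"
    using smooth_on_openE[OF Z'(1)] by blast
  define D' where "D' x vs = Blinfun (\<lambda>h. D x (vs @ [h]))" for x vs
  have D': "deriv_family W D'"
    unfolding D'_def by (rule deriv_family_derivative[OF D(2)])
  have app: "blinfun_apply (D' x vs) h = D x (vs @ [h])" if "x \<in> W" for x vs h
    unfolding D'_def
    by (simp add: bounded_linear_Blinfun_apply
        bounded_multilinear_last[OF deriv_family_multilinear[OF D(2) that]])
  have Zder: "deriv_on N Z q v = blinfun_apply (D' q []) v"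
    if "q \<in> N \<inter> W" "v \<in> tangent_space N q" for q v
  proof -
    have "(Z has_derivative (\<lambda>h. D q [h])) (at q within N)"
      by (rule has_derivative_local_extension[OF smooth_on_open_has_derivative[OF W D] W _ _ Z'(2)])
        (use that in auto)
    from deriv_on_eq[OF this that(2)] show ?thesis using app[of q "[]" v] that(1) by simp
  qed
  have second: "deriv_on N (\<lambda>q. deriv_on N Z q (Y q)) p v
       = D p [v, Y p] + blinfun_apply (D' p []) (deriv_on N Y p v)"
    if Y: "smooth_on N Y" "\<And>q. q \<in> N \<Longrightarrow> Y q \<in> tangent_space N q" and v: "v \<in> tangent_space N p" for Y v
  proof -
    have "((\<lambda>q. D' q []) has_derivative (\<lambda>h. D' p [h])) (at p within N)"
      by (rule has_derivative_at_withinI[OF deriv_family_has_derivative[OF D' W pW]])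
    from bounded_bilinear.FDERIV[OF bounded_bilinear_blinfun_apply this smooth_on_has_derivative[OF Y(1) p]]
    have der: "((\<lambda>q. blinfun_apply (D' q []) (Y q)) has_derivative
        (\<lambda>h. blinfun_apply (D' p []) (deriv_on N Y p h) + blinfun_apply (D' p [h]) (Y p))) (at p within N)" .
    obtain d where d: "0 < d" "ball p d \<subseteq> W" using W pW open_contains_ball by blast
    have "((\<lambda>q. deriv_on N Z q (Y q)) has_derivative
        (\<lambda>h. blinfun_apply (D' p []) (deriv_on N Y p h) + blinfun_apply (D' p [h]) (Y p))) (at p within N)"
      by (rule has_derivative_transform_within[OF der d(1) p])
        (use d(2) Y(2) in \<open>auto simp: Zder subset_iff dist_commute\<close>)
    from deriv_on_eq[OF this v] show ?thesis using app[OF pW, of "[v]" "Y p"] by (simp add: add.commute)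
  qed
  have "D p [U p, V p] = D p [V p, U p]"
    by (rule deriv_family_symmetric[OF D(2) W pW])
  moreover have "deriv_on N Z p (lie_bracket N U V p) = blinfun_apply (D' p []) (lie_bracket N U V p)"
    by (rule Zder[OF _ br]) (use p pW in simp)
  ultimately show ?thesis
    using second[OF V U(2)[OF p]] second[OF U V(2)[OF p]]
    by (simp add: lie_bracket_def blinfun.diff_right)
qed

section \<open>Connections on submanifolds\<close>

lemma is_levi_civitaD:
  assumes "is_levi_civita N G nab" "U \<in> vector_fields N" "V \<in> vector_fields N"
  shows "nab U V \<in> vector_fields N"
    and "p \<in> N \<Longrightarrow> nab U V p - nab V U p = lie_bracket N U V p"
    and "p \<in> N \<Longrightarrow> Z \<in> vector_fields N \<Longrightarrow>
      deriv_on N (\<lambda>q. G q (V q) (Z q)) p (U p) = G p (nab U V p) (Z p) + G p (V p) (nab U Z p)"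
proof -
  note A = assms(1)[unfolded is_levi_civita_def]
  note A6 = A[THEN conjunct2, THEN conjunct2, THEN conjunct2, THEN conjunct2, THEN conjunct2, THEN conjunct2]
  show "nab U V \<in> vector_fields N"
    using A[THEN conjunct1] assms(2,3) by blast
  show "nab U V p - nab V U p = lie_bracket N U V p" if "p \<in> N"
    using A6[THEN conjunct1] assms(2,3) that by blast
  show "deriv_on N (\<lambda>q. G q (V q) (Z q)) p (U p) = G p (nab U V p) (Z p) + G p (V p) (nab U Z p)"
    if "p \<in> N" "Z \<in> vector_fields N"
    using A6[THEN conjunct2] assms(2,3) that by blast
qed

text \<open>
  A covariant derivative of the form \<open>\<nabla>\<^sub>U V = DV(U) + \<Gamma>(U, V)\<close>, where \<open>DV(U)\<close> is the derivative in the
  ambient vector space and the symmetric bilinear correction \<open>\<Gamma>\<close> depends smoothly on the base point.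
  It contains both the normal correction that projects \<open>DV(U)\<close> back to the tangent space and the
  Christoffel symbols of the metric.  The last assumption says that \<open>d\<Gamma> p u\<close> is the derivative of \<open>\<Gamma>\<close> in
  direction \<open>u\<close>; it is stated along vector fields, because only there is it determined.
\<close>

locale submanifold_connection =
  fixes N :: "'a::real_normed_vector set"
    and G :: "'a \<Rightarrow> 'a \<Rightarrow> 'a \<Rightarrow> real"
    and \<Gamma> :: "'a \<Rightarrow> 'a \<Rightarrow> 'a \<Rightarrow> 'a"
    and d\<Gamma> :: "'a \<Rightarrow> 'a \<Rightarrow> 'a \<Rightarrow> 'a \<Rightarrow> 'a"
  assumes subspace_tangent: "p \<in> N \<Longrightarrow> subspace (tangent_space N p)"
    and extension: "p \<in> N \<Longrightarrow> v \<in> tangent_space N p \<Longrightarrow> \<exists>V\<in>vector_fields N. V p = v"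
    and metric_linear: "linear (G p u)"
    and metric_sym: "G p u v = G p v u"
    and metric_definite: "p \<in> N \<Longrightarrow> u \<in> tangent_space N p \<Longrightarrow> G p u u = 0 \<Longrightarrow> u = 0"
    and \<Gamma>_linear: "linear (\<Gamma> p u)"
    and \<Gamma>_sym: "\<Gamma> p u v = \<Gamma> p v u"
    and \<Gamma>_smooth: "smooth_on N U \<Longrightarrow> smooth_on N V \<Longrightarrow> smooth_on N (\<lambda>q. \<Gamma> q (U q) (V q))"
    and \<Gamma>_tangent: "U \<in> vector_fields N \<Longrightarrow> V \<in> vector_fields N \<Longrightarrow> p \<in> N \<Longrightarrow>
      deriv_on N V p (U p) + \<Gamma> p (U p) (V p) \<in> tangent_space N p"
    and \<Gamma>_metric: "U \<in> vector_fields N \<Longrightarrow> V \<in> vector_fields N \<Longrightarrow> Z \<in> vector_fields N \<Longrightarrow> p \<in> N \<Longrightarrow>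
      deriv_on N (\<lambda>q. G q (V q) (Z q)) p (U p) =
        G p (deriv_on N V p (U p) + \<Gamma> p (U p) (V p)) (Z p) +
        G p (V p) (deriv_on N Z p (U p) + \<Gamma> p (U p) (Z p))"
    and \<Gamma>_deriv: "U \<in> vector_fields N \<Longrightarrow> V \<in> vector_fields N \<Longrightarrow> Z \<in> vector_fields N \<Longrightarrow> p \<in> N \<Longrightarrow>
      deriv_on N (\<lambda>q. \<Gamma> q (V q) (Z q)) p (U p) =
        d\<Gamma> p (U p) (V p) (Z p) + \<Gamma> p (deriv_on N V p (U p)) (Z p) + \<Gamma> p (V p) (deriv_on N Z p (U p))"
begin

definition nabla :: "('a \<Rightarrow> 'a) \<Rightarrow> ('a \<Rightarrow> 'a) \<Rightarrow> 'a \<Rightarrow> 'a" where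
  "nabla U V p = deriv_on N V p (U p) + \<Gamma> p (U p) (V p)"

lemma vector_fieldsD:
  "U \<in> vector_fields N \<Longrightarrow> smooth_on N U"
  "U \<in> vector_fields N \<Longrightarrow> p \<in> N \<Longrightarrow> U p \<in> tangent_space N p"
  by (auto simp: vector_fields_def)

lemma vector_fields_diff:
  "U \<in> vector_fields N \<Longrightarrow> V \<in> vector_fields N \<Longrightarrow> (\<lambda>q. U q - V q) \<in> vector_fields N"
  by (auto simp: vector_fields_def intro: smooth_on_diff subspace_diff[OF subspace_tangent])

lemma metric_diff:
  "G p u (v - w) = G p u v - G p u w" "G p (v - w) u = G p v u - G p w u"
proof -
  show "G p u (v - w) = G p u v - G p u w" for u v w by (rule linear_diff[OF metric_linear])
  from this[of u v w] show "G p (v - w) u = G p v u - G p w u"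
    by (simp only: metric_sym[of p _ u])
qed

lemma \<Gamma>_add: "\<Gamma> p u (v + w) = \<Gamma> p u v + \<Gamma> p u w" "\<Gamma> p (v + w) u = \<Gamma> p v u + \<Gamma> p w u"
  and \<Gamma>_diff: "\<Gamma> p (v - w) u = \<Gamma> p v u - \<Gamma> p w u"
  and \<Gamma>_scaleR: "\<Gamma> p u (c *\<^sub>R v) = c *\<^sub>R \<Gamma> p u v" "\<Gamma> p (c *\<^sub>R v) u = c *\<^sub>R \<Gamma> p v u"
proof -
  show 1: "\<Gamma> p u (v + w) = \<Gamma> p u v + \<Gamma> p u w" and 3: "\<Gamma> p u (c *\<^sub>R v) = c *\<^sub>R \<Gamma> p u v"
    by (rule linear_add[OF \<Gamma>_linear] linear_scale[OF \<Gamma>_linear])+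
  have 2: "\<Gamma> p u (v - w) = \<Gamma> p u v - \<Gamma> p u w"
    by (rule linear_diff[OF \<Gamma>_linear])
  show "\<Gamma> p (v + w) u = \<Gamma> p v u + \<Gamma> p w u" "\<Gamma> p (v - w) u = \<Gamma> p v u - \<Gamma> p w u"
    "\<Gamma> p (c *\<^sub>R v) u = c *\<^sub>R \<Gamma> p v u"
    using 1 2 3 by (simp_all only: \<Gamma>_sym[of p _ u])
qed

lemma nabla_vector_field:
  assumes "U \<in> vector_fields N" "V \<in> vector_fields N"
  shows "nabla U V \<in> vector_fields N"
proof -
  have "smooth_on N (nabla U V)"
    using assms vector_fieldsD
    by (auto simp: nabla_def[abs_def] intro!: smooth_on_add smooth_on_deriv_on \<Gamma>_smooth)
  then show ?thesis
    using \<Gamma>_tangent[OF assms] by (simp add: vector_fields_def nabla_def)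
qed

lemma nabla_cong:
  assumes "\<And>q. q \<in> N \<Longrightarrow> U q = U' q" "\<And>q. q \<in> N \<Longrightarrow> V q = V' q" "p \<in> N"
  shows "nabla U V p = nabla U' V' p"
  using deriv_on_cong[of N V V', OF assms(2,3)] assms by (simp add: nabla_def)

lemma is_levi_civita_nabla: "is_levi_civita N G nabla"
  unfolding is_levi_civita_def
proof (intro conjI ballI allI impI)
  fix U V Z U' V' p and f :: "'a \<Rightarrow> real"
  assume U: "U \<in> vector_fields N" and V: "V \<in> vector_fields N"
  show "nabla U V \<in> vector_fields N" by (rule nabla_vector_field[OF U V])
  {
    assume "\<forall>p\<in>N. U p = U' p \<and> V p = V' p" "p \<in> N"
    then show "nabla U V p = nabla U' V' p" by (intro nabla_cong) auto
  }
  assume p: "p \<in> N"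
  note lin = linear_deriv_on[OF vector_fieldsD(1)[OF V] p]
  show "nabla (\<lambda>q. U q + U' q) V p = nabla U V p + nabla U' V p"
    by (simp add: nabla_def linear_add[OF lin] \<Gamma>_add)
  show "nabla (\<lambda>q. f q *\<^sub>R U q) V p = f p *\<^sub>R nabla U V p"
    by (simp add: nabla_def linear_scale[OF lin] \<Gamma>_scaleR scaleR_add_right)
  show "nabla U V p - nabla V U p = lie_bracket N U V p"
    by (simp add: nabla_def lie_bracket_def \<Gamma>_sym[of p "U p"])
  show "nabla U (\<lambda>q. V q + V' q) p = nabla U V p + nabla U V' p" if V': "V' \<in> vector_fields N"
    by (simp add: nabla_def \<Gamma>_add
        deriv_on_add[OF vector_fieldsD(1)[OF V] vector_fieldsD(1)[OF V'] p vector_fieldsD(2)[OF U p]])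
  show "nabla U (\<lambda>q. f q *\<^sub>R V q) p = deriv_on N f p (U p) *\<^sub>R V p + f p *\<^sub>R nabla U V p"
    if f: "smooth_on N f"
    by (simp add: nabla_def \<Gamma>_scaleR scaleR_add_right
        deriv_on_scaleR[OF f vector_fieldsD(1)[OF V] p vector_fieldsD(2)[OF U p]])
  show "deriv_on N (\<lambda>q. G q (V q) (Z q)) p (U p) = G p (nabla U V p) (Z p) + G p (V p) (nabla U Z p)"
    if Z: "Z \<in> vector_fields N"
    unfolding nabla_def by (rule \<Gamma>_metric[OF U V Z p])
qed

text \<open>
  The difference of two such connections, paired with a third field, is symmetric in its first two
  arguments (no torsion) and antisymmetric in its last two (metric).  Such an expression vanishes, since
  six alternating swaps, three of which change the sign, return the arguments to their places.  The difference
  is itself a vector field, so it may be paired with itself.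
\<close>

lemma is_levi_civita_unique:
  assumes n: "is_levi_civita N G nab" and m: "is_levi_civita N G nab'"
    and U: "U \<in> vector_fields N" and V: "V \<in> vector_fields N" and p: "p \<in> N"
  shows "nab U V p = nab' U V p"
proof -
  define \<delta> where "\<delta> U V q = nab U V q - nab' U V q" for U V q
  have closed: "nab U V \<in> vector_fields N" "nab' U V \<in> vector_fields N"
    if "U \<in> vector_fields N" "V \<in> vector_fields N" for U V
    using is_levi_civitaD(1)[OF n that] is_levi_civitaD(1)[OF m that] .
  have sym: "\<delta> U V p = \<delta> V U p" if "U \<in> vector_fields N" "V \<in> vector_fields N" for U V
  proof -
    have "nab U V p - nab V U p = nab' U V p - nab' V U p"
      by (rule trans[OF is_levi_civitaD(2)[OF n that p] is_levi_civitaD(2)[OF m that p, symmetric]])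
    then show ?thesis unfolding \<delta>_def by (simp add: diff_eq_eq algebra_simps)
  qed
  have skew: "G p (\<delta> U V p) (Z p) = - G p (\<delta> U Z p) (V p)"
    if "U \<in> vector_fields N" "V \<in> vector_fields N" "Z \<in> vector_fields N" for U V Z
  proof -
    have "deriv_on N (\<lambda>q. G q (V q) (Z q)) p (U p) = G p (nab U V p) (Z p) + G p (V p) (nab U Z p)"
      by (rule is_levi_civitaD(3)[OF n that(1,2) p that(3)])
    moreover have "deriv_on N (\<lambda>q. G q (V q) (Z q)) p (U p) = G p (nab' U V p) (Z p) + G p (V p) (nab' U Z p)"
      by (rule is_levi_civitaD(3)[OF m that(1,2) p that(3)])
    moreover have "G p (V p) (nab U Z p) = G p (nab U Z p) (V p)" "G p (V p) (nab' U Z p) = G p (nab' U Z p) (V p)"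
      by (rule metric_sym)+
    ultimately show ?thesis unfolding \<delta>_def metric_diff by linarith
  qed
  have zero: "G p (\<delta> U V p) (Z p) = 0" if Z: "Z \<in> vector_fields N" for Z
  proof -
    have "G p (\<delta> U V p) (Z p) = - G p (\<delta> Z U p) (V p)"
      using skew[OF U V Z] unfolding sym[OF U Z] .
    moreover have "G p (\<delta> Z U p) (V p) = - G p (\<delta> V Z p) (U p)"
      using skew[OF Z U V] unfolding sym[OF Z V] .
    moreover have "G p (\<delta> V Z p) (U p) = - G p (\<delta> U V p) (Z p)"
      using skew[OF V Z U] unfolding sym[OF V U] .
    ultimately show ?thesis by linarith
  qed
  have "(\<lambda>q. nab U V q - nab' U V q) \<in> vector_fields N"
    by (intro vector_fields_diff closed U V)
  then have \<delta>: "\<delta> U V \<in> vector_fields N" by (simp add: \<delta>_def[abs_def])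
  have "\<delta> U V p = 0"
    by (rule metric_definite[OF p vector_fieldsD(2)[OF \<delta> p] zero[OF \<delta>]])
  then show ?thesis by (simp add: \<delta>_def)
qed

lemma is_levi_civita_levi_civita: "is_levi_civita N G (levi_civita N G)"
proof -
  have "\<exists>nab. is_levi_civita N G nab" by (rule exI[of _ nabla]) (rule is_levi_civita_nabla)
  then show ?thesis unfolding levi_civita_def by (rule someI_ex)
qed

lemma levi_civita_eq:
  assumes "U \<in> vector_fields N" "V \<in> vector_fields N" "p \<in> N"
  shows "levi_civita N G U V p = nabla U V p"
  by (rule is_levi_civita_unique[OF is_levi_civita_levi_civita is_levi_civita_nabla assms])

lemma lie_bracket_vector_field:
  assumes "U \<in> vector_fields N" "V \<in> vector_fields N"
  shows "lie_bracket N U V \<in> vector_fields N"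
proof -
  have "(\<lambda>q. nabla U V q - nabla V U q) = lie_bracket N U V"
    by (simp add: fun_eq_iff nabla_def lie_bracket_def \<Gamma>_sym)
  then show ?thesis
    using vector_fields_diff[OF nabla_vector_field[OF assms] nabla_vector_field[OF assms(2,1)]] by simp
qed

text \<open>
  In coordinates this is the usual expression of the curvature by Christoffel symbols, except that the
  values of \<open>\<Gamma>\<close> need not be tangent.
\<close>

definition curvature_form :: "'a \<Rightarrow> 'a \<Rightarrow> 'a \<Rightarrow> 'a \<Rightarrow> 'a" where
  "curvature_form p u v z =
     d\<Gamma> p u v z - d\<Gamma> p v u z + \<Gamma> p u (\<Gamma> p v z) - \<Gamma> p v (\<Gamma> p u z)"

lemma nabla_nabla:
  assumes U: "U \<in> vector_fields N" and V: "V \<in> vector_fields N" and Z: "Z \<in> vector_fields N" and p: "p \<in> N"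
  shows "nabla U (nabla V Z) p = deriv_on N (\<lambda>q. deriv_on N Z q (V q)) p (U p)
    + d\<Gamma> p (U p) (V p) (Z p) + \<Gamma> p (deriv_on N V p (U p)) (Z p) + \<Gamma> p (V p) (deriv_on N Z p (U p))
    + \<Gamma> p (U p) (deriv_on N Z p (V p)) + \<Gamma> p (U p) (\<Gamma> p (V p) (Z p))"
proof -
  have "deriv_on N (nabla V Z) p (U p) = deriv_on N (\<lambda>q. deriv_on N Z q (V q)) p (U p)
      + deriv_on N (\<lambda>q. \<Gamma> q (V q) (Z q)) p (U p)"
    unfolding nabla_def[abs_def]
    by (intro deriv_on_add smooth_on_deriv_on \<Gamma>_smooth vector_fieldsD U V Z p)
  then show ?thesis
    by (simp add: nabla_def[of U] nabla_def[of V Z p] \<Gamma>_deriv[OF U V Z p] \<Gamma>_add add_ac)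
qed

text \<open>
  The terms with second derivatives of \<open>Z\<close> are removed by the commutator formula, and the terms with
  first derivatives of \<open>U\<close>, \<open>V\<close>, \<open>Z\<close> cancel by symmetry of \<open>\<Gamma>\<close>.  What remains depends on the values of the
  fields at the point only, which is why the curvature is a tensor.
\<close>

lemma curvature_fields_eq:
  assumes U: "U \<in> vector_fields N" and V: "V \<in> vector_fields N" and Z: "Z \<in> vector_fields N" and p: "p \<in> N"
  shows "curvature_fields N G U V Z p = curvature_form p (U p) (V p) (Z p)"
proof -
  have step: "levi_civita N G U (levi_civita N G V Z) p = nabla U (nabla V Z) p"
    if "U \<in> vector_fields N" "V \<in> vector_fields N" for U V
  proof -
    have "levi_civita N G V Z \<in> vector_fields N"
      by (rule is_levi_civitaD(1)[OF is_levi_civita_levi_civita that(2) Z])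
    then have "levi_civita N G U (levi_civita N G V Z) p = nabla U (levi_civita N G V Z) p"
      by (rule levi_civita_eq[OF that(1) _ p])
    also have "\<dots> = nabla U (nabla V Z) p"
      using levi_civita_eq[OF that(2) Z] p by (intro nabla_cong) auto
    finally show ?thesis .
  qed
  note L = lie_bracket_vector_field[OF U V]
  have "curvature_fields N G U V Z p
      = nabla U (nabla V Z) p - nabla V (nabla U Z) p - nabla (lie_bracket N U V) Z p"
    by (simp add: curvature_fields_def Let_def step U V levi_civita_eq[OF L Z p])
  also have "nabla (lie_bracket N U V) Z p = deriv_on N (\<lambda>q. deriv_on N Z q (V q)) p (U p)
      - deriv_on N (\<lambda>q. deriv_on N Z q (U q)) p (V p)
      + (\<Gamma> p (deriv_on N V p (U p)) (Z p) - \<Gamma> p (deriv_on N U p (V p)) (Z p))"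
    using deriv_on_commutator[OF vector_fieldsD(1)[OF Z] vector_fieldsD(1)[OF U] vector_fieldsD(2)[OF U]
        vector_fieldsD(1)[OF V] vector_fieldsD(2)[OF V] p vector_fieldsD(2)[OF L p]]
    by (simp add: nabla_def) (simp add: lie_bracket_def \<Gamma>_diff)
  finally show ?thesis
    by (simp add: nabla_nabla U V Z p curvature_form_def)
qed

lemma curvature_eq:
  assumes p: "p \<in> N" and "u \<in> tangent_space N p" "v \<in> tangent_space N p" "z \<in> tangent_space N p"
  shows "curvature N G p u v z = curvature_form p u v z"
proof -
  obtain U where U: "U \<in> vector_fields N" "U p = u" using extension[OF assms(1,2)] by blast
  obtain V where V: "V \<in> vector_fields N" "V p = v" using extension[OF assms(1,3)] by blast
  obtain Z where Z: "Z \<in> vector_fields N" "Z p = z" using extension[OF assms(1,4)] by blast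
  have "curvature_form p u v z = curvature_fields N G U V Z p"
    using curvature_fields_eq[OF U(1) V(1) Z(1) p] by (simp add: U V Z)
  then show ?thesis
    unfolding curvature_def
    by (intro the_equality bexI[of _ U] bexI[of _ V] bexI[of _ Z] conjI U V Z)
      (auto simp: curvature_fields_eq[OF _ _ _ p])
qed

end

section \<open>The unit sphere\<close>

text \<open>
  A tangent vector \<open>v\<close> is the velocity of the great circle through \<open>p\<close> in the plane of \<open>p\<close> and \<open>v\<close>.  For
  \<open>v = 0\<close> the formula for the curve degenerates correctly to the constant curve, because \<open>v /\<^sub>R 0 = 0\<close>.
\<close>

lemma tangent_space_sphere:
  fixes p :: "'h::real_inner"
  assumes p: "p \<in> sphere 0 1"
  shows "tangent_space (sphere 0 1) p = {v. p \<bullet> v = 0}"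
proof (intro set_eqI iffI)
  fix v assume "v \<in> tangent_space (sphere 0 1) p"
  then obtain c where c: "c 0 = p" "(c has_vector_derivative v) (at 0)" "\<forall>\<^sub>F t in at 0. c t \<in> sphere 0 1"
    unfolding tangent_space_def by blast
  have "((\<lambda>q. q \<bullet> q) has_derivative (\<lambda>h. 2 * (p \<bullet> h))) (at p within sphere 0 1)"
    by (auto intro!: derivative_eq_intros simp: inner_commute)
  moreover have "((\<lambda>q. q \<bullet> q) has_derivative (\<lambda>h. 0)) (at p within sphere 0 1)"
    by (rule has_derivative_transform[OF p _ has_derivative_const[of "1::real"]])
      (simp add: dot_square_norm)
  ultimately have "((\<lambda>t. c t \<bullet> c t) has_vector_derivative (2 * (p \<bullet> v))) (at 0)"
    "((\<lambda>t. c t \<bullet> c t) has_vector_derivative 0) (at 0)"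
    using has_vector_derivative_along_curve[OF _ c] by blast+
  then have "2 * (p \<bullet> v) = 0" by (rule vector_derivative_unique_at)
  then show "v \<in> {v. p \<bullet> v = 0}" by simp
next
  fix v assume "v \<in> {v. p \<bullet> v = 0}"
  then have v: "p \<bullet> v = 0" by simp
  have pp: "p \<bullet> p = 1" using p by (simp add: dot_square_norm)
  define c where "c t = cos (norm v * t) *\<^sub>R p + sin (norm v * t) *\<^sub>R (v /\<^sub>R norm v)" for t
  have "c t \<bullet> c t = 1" if "v \<noteq> 0" for t
    using that v pp sin_cos_squared_add2[of "norm v * t"]
    by (simp add: c_def inner_add_left inner_add_right inner_commute[of v p] power2_eq_square dot_square_norm[of v] field_simps)
  then have sph: "c t \<in> sphere 0 1" for t
    using p by (cases "v = 0") (simp_all add: norm_eq_sqrt_inner c_def)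
  have "(c has_vector_derivative v) (at 0)"
    unfolding c_def[abs_def]
    by (cases "v = 0") (auto intro!: derivative_eq_intros simp: has_vector_derivative_def field_simps)
  moreover have "c 0 = p" by (simp add: c_def)
  ultimately show "v \<in> tangent_space (sphere 0 1) p"
    unfolding tangent_space_def using sph by auto
qed

lemma deriv_on_ident: "v \<in> tangent_space N p \<Longrightarrow> deriv_on N (\<lambda>q. q) p v = v"
  by (rule deriv_on_bounded_linear[OF bounded_linear_ident])

text \<open>
  Differentiating \<open>q \<bullet> V q = 0\<close> yields the normal component of the ambient derivative of a tangent field.
\<close>

lemma sphere_field_deriv_normal:
  fixes V :: "'h::real_inner \<Rightarrow> 'h"
  assumes V: "smooth_on (sphere 0 1) V" "\<And>q. q \<in> sphere 0 1 \<Longrightarrow> V q \<in> tangent_space (sphere 0 1) q"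
    and p: "p \<in> sphere 0 1" and u: "u \<in> tangent_space (sphere 0 1) p"
  shows "p \<bullet> deriv_on (sphere 0 1) V p u = - (u \<bullet> V p)"
proof -
  have "((\<lambda>q. q \<bullet> V q) has_derivative (\<lambda>h. 0)) (at p within sphere 0 1)"
    by (rule has_derivative_transform[OF p _ has_derivative_const[of "0::real"]])
      (use V(2) tangent_space_sphere in blast)
  from deriv_on_eq[OF this u]
  have "0 = deriv_on (sphere 0 1) (\<lambda>q. q \<bullet> V q) p u" by simp
  also have "\<dots> = u \<bullet> V p + p \<bullet> deriv_on (sphere 0 1) V p u"
    by (simp add: deriv_on_inner[OF smooth_on_ident V(1) p u] deriv_on_ident[OF u])
  finally show ?thesis by simp
qed

text \<open>
  The Levi-Civita derivative of the sphere is the ambient derivative, orthogonally projected to the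
  tangent space.
\<close>

lemma sphere_connection:
  "submanifold_connection (sphere (0::'h::real_inner) 1) (\<lambda>p. (\<bullet>))
     (\<lambda>p u v. (u \<bullet> v) *\<^sub>R p) (\<lambda>p u v z. (v \<bullet> z) *\<^sub>R u)"
proof (rule submanifold_connection.intro)
  let ?S = "sphere (0::'h) 1"
  note T = tangent_space_sphere
  show "linear ((\<bullet>) u)" for u :: 'h by (rule bounded_linear.linear[OF bounded_linear_inner_right])
  show "linear (\<lambda>v. (u \<bullet> v) *\<^sub>R p)" for p u :: 'h
    by (intro linearI) (simp_all add: inner_add_right scaleR_add_left)
  show "u \<bullet> v = v \<bullet> u" "(u \<bullet> v) *\<^sub>R p = (v \<bullet> u) *\<^sub>R p" for u v p :: 'h by (simp_all add: inner_commute)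
  show "smooth_on ?S (\<lambda>q. (U q \<bullet> V q) *\<^sub>R q)" if "smooth_on ?S U" "smooth_on ?S V" for U V
    by (intro smooth_on_scaleR smooth_on_inner smooth_on_ident that)
  fix p :: 'h assume p: "p \<in> ?S"
  then have pp: "p \<bullet> p = 1" by (simp add: dot_square_norm)
  show "subspace (tangent_space ?S p)"
    unfolding T[OF p] by (simp add: subspace_def inner_add_right)
  show "u = 0" if "u \<bullet> u = 0" for u :: 'h using that by simp
  show "\<exists>V\<in>vector_fields ?S. V p = v" if "v \<in> tangent_space ?S p" for v
  proof
    show "v - (p \<bullet> v) *\<^sub>R p = v" using that T[OF p] by simp
    show "(\<lambda>q. v - (q \<bullet> v) *\<^sub>R q) \<in> vector_fields ?S"
      unfolding vector_fields_def
      by (auto simp: T inner_diff_right dot_square_norm intro!: smooth_on_diff smooth_on_const smooth_on_scaleR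
        smooth_on_inner smooth_on_ident)
  qed
  fix U V assume UV: "U \<in> vector_fields ?S" "V \<in> vector_fields ?S"
  then have U: "smooth_on ?S U" "U q \<in> tangent_space ?S q" and V: "smooth_on ?S V" "V q \<in> tangent_space ?S q"
    if "q \<in> ?S" for q
    using that by (auto simp: vector_fields_def)
  show "deriv_on ?S V p (U p) + (U p \<bullet> V p) *\<^sub>R p \<in> tangent_space ?S p"
    unfolding T[OF p] using sphere_field_deriv_normal[OF V(1)[OF p] V(2) p U(2)[OF p]]
    by (simp add: inner_add_right pp)
  fix Z assume "Z \<in> vector_fields ?S"
  then have Z: "smooth_on ?S Z" "Z q \<in> tangent_space ?S q" if "q \<in> ?S" for q
    using that by (auto simp: vector_fields_def)
  have perp: "p \<bullet> V p = 0" "p \<bullet> Z p = 0" using V(2)[OF p] Z(2)[OF p] T[OF p] by auto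
  show "deriv_on ?S (\<lambda>q. V q \<bullet> Z q) p (U p) = (deriv_on ?S V p (U p) + (U p \<bullet> V p) *\<^sub>R p) \<bullet> Z p
      + V p \<bullet> (deriv_on ?S Z p (U p) + (U p \<bullet> Z p) *\<^sub>R p)"
    using perp by (simp add: deriv_on_inner[OF V(1)[OF p] Z(1)[OF p] p U(2)[OF p]] inner_add_left inner_add_right
        inner_commute[of "V p" p])
  show "deriv_on ?S (\<lambda>q. (V q \<bullet> Z q) *\<^sub>R q) p (U p) = (V p \<bullet> Z p) *\<^sub>R U p
     + (deriv_on ?S V p (U p) \<bullet> Z p) *\<^sub>R p + (V p \<bullet> deriv_on ?S Z p (U p)) *\<^sub>R p"
    by (simp add: deriv_on_scaleR[OF smooth_on_inner[OF V(1)[OF p] Z(1)[OF p]] smooth_on_ident p U(2)[OF p]]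
        deriv_on_inner[OF V(1)[OF p] Z(1)[OF p] p U(2)[OF p]] deriv_on_ident[OF U(2)[OF p]] scaleR_add_left)
qed

lemma sphere_curvature:
  fixes p :: "'h::real_inner"
  assumes p: "p \<in> sphere 0 1"
    and "x \<in> tangent_space (sphere 0 1) p" "y \<in> tangent_space (sphere 0 1) p" "z \<in> tangent_space (sphere 0 1) p"
  shows "curvature (sphere 0 1) (\<lambda>p. (\<bullet>)) p x y z = (y \<bullet> z) *\<^sub>R x - (x \<bullet> z) *\<^sub>R y"
proof -
  interpret submanifold_connection "sphere (0::'h) 1" "\<lambda>p. (\<bullet>)" "\<lambda>p u v. (u \<bullet> v) *\<^sub>R p"
    "\<lambda>p u v z. (v \<bullet> z) *\<^sub>R u"
    by (rule sphere_connection)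
  have "x \<bullet> p = 0" "y \<bullet> p = 0"
    using assms(2,3) tangent_space_sphere[OF p] by (auto simp: inner_commute)
  then show ?thesis by (simp add: curvature_eq[OF assms] curvature_form_def)
qed

section \<open>The warped product of an interval with the sphere\<close>

locale warped_product =
  fixes I :: "real set" and a a\<^sub>1 a\<^sub>2 b\<^sub>1 :: "real \<Rightarrow> real"
  assumes open_I: "open I"
    and a_pos: "s \<in> I \<Longrightarrow> 0 < a s"
    and smooth_a: "smooth_on I a" and smooth_a1: "smooth_on I a\<^sub>1"
    and smooth_b: "smooth_on I (\<lambda>s. a\<^sub>1 s / (2 * a s))"
    and deriv_a: "s \<in> I \<Longrightarrow> (a has_real_derivative a\<^sub>1 s) (at s)"
    and deriv_a1: "s \<in> I \<Longrightarrow> (a\<^sub>1 has_real_derivative a\<^sub>2 s) (at s)"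
    and deriv_b: "s \<in> I \<Longrightarrow> ((\<lambda>s. a\<^sub>1 s / (2 * a s)) has_real_derivative b\<^sub>1 s) (at s)"
begin

abbreviation M :: "(real \<times> 'h::real_inner) set" where
  "M \<equiv> I \<times> sphere 0 1"

abbreviation b :: "real \<Rightarrow> real" where
  "b s \<equiv> a\<^sub>1 s / (2 * a s)"

lemma b1_eq: "s \<in> I \<Longrightarrow> b\<^sub>1 s = a\<^sub>2 s / (2 * a s) - (a\<^sub>1 s)\<^sup>2 / (2 * (a s)\<^sup>2)"
proof -
  assume s: "s \<in> I"
  have "((\<lambda>s. a\<^sub>1 s / (2 * a s)) has_real_derivative
      (a\<^sub>2 s * (2 * a s) - a\<^sub>1 s * (2 * a\<^sub>1 s)) / ((2 * a s) * (2 * a s))) (at s)"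
    by (rule DERIV_divide[OF deriv_a1[OF s] DERIV_cmult[OF deriv_a[OF s]]]) (use a_pos[OF s] in simp)
  from DERIV_unique[OF deriv_b[OF s] this] show ?thesis
    using a_pos[OF s] by (simp add: field_simps power2_eq_square)
qed

lemma tangent_space_product:
  fixes \<phi> :: "'h::real_inner"
  assumes s: "s \<in> I" and \<phi>: "\<phi> \<in> sphere 0 1"
  shows "tangent_space M (s, \<phi>) = UNIV \<times> tangent_space (sphere 0 1) \<phi>"
proof (intro set_eqI iffI)
  fix v :: "real \<times> 'h" assume "v \<in> tangent_space M (s, \<phi>)"
  then obtain c where c: "c 0 = (s, \<phi>)" "(c has_vector_derivative v) (at 0)"
    "\<forall>\<^sub>F t in at 0. c t \<in> M"
    unfolding tangent_space_def by blast
  have "((\<lambda>t. snd (c t)) has_vector_derivative snd v) (at 0)"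
    by (rule bounded_linear.has_vector_derivative[OF bounded_linear_snd c(2)])
  moreover have "\<forall>\<^sub>F t in at 0. snd (c t) \<in> sphere 0 1"
    using c(3) by eventually_elim auto
  ultimately have "snd v \<in> tangent_space (sphere 0 1) \<phi>"
    unfolding tangent_space_def using c(1) by (intro CollectI exI[of _ "\<lambda>t. snd (c t)"]) simp
  then show "v \<in> UNIV \<times> tangent_space (sphere 0 1) \<phi>" by (cases v) simp
next
  fix v :: "real \<times> 'h" assume "v \<in> UNIV \<times> tangent_space (sphere 0 1) \<phi>"
  then have "snd v \<in> tangent_space (sphere 0 1) \<phi>" by auto
  then obtain c where c: "c 0 = \<phi>" "(c has_vector_derivative snd v) (at 0)"
    "\<forall>\<^sub>F t in at 0. c t \<in> sphere 0 1"
    unfolding tangent_space_def by blast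
  have line: "((\<lambda>t. s + t * fst v) has_vector_derivative fst v) (at 0)"
    by (auto intro!: derivative_eq_intros simp: has_vector_derivative_def)
  have "((\<lambda>t. s + t * fst v) \<longlongrightarrow> s) (at 0)"
    by (auto intro!: tendsto_eq_intros)
  then have "\<forall>\<^sub>F t in at 0. s + t * fst v \<in> I"
    using open_I s topological_tendstoD by blast
  then have "\<forall>\<^sub>F t in at 0. (s + t * fst v, c t) \<in> M"
    using c(3) by eventually_elim auto
  moreover have "((\<lambda>t. (s + t * fst v, c t)) has_vector_derivative (fst v, snd v)) (at 0)"
    by (rule has_vector_derivative_Pair[OF line c(2)])
  ultimately show "v \<in> tangent_space M (s, \<phi>)"
    unfolding tangent_space_def using c(1)
    by (intro CollectI exI[of _ "\<lambda>t. (s + t * fst v, c t)"]) simp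
qed

lemma tangent_space_product_iff:
  fixes p :: "real \<times> 'h::real_inner"
  assumes "p \<in> M"
  shows "v \<in> tangent_space M p \<longleftrightarrow> snd p \<bullet> snd v = 0"
  using assms tangent_space_product[of "fst p" "snd p"] tangent_space_sphere[of "snd p"]
  by (cases p; cases v) auto

lemma product_vector_fieldD:
  fixes U :: "real \<times> 'h::real_inner \<Rightarrow> real \<times> 'h"
  assumes "U \<in> vector_fields M" "p \<in> M"
  shows "U p \<in> tangent_space M p" and "snd p \<bullet> snd (U p) = 0"
proof -
  show 1: "U p \<in> tangent_space M p"
    using assms unfolding vector_fields_def by blast
  show "snd p \<bullet> snd (U p) = 0"
    using 1 unfolding tangent_space_product_iff[OF assms(2)] .
qed

text \<open>
  The last summand of the second component is the normal correction of the sphere, the remaining terms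
  are the Christoffel symbols of \<open>ds\<^sup>2 + a(s) d\<phi>\<^sup>2\<close>; \<open>b = a\<^sub>1 / (2 a)\<close>.
\<close>

definition \<Gamma> :: "real \<times> 'h::real_inner \<Rightarrow> real \<times> 'h \<Rightarrow> real \<times> 'h \<Rightarrow> real \<times> 'h" where
  "\<Gamma> p u v = (- (a\<^sub>1 (fst p) / 2) * (snd u \<bullet> snd v),
     b (fst p) *\<^sub>R (fst u *\<^sub>R snd v + fst v *\<^sub>R snd u) + (snd u \<bullet> snd v) *\<^sub>R snd p)"

definition d\<Gamma> :: "real \<times> 'h::real_inner \<Rightarrow> real \<times> 'h \<Rightarrow> real \<times> 'h \<Rightarrow> real \<times> 'h \<Rightarrow> real \<times> 'h" where
  "d\<Gamma> p u v z = (- (fst u * a\<^sub>2 (fst p) / 2) * (snd v \<bullet> snd z),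
     (fst u * b\<^sub>1 (fst p)) *\<^sub>R (fst v *\<^sub>R snd z + fst z *\<^sub>R snd v) + (snd v \<bullet> snd z) *\<^sub>R snd u)"

definition metric :: "real \<times> 'h::real_inner \<Rightarrow> real \<times> 'h \<Rightarrow> real \<times> 'h \<Rightarrow> real" where
  "metric p u v = fst u * fst v + a (fst p) * (snd u \<bullet> snd v)"

lemma smooth_on_fst_comp:
  fixes f :: "real \<Rightarrow> real" and S :: "'h::real_inner set"
  assumes "smooth_on I f"
  shows "smooth_on (I \<times> S) (\<lambda>q. f (fst q))"
proof -
  have "smooth_on (I \<times> S) (\<lambda>q. f (0 + fst q))"
    by (rule smooth_on_affine_comp[OF assms bounded_linear_fst]) auto
  then show ?thesis by simp
qed

lemma has_derivative_fst_comp: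
  assumes "(f has_real_derivative f') (at (fst p))"
  shows "((\<lambda>q. f (fst q)) has_derivative (\<lambda>h. f' * fst h)) (at p within N)"
  by (rule has_derivative_compose[OF has_derivative_fst[OF has_derivative_ident] assms[unfolded has_field_derivative_def]])

lemma product_field_deriv_normal:
  fixes V :: "real \<times> 'h::real_inner \<Rightarrow> real \<times> 'h"
  assumes V: "V \<in> vector_fields M" and p: "p \<in> M"
    and u: "u \<in> tangent_space M p"
  shows "snd p \<bullet> snd (deriv_on M V p u) = - (snd u \<bullet> snd (V p))"
proof -
  let ?N = "I \<times> sphere (0::'h) 1"
  have "((\<lambda>q. snd q \<bullet> snd (V q)) has_derivative (\<lambda>h. 0)) (at p within ?N)"
    by (rule has_derivative_transform[OF p _ has_derivative_const[of "0::real"]], rule product_vector_fieldD(2)[OF V])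
  from deriv_on_eq[OF this u]
  have "deriv_on ?N (\<lambda>q. snd q \<bullet> snd (V q)) p u = 0" .
  moreover have "(V has_derivative deriv_on ?N V p) (at p within ?N)"
    using V p by (intro smooth_on_has_derivative) (auto simp: vector_fields_def)
  then have "((\<lambda>q. snd q \<bullet> snd (V q)) has_derivative
      (\<lambda>h. snd p \<bullet> snd (deriv_on ?N V p h) + snd h \<bullet> snd (V p))) (at p within ?N)"
    by (auto intro!: derivative_eq_intros)
  from deriv_on_eq[OF this u]
  have "deriv_on ?N (\<lambda>q. snd q \<bullet> snd (V q)) p u = snd p \<bullet> snd (deriv_on ?N V p u) + snd u \<bullet> snd (V p)" .
  ultimately show ?thesis by simp
qed

lemma warped_connection:
  "submanifold_connection (I \<times> sphere (0::'h::real_inner) 1) metric \<Gamma> d\<Gamma>"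
proof (rule submanifold_connection.intro)
  let ?S = "sphere (0::'h) 1"
  let ?N = "I \<times> ?S"
  show "linear (metric p u)" for p u :: "real \<times> 'h"
    by (intro linearI) (simp_all add: metric_def inner_add_right algebra_simps)
  show "metric p u v = metric p v u" for p u v :: "real \<times> 'h"
    by (simp add: metric_def inner_commute mult.commute)
  show "linear (\<Gamma> p u)" for p u :: "real \<times> 'h"
    by (intro linearI) (simp_all add: \<Gamma>_def inner_add_right algebra_simps)
  show "\<Gamma> p u v = \<Gamma> p v u" for p u v :: "real \<times> 'h"
    by (simp add: \<Gamma>_def inner_commute add.commute)
  show "smooth_on ?N (\<lambda>q. \<Gamma> q (U q) (V q))" if UV: "smooth_on ?N U" "smooth_on ?N V" for U V
  proof -
    have *: "smooth_on ?N (\<lambda>q. (-1/2) * (a\<^sub>1 (fst q)))"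
      by (intro smooth_on_mult smooth_on_const smooth_on_fst_comp smooth_a1)
    have "smooth_on ?N (\<lambda>q. (((-1/2) * (a\<^sub>1 (fst q))) * (snd (U q) \<bullet> snd (V q)),
      b (fst q) *\<^sub>R (fst (U q) *\<^sub>R snd (V q) + fst (V q) *\<^sub>R snd (U q)) + (snd (U q) \<bullet> snd (V q)) *\<^sub>R snd q))"
      by (intro smooth_on_Pair smooth_on_mult[OF *] smooth_on_add smooth_on_scaleR smooth_on_inner
        smooth_on_fst smooth_on_snd UV smooth_on_ident smooth_on_fst_comp[OF smooth_b])
    then show ?thesis by (simp add: \<Gamma>_def)
  qed
  fix p assume p: "p \<in> ?N"
  then have pp: "snd p \<bullet> snd p = 1" and fp: "fst p \<in> I" by (auto simp: dot_square_norm)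
  show "subspace (tangent_space ?N p)"
    by (auto simp: subspace_def tangent_space_product_iff[OF p] inner_add_right)
  show "u = 0" if "metric p u u = 0" for u
  proof -
    have "fst u * fst u \<ge> 0" "a (fst p) * (snd u \<bullet> snd u) \<ge> 0"
      using a_pos[OF fp] by simp_all
    then have "fst u * fst u = 0" "a (fst p) * (snd u \<bullet> snd u) = 0"
      using that unfolding metric_def by linarith+
    then show ?thesis using a_pos[OF fp] by (simp add: prod_eq_iff)
  qed
  show "\<exists>V\<in>vector_fields ?N. V p = v" if "v \<in> tangent_space ?N p" for v
  proof
    show "(fst v, snd v - (snd p \<bullet> snd v) *\<^sub>R snd p) = v"
      using that tangent_space_product_iff[OF p] by simp
    show "(\<lambda>q. (fst v, snd v - (snd q \<bullet> snd v) *\<^sub>R snd q)) \<in> vector_fields ?N"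
      unfolding vector_fields_def
      by (auto simp: tangent_space_product_iff inner_diff_right dot_square_norm
        intro!: smooth_on_Pair smooth_on_diff smooth_on_const smooth_on_scaleR
        smooth_on_inner smooth_on_snd smooth_on_ident)
  qed
  fix U V assume U: "U \<in> vector_fields ?N" and V: "V \<in> vector_fields ?N"
  note Up = product_vector_fieldD[OF U p] and Vp = product_vector_fieldD(2)[OF V p]
  show "deriv_on ?N V p (U p) + \<Gamma> p (U p) (V p) \<in> tangent_space ?N p"
    using product_field_deriv_normal[OF V p Up(1)] Up Vp pp
    by (simp add: tangent_space_product_iff[OF p] \<Gamma>_def inner_add_right)
  fix Z assume Z: "Z \<in> vector_fields ?N"
  note Zp = product_vector_fieldD(2)[OF Z p]
  have dV: "(V has_derivative deriv_on ?N V p) (at p within ?N)" and dZ: "(Z has_derivative deriv_on ?N Z p) (at p within ?N)"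
    using V Z p by (auto intro!: smooth_on_has_derivative simp: vector_fields_def)
  note d = dV dZ has_derivative_fst_comp[OF deriv_a[OF fp]] has_derivative_fst_comp[OF deriv_a1[OF fp]]
    has_derivative_fst_comp[OF deriv_b[OF fp]]
  have 1: "((\<lambda>q. metric q (V q) (Z q)) has_derivative (\<lambda>h. fst (deriv_on ?N V p h) * fst (Z p) + fst (V p) * fst (deriv_on ?N Z p h)
      + a\<^sub>1 (fst p) * fst h * (snd (V p) \<bullet> snd (Z p))
      + a (fst p) * (snd (deriv_on ?N V p h) \<bullet> snd (Z p) + snd (V p) \<bullet> snd (deriv_on ?N Z p h)))) (at p within ?N)"
    unfolding metric_def by (auto intro!: derivative_eq_intros d simp: algebra_simps)
  have "snd (V p) \<bullet> snd p = 0" "snd p \<bullet> snd (Z p) = 0" "a (fst p) \<noteq> 0"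
    using Vp Zp a_pos[OF fp] by (auto simp: inner_commute)
  then show "deriv_on ?N (\<lambda>q. metric q (V q) (Z q)) p (U p) =
      metric p (deriv_on ?N V p (U p) + \<Gamma> p (U p) (V p)) (Z p) + metric p (V p) (deriv_on ?N Z p (U p) + \<Gamma> p (U p) (Z p))"
    unfolding deriv_on_eq[OF 1 Up(1)]
    by (simp add: metric_def \<Gamma>_def inner_add_left inner_add_right field_simps inner_commute[of "snd (V p)" "snd (U p)"])
  have 2: "((\<lambda>q. \<Gamma> q (V q) (Z q)) has_derivative (\<lambda>h. d\<Gamma> p h (V p) (Z p)
      + \<Gamma> p (deriv_on ?N V p h) (Z p) + \<Gamma> p (V p) (deriv_on ?N Z p h))) (at p within ?N)"
    unfolding \<Gamma>_def
    by (rule has_derivative_eq_rhs,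
       (rule has_derivative_Pair has_derivative_add has_derivative_scaleR has_derivative_mult has_derivative_inner
         has_derivative_minus has_derivative_divide' has_derivative_fst has_derivative_snd
         has_derivative_ident has_derivative_const d | simp)+,
       simp add: d\<Gamma>_def fun_eq_iff algebra_simps)
  show "deriv_on ?N (\<lambda>q. \<Gamma> q (V q) (Z q)) p (U p) = d\<Gamma> p (U p) (V p) (Z p)
      + \<Gamma> p (deriv_on ?N V p (U p)) (Z p) + \<Gamma> p (V p) (deriv_on ?N Z p (U p))"
    by (rule deriv_on_eq[OF 2 Up(1)])
qed

end

section \<open>Covariant derivative and curvature of the warped product\<close>

context warped_product
begin

text \<open>
  The tangent vector \<open>(f, X)\<close> is the sum of \<open>(f, 0)\<close> and \<open>(0, X)\<close>, which are tangent to the two slices.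
\<close>

lemma deriv_on_product:
  fixes g :: "real \<times> 'h::real_inner \<Rightarrow> 'b::real_normed_vector"
  assumes g: "smooth_on M g" and s: "s \<in> I" and \<phi>: "\<phi> \<in> sphere 0 1"
    and X: "X \<in> tangent_space (sphere 0 1) \<phi>"
  shows "((\<lambda>t. g (t, \<phi>)) has_vector_derivative vector_derivative (\<lambda>t. g (t, \<phi>)) (at s)) (at s)"
    and "deriv_on M g (s, \<phi>) (f, X)
      = f *\<^sub>R vector_derivative (\<lambda>t. g (t, \<phi>)) (at s) + deriv_on (sphere 0 1) (\<lambda>\<psi>. g (s, \<psi>)) \<phi> X"
proof -
  let ?N = "I \<times> sphere (0::'h) 1" and ?g' = "deriv_on (I \<times> sphere (0::'h) 1) g (s, \<phi>)"
  have der: "(g has_derivative ?g') (at (s, \<phi>) within ?N)"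
    by (rule smooth_on_has_derivative[OF g]) (use s \<phi> in simp)
  note lin = has_derivative_linear[OF der]
  have "(g has_derivative ?g') (at (s, \<phi>) within (\<lambda>t. (t, \<phi>)) ` I)"
    by (rule has_derivative_subset[OF der]) (use \<phi> in auto)
  from has_derivative_in_compose[OF has_derivative_Pair[OF has_derivative_ident has_derivative_const] this]
  have "((\<lambda>t. g (t, \<phi>)) has_derivative (\<lambda>h. ?g' (h, 0))) (at s within I)" .
  moreover have "(\<lambda>h. ?g' (h, 0)) = (\<lambda>h. h *\<^sub>R ?g' (1, 0))"
  proof
    show "?g' (h, 0) = h *\<^sub>R ?g' (1, 0)" for h
      using linear_scale[OF lin, of h "(1, 0)"] unfolding scaleR_Pair scaleR_zero_right real_scaleR_def mult_1_right .
  qed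
  ultimately have "((\<lambda>t. g (t, \<phi>)) has_derivative (\<lambda>h. h *\<^sub>R ?g' (1, 0))) (at s within I)"
    by (simp only:)
  then have 1: "((\<lambda>t. g (t, \<phi>)) has_vector_derivative ?g' (1, 0)) (at s)"
    by (simp add: has_vector_derivative_def at_within_open[OF s open_I])
  then show "((\<lambda>t. g (t, \<phi>)) has_vector_derivative vector_derivative (\<lambda>t. g (t, \<phi>)) (at s)) (at s)"
    by (simp add: vector_derivative_at)
  have "(g has_derivative ?g') (at (s, \<phi>) within (\<lambda>\<psi>. (s, \<psi>)) ` sphere 0 1)"
    by (rule has_derivative_subset[OF der]) (use s in auto)
  from has_derivative_in_compose[OF has_derivative_Pair[OF has_derivative_const has_derivative_ident] this]
  have "((\<lambda>\<psi>. g (s, \<psi>)) has_derivative (\<lambda>h. ?g' (0, h))) (at \<phi> within sphere 0 1)" .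
  from deriv_on_eq[OF this X]
  show "?g' (f, X) = f *\<^sub>R vector_derivative (\<lambda>t. g (t, \<phi>)) (at s) + deriv_on (sphere 0 1) (\<lambda>\<psi>. g (s, \<psi>)) \<phi> X"
    using linear_add[OF lin, of "(f, 0)" "(0, X)"] linear_scale[OF lin, of f "(1, 0)"]
    by (simp add: vector_derivative_at[OF 1])
qed

lemma smooth_on_slice:
  fixes X :: "real \<times> 'h::real_inner \<Rightarrow> 'b::real_normed_vector"
  assumes "smooth_on M X" "s \<in> I"
  shows "smooth_on (sphere 0 1) (\<lambda>\<psi>. X (s, \<psi>))"
proof -
  have "bounded_linear (\<lambda>\<psi>::'h. (0::real, \<psi>))"
    by (intro bounded_linear_Pair bounded_linear_ident bounded_linear_zero)
  from smooth_on_affine_comp[OF assms(1) this, of "sphere 0 1" "(s, 0)"] assms(2)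
  show ?thesis by simp
qed

lemma levi_civita_warped:
  fixes f g :: "real \<times> 'h::real_inner \<Rightarrow> real" and X Y :: "real \<times> 'h \<Rightarrow> 'h"
  assumes sm: "smooth_on M f" "smooth_on M g"
      "smooth_on M X" "smooth_on M Y"
    and tan: "\<And>s \<phi>. s \<in> I \<Longrightarrow> \<phi> \<in> sphere 0 1 \<Longrightarrow> X (s, \<phi>) \<in> tangent_space (sphere 0 1) \<phi>"
      "\<And>s \<phi>. s \<in> I \<Longrightarrow> \<phi> \<in> sphere 0 1 \<Longrightarrow> Y (s, \<phi>) \<in> tangent_space (sphere 0 1) \<phi>"
    and s: "s \<in> I" and \<phi>: "\<phi> \<in> sphere 0 1"
  shows "levi_civita M metric (\<lambda>p. (f p, X p)) (\<lambda>p. (g p, Y p)) (s, \<phi>) =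
    (f (s, \<phi>) * deriv (\<lambda>t. g (t, \<phi>)) s + deriv_on (sphere 0 1) (\<lambda>\<psi>. g (s, \<psi>)) \<phi> (X (s, \<phi>))
       - a\<^sub>1 s / 2 * (X (s, \<phi>) \<bullet> Y (s, \<phi>)),
     b s *\<^sub>R (f (s, \<phi>) *\<^sub>R Y (s, \<phi>) + g (s, \<phi>) *\<^sub>R X (s, \<phi>))
       + f (s, \<phi>) *\<^sub>R vector_derivative (\<lambda>t. Y (t, \<phi>)) (at s)
       + levi_civita (sphere 0 1) (\<lambda>_. (\<bullet>)) (\<lambda>\<psi>. X (s, \<psi>)) (\<lambda>\<psi>. Y (s, \<psi>)) \<phi>)"
proof -
  let ?S = "sphere (0::'h) 1"
  let ?N = "I \<times> ?S" and ?p = "(s, \<phi>)"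
  interpret W: submanifold_connection ?N metric \<Gamma> d\<Gamma> by (rule warped_connection)
  interpret S: submanifold_connection ?S "\<lambda>_. (\<bullet>)" "\<lambda>p u v. (u \<bullet> v) *\<^sub>R p" "\<lambda>p u v z. (v \<bullet> z) *\<^sub>R u"
    by (rule sphere_connection)
  have U: "(\<lambda>p. (f p, X p)) \<in> vector_fields ?N" and V: "(\<lambda>p. (g p, Y p)) \<in> vector_fields ?N"
    using tan by (auto simp: vector_fields_def tangent_space_product intro!: smooth_on_Pair sm)
  have X: "(\<lambda>\<psi>. X (s, \<psi>)) \<in> vector_fields ?S" and Y: "(\<lambda>\<psi>. Y (s, \<psi>)) \<in> vector_fields ?S"
    unfolding vector_fields_def using tan[OF s] smooth_on_slice[OF sm(3) s] smooth_on_slice[OF sm(4) s]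
    by blast+
  have p: "?p \<in> ?N" using s \<phi> by simp
  have "(f ?p, X ?p) \<in> tangent_space ?N ?p" using W.vector_fieldsD(2)[OF U p] .
  from deriv_on_Pair[OF sm(2,4) p this]
  have dV: "deriv_on ?N (\<lambda>p. (g p, Y p)) ?p (f ?p, X ?p)
      = (f ?p *\<^sub>R vector_derivative (\<lambda>t. g (t, \<phi>)) (at s) + deriv_on ?S (\<lambda>\<psi>. g (s, \<psi>)) \<phi> (X ?p),
         f ?p *\<^sub>R vector_derivative (\<lambda>t. Y (t, \<phi>)) (at s) + deriv_on ?S (\<lambda>\<psi>. Y (s, \<psi>)) \<phi> (X ?p))"
    by (simp only: deriv_on_product(2)[OF sm(2) s \<phi> tan(1)[OF s \<phi>]] deriv_on_product(2)[OF sm(4) s \<phi> tan(1)[OF s \<phi>]])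
  have dg: "deriv (\<lambda>t. g (t, \<phi>)) s = vector_derivative (\<lambda>t. g (t, \<phi>)) (at s)"
    using deriv_on_product(1)[OF sm(2) s \<phi> tan(1)[OF s \<phi>]]
    by (intro DERIV_imp_deriv) (simp add: has_real_derivative_iff_has_vector_derivative)
  show ?thesis
    unfolding W.levi_civita_eq[OF U V p] S.levi_civita_eq[OF X Y \<phi>] W.nabla_def S.nabla_def dV dg
    by (simp add: \<Gamma>_def)
qed

lemma curvature_warped:
  fixes X Y Z :: "'h::real_inner"
  assumes s: "s \<in> I" and \<phi>: "\<phi> \<in> sphere 0 1"
    and T: "X \<in> tangent_space (sphere 0 1) \<phi>" "Y \<in> tangent_space (sphere 0 1) \<phi>" "Z \<in> tangent_space (sphere 0 1) \<phi>"
  shows "curvature M metric (s, \<phi>) (f, X) (g, Y) (h, Z) =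
    ((a\<^sub>2 s / 2 - (a\<^sub>1 s)\<^sup>2 / (4 * a s)) * ((g *\<^sub>R X - f *\<^sub>R Y) \<bullet> Z),
     curvature (sphere 0 1) (\<lambda>_. (\<bullet>)) \<phi> X Y Z
       - ((b\<^sub>1 s + (a\<^sub>1 s)\<^sup>2 / (4 * (a s)\<^sup>2)) * h) *\<^sub>R (g *\<^sub>R X - f *\<^sub>R Y)
       + ((a\<^sub>1 s)\<^sup>2 / (4 * a s)) *\<^sub>R ((X \<bullet> Z) *\<^sub>R Y - (Y \<bullet> Z) *\<^sub>R X))"
proof -
  let ?N = "I \<times> sphere (0::'h) 1" and ?p = "(s, \<phi>)"
  interpret W: submanifold_connection ?N metric \<Gamma> d\<Gamma> by (rule warped_connection)
  have p: "?p \<in> ?N" using s \<phi> by simp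
  have T': "(c, V) \<in> tangent_space ?N ?p" if "V \<in> tangent_space (sphere 0 1) \<phi>" for c V
    using that tangent_space_product[OF s \<phi>] by simp
  define \<beta> where "\<beta> = b s"
  have \<beta>: "(a\<^sub>1 s)\<^sup>2 / (4 * a s) = a\<^sub>1 s * \<beta> / 2" "(a\<^sub>1 s)\<^sup>2 / (4 * (a s)\<^sup>2) = \<beta> * \<beta>"
    by (simp_all add: \<beta>_def power2_eq_square)
  have o: "X \<bullet> \<phi> = 0" "Y \<bullet> \<phi> = 0"
    using T tangent_space_sphere[OF \<phi>] by (auto simp: inner_commute)
  have "W.curvature_form ?p (f, X) (g, Y) (h, Z) =
    ((a\<^sub>2 s / 2 - a\<^sub>1 s * \<beta> / 2) * ((g *\<^sub>R X - f *\<^sub>R Y) \<bullet> Z),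
     ((Y \<bullet> Z) *\<^sub>R X - (X \<bullet> Z) *\<^sub>R Y) - ((b\<^sub>1 s + \<beta> * \<beta>) * h) *\<^sub>R (g *\<^sub>R X - f *\<^sub>R Y)
       + (a\<^sub>1 s * \<beta> / 2) *\<^sub>R ((X \<bullet> Z) *\<^sub>R Y - (Y \<bullet> Z) *\<^sub>R X))"
    unfolding W.curvature_form_def \<Gamma>_def d\<Gamma>_def fst_conv snd_conv \<beta>_def[symmetric]
    by (simp add: o inner_add_left inner_add_right inner_diff_left inner_commute[of Y X] algebra_simps)
  then show ?thesis
    unfolding \<beta> sphere_curvature[OF \<phi> T] W.curvature_eq[OF p T'[OF T(1)] T'[OF T(2)] T'[OF T(3)]] .
qed

lemma curvature_numerator_warped:
  fixes X Y :: "'h::real_inner"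
  assumes s: "s \<in> I" and \<phi>: "\<phi> \<in> sphere 0 1"
    and T: "X \<in> tangent_space (sphere 0 1) \<phi>" "Y \<in> tangent_space (sphere 0 1) \<phi>"
  shows "metric (s, \<phi>) (curvature M metric (s, \<phi>) (f, X) (g, Y) (g, Y)) (f, X) =
      a s * (curvature (sphere 0 1) (\<lambda>_. (\<bullet>)) \<phi> X Y Y \<bullet> X)
        - (a\<^sub>2 s / 2 - (a\<^sub>1 s)\<^sup>2 / (4 * a s)) * ((g *\<^sub>R X - f *\<^sub>R Y) \<bullet> (g *\<^sub>R X - f *\<^sub>R Y))
        + (a\<^sub>1 s)\<^sup>2 / 4 * ((X \<bullet> Y)\<^sup>2 - (Y \<bullet> Y) * (X \<bullet> X))"
proof -
  have a: "a s \<noteq> 0" using a_pos[OF s] by simp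
  define \<kappa> where "\<kappa> = a\<^sub>2 s / 2 - (a\<^sub>1 s)\<^sup>2 / (4 * a s)"
  define \<beta> where "\<beta> = (a\<^sub>1 s)\<^sup>2 / (4 * a s)"
  have 1: "b\<^sub>1 s + (a\<^sub>1 s)\<^sup>2 / (4 * (a s)\<^sup>2) = \<kappa> / a s"
    unfolding b1_eq[OF s] \<kappa>_def using a by (simp add: field_simps power2_eq_square)
  have 2: "(a\<^sub>1 s)\<^sup>2 / 4 = a s * \<beta>"
    using a by (simp add: \<beta>_def)
  have 3: "a\<^sub>2 s / 2 - \<beta> = \<kappa>" by (simp add: \<kappa>_def \<beta>_def)
  show ?thesis
    unfolding curvature_warped[OF s \<phi> T T(2)] 1 2 3 \<beta>_def[symmetric] metric_def fst_conv snd_conv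
    using a by (simp add: inner_add_left inner_diff_left inner_diff_right inner_commute[of Y X] power2_eq_square
      field_simps)
qed

end

section \<open>Sectional curvatures\<close>

lemma in_span_pair: "x \<in> span {u, v} \<longleftrightarrow> (\<exists>\<alpha> \<beta>. x = \<alpha> *\<^sub>R u + \<beta> *\<^sub>R v)"
  for x u v :: "'v::real_vector"
proof
  assume "x \<in> span {u, v}"
  then obtain k l where "x - k *\<^sub>R u = l *\<^sub>R v"
    by (auto simp: span_insert span_singleton)
  then have "x = k *\<^sub>R u + l *\<^sub>R v" by (simp add: algebra_simps)
  then show "\<exists>\<alpha> \<beta>. x = \<alpha> *\<^sub>R u + \<beta> *\<^sub>R v" by blast
next
  assume "\<exists>\<alpha> \<beta>. x = \<alpha> *\<^sub>R u + \<beta> *\<^sub>R v"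
  then obtain \<alpha> \<beta> where x: "x = \<alpha> *\<^sub>R u + \<beta> *\<^sub>R v" by blast
  show "x \<in> span {u, v}" unfolding x by (intro span_add span_scale span_base) simp_all
qed

text \<open>
  In the span of three orthonormal vectors the orthogonal complement of \<open>p\<close> is at least a plane.  In
  the coordinates \<open>c = (c1, c2, c3)\<close> of the projection of \<open>p\<close>, it contains \<open>x = (c2, - c1, 0)\<close> and the
  cross product \<open>y\<close> of \<open>c\<close> and \<open>x\<close>.
\<close>

lemma orthonormal_pair_perp:
  fixes e1 e2 e3 p :: "'h::real_inner"
  assumes "e1 \<bullet> e1 = 1" "e2 \<bullet> e2 = 1" "e3 \<bullet> e3 = 1" "e1 \<bullet> e2 = 0" "e1 \<bullet> e3 = 0" "e2 \<bullet> e3 = 0"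
  obtains x y where "p \<bullet> x = 0" "p \<bullet> y = 0" "x \<bullet> y = 0" "x \<bullet> x = 1" "y \<bullet> y = 1"
proof -
  note result = that
  have normalize: thesis if "p \<bullet> x = 0" "p \<bullet> y = 0" "x \<bullet> y = 0" "x \<bullet> x > 0" "y \<bullet> y > 0" for x y
  proof (rule result[of "sgn x" "sgn y"])
    have "x \<noteq> 0" "y \<noteq> 0" using \<open>x \<bullet> x > 0\<close> \<open>y \<bullet> y > 0\<close> by auto
    then show "sgn x \<bullet> sgn x = 1" "sgn y \<bullet> sgn y = 1" by (simp_all add: dot_square_norm norm_sgn)
  qed (use \<open>p \<bullet> x = 0\<close> \<open>p \<bullet> y = 0\<close> \<open>x \<bullet> y = 0\<close> in \<open>simp_all add: sgn_div_norm\<close>)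
  define c1 c2 c3 where c: "c1 = p \<bullet> e1" "c2 = p \<bullet> e2" "c3 = p \<bullet> e3"
  have o: "e2 \<bullet> e1 = 0" "e3 \<bullet> e1 = 0" "e3 \<bullet> e2 = 0" using assms by (simp_all add: inner_commute)
  show thesis
  proof (cases "c1 = 0 \<and> c2 = 0")
    case True
    then show ?thesis using normalize[of e1 e2] assms c by simp
  next
    case False
    then have pos: "0 < c1 * c1 + c2 * c2"
      by (auto simp: sum_squares_gt_zero_iff)
    define x where "x = c2 *\<^sub>R e1 - c1 *\<^sub>R e2"
    define y where "y = (c1 * c3) *\<^sub>R e1 + (c2 * c3) *\<^sub>R e2 - (c1 * c1 + c2 * c2) *\<^sub>R e3"
    have "x \<bullet> x = c1 * c1 + c2 * c2"
      using assms o by (simp add: x_def inner_diff_left inner_diff_right)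
    moreover have "y \<bullet> y = c1 * c3 * (c1 * c3) + c2 * c3 * (c2 * c3) + (c1 * c1 + c2 * c2) * (c1 * c1 + c2 * c2)"
      using assms o by (simp add: y_def inner_diff_left inner_diff_right inner_add_left inner_add_right algebra_simps)
    moreover have "0 \<le> c1 * c3 * (c1 * c3)" "0 \<le> c2 * c3 * (c2 * c3)" "0 < (c1 * c1 + c2 * c2) * (c1 * c1 + c2 * c2)"
      using pos by simp_all
    moreover have "x \<bullet> y = 0"
      using assms o by (simp add: x_def y_def inner_diff_left inner_diff_right inner_add_right)
    moreover have "p \<bullet> x = 0" "p \<bullet> y = 0"
      by (simp_all add: x_def y_def inner_diff_right inner_add_right flip: c) (simp add: algebra_simps)
    ultimately show ?thesis using pos by (intro normalize[of x y]) linarith+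
  qed
qed

context warped_product
begin

definition tangential_curvature :: "real \<Rightarrow> real" where
  "tangential_curvature s = 1 / a s - (a\<^sub>1 s)\<^sup>2 / (4 * (a s)\<^sup>2)"

definition radial_curvature :: "real \<Rightarrow> real" where
  "radial_curvature s = - (a\<^sub>2 s / (2 * a s)) + (a\<^sub>1 s)\<^sup>2 / (4 * (a s)\<^sup>2)"

text \<open>
  The squared area of the parallelogram spanned by \<open>u\<close> and \<open>v\<close> is the sum of two parts: its projection to
  the tangent space of the sphere, and its part that involves the direction \<open>\<partial>\<^sub>s\<close>.
\<close>

definition tangential_area :: "real \<Rightarrow> real \<times> 'h::real_inner \<Rightarrow> real \<times> 'h \<Rightarrow> real" where
  "tangential_area s u v = (a s)\<^sup>2 * ((snd u \<bullet> snd u) * (snd v \<bullet> snd v) - (snd u \<bullet> snd v)\<^sup>2)"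

definition radial_area :: "real \<Rightarrow> real \<times> 'h::real_inner \<Rightarrow> real \<times> 'h \<Rightarrow> real" where
  "radial_area s u v = a s * ((fst v *\<^sub>R snd u - fst u *\<^sub>R snd v) \<bullet> (fst v *\<^sub>R snd u - fst u *\<^sub>R snd v))"

lemma area_decomposition:
  "tangential_area s u v + radial_area s u v = metric (s, \<phi>) u u * metric (s, \<phi>) v v - (metric (s, \<phi>) u v)\<^sup>2"
  by (simp add: tangential_area_def radial_area_def metric_def inner_diff_left inner_diff_right
      inner_commute[of "snd v" "snd u"] power2_eq_square algebra_simps)

text \<open>
  Both parts are quadratic forms in the bivector of \<open>u\<close> and \<open>v\<close>, hence scale by the squared determinant.
  As their sum is 1 for every orthonormal basis of a plane, so is the squared determinant, and both
  parts depend on the plane only.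
\<close>

lemma area_change_basis:
  "tangential_area s (\<alpha> *\<^sub>R u + \<beta> *\<^sub>R v) (\<gamma> *\<^sub>R u + \<delta> *\<^sub>R v) = (\<alpha> * \<delta> - \<beta> * \<gamma>)\<^sup>2 * tangential_area s u v"
  "radial_area s (\<alpha> *\<^sub>R u + \<beta> *\<^sub>R v) (\<gamma> *\<^sub>R u + \<delta> *\<^sub>R v) = (\<alpha> * \<delta> - \<beta> * \<gamma>)\<^sup>2 * radial_area s u v"
  by (simp_all add: tangential_area_def radial_area_def inner_diff_left inner_diff_right
      inner_add_left inner_add_right inner_commute[of "snd v" "snd u"] power2_eq_square algebra_simps)

lemma area_nonneg:
  assumes "s \<in> I"
  shows "0 \<le> tangential_area s u v" "0 \<le> radial_area s u v"
  using Cauchy_Schwarz_ineq[of "snd u" "snd v"] a_pos[OF assms]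
  by (simp_all add: tangential_area_def radial_area_def)

lemma curvature_numerator_area:
  fixes u v :: "real \<times> 'h::real_inner"
  assumes s: "s \<in> I" and \<phi>: "\<phi> \<in> sphere 0 1"
    and uv: "u \<in> tangent_space M (s, \<phi>)" "v \<in> tangent_space M (s, \<phi>)"
  shows "metric (s, \<phi>) (curvature M metric (s, \<phi>) u v v) u
    = tangential_curvature s * tangential_area s u v + radial_curvature s * radial_area s u v"
proof -
  obtain f X g Y where e: "u = (f, X)" "v = (g, Y)" by (cases u; cases v)
  have T: "X \<in> tangent_space (sphere 0 1) \<phi>" "Y \<in> tangent_space (sphere 0 1) \<phi>"
    using uv tangent_space_product[OF s \<phi>] by (auto simp: e)
  have a: "a s \<noteq> 0" using a_pos[OF s] by simp
  have "tangential_curvature s * (a s)\<^sup>2 = a s - (a\<^sub>1 s)\<^sup>2 / 4"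
    "radial_curvature s * a s = - (a\<^sub>2 s / 2 - (a\<^sub>1 s)\<^sup>2 / (4 * a s))"
    using a by (simp_all add: tangential_curvature_def radial_curvature_def field_simps power2_eq_square)
  note coeff = this[symmetric]
  have "metric (s, \<phi>) (curvature M metric (s, \<phi>) u v v) u =
      (a s - (a\<^sub>1 s)\<^sup>2 / 4) * ((X \<bullet> X) * (Y \<bullet> Y) - (X \<bullet> Y)\<^sup>2)
      + (- (a\<^sub>2 s / 2 - (a\<^sub>1 s)\<^sup>2 / (4 * a s))) * ((g *\<^sub>R X - f *\<^sub>R Y) \<bullet> (g *\<^sub>R X - f *\<^sub>R Y))"
    unfolding e curvature_numerator_warped[OF s \<phi> T] sphere_curvature[OF \<phi> T T(2)] inner_diff_left[of "_ *\<^sub>R X" "_ *\<^sub>R Y" X]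
    by (simp add: inner_commute[of Y X] power2_eq_square left_diff_distrib right_diff_distrib mult_ac)
  then show ?thesis
    unfolding coeff tangential_area_def radial_area_def e fst_conv snd_conv by (simp only: mult.assoc)
qed

lemma sectional_curvature_warped:
  fixes u v :: "real \<times> 'h::real_inner"
  assumes s: "s \<in> I" and \<phi>: "\<phi> \<in> sphere 0 1"
    and uv: "u \<in> tangent_space M (s, \<phi>)" "v \<in> tangent_space M (s, \<phi>)"
    and on: "metric (s, \<phi>) u u = 1" "metric (s, \<phi>) v v = 1" "metric (s, \<phi>) u v = 0"
  shows "sectional_curvature M metric (s, \<phi>) (span {u, v})
    = tangential_curvature s * tangential_area s u v + radial_curvature s * radial_area s u v"
  unfolding sectional_curvature_def
proof (rule the_equality)
  show "\<exists>u' v'. span {u', v'} = span {u, v} \<and> metric (s, \<phi>) u' u' = 1 \<and> metric (s, \<phi>) v' v' = 1 \<and>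
      metric (s, \<phi>) u' v' = 0 \<and> tangential_curvature s * tangential_area s u v + radial_curvature s * radial_area s u v
        = metric (s, \<phi>) (curvature M metric (s, \<phi>) u' v' v') u'"
    using on curvature_numerator_area[OF s \<phi> uv] by (intro exI[of _ u] exI[of _ v]) simp
next
  fix k assume "\<exists>u' v'. span {u', v'} = span {u, v} \<and> metric (s, \<phi>) u' u' = 1 \<and> metric (s, \<phi>) v' v' = 1 \<and>
      metric (s, \<phi>) u' v' = 0 \<and> k = metric (s, \<phi>) (curvature M metric (s, \<phi>) u' v' v') u'"
  then obtain u' v' where sp: "span {u', v'} = span {u, v}"
    and on': "metric (s, \<phi>) u' u' = 1" "metric (s, \<phi>) v' v' = 1" "metric (s, \<phi>) u' v' = 0"
    and k: "k = metric (s, \<phi>) (curvature M metric (s, \<phi>) u' v' v') u'"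
    by blast
  interpret W: submanifold_connection "I \<times> sphere (0::'h) 1" metric \<Gamma> d\<Gamma> by (rule warped_connection)
  have "u' \<in> span {u, v}" "v' \<in> span {u, v}" unfolding sp[symmetric] by (auto intro: span_base)
  then obtain \<alpha> \<beta> \<gamma> \<delta> where e: "u' = \<alpha> *\<^sub>R u + \<beta> *\<^sub>R v" "v' = \<gamma> *\<^sub>R u + \<delta> *\<^sub>R v"
    unfolding in_span_pair by blast
  have "subspace (tangent_space M (s, \<phi>))"
    by (rule W.subspace_tangent) (use s \<phi> in simp)
  then have uv': "u' \<in> tangent_space M (s, \<phi>)" "v' \<in> tangent_space M (s, \<phi>)"
    unfolding e using uv by (auto intro!: subspace_add subspace_scale)
  have "tangential_area s u' v' + radial_area s u' v' = 1" "tangential_area s u v + radial_area s u v = 1"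
    unfolding area_decomposition[of s _ _ \<phi>] on on' by simp_all
  moreover have "tangential_area s u' v' = (\<alpha> * \<delta> - \<beta> * \<gamma>)\<^sup>2 * tangential_area s u v"
    "radial_area s u' v' = (\<alpha> * \<delta> - \<beta> * \<gamma>)\<^sup>2 * radial_area s u v"
    unfolding e by (rule area_change_basis)+
  ultimately have "(\<alpha> * \<delta> - \<beta> * \<gamma>)\<^sup>2 = 1"
    using distrib_left[of "(\<alpha> * \<delta> - \<beta> * \<gamma>)\<^sup>2" "tangential_area s u v" "radial_area s u v"] by simp
  then have "tangential_area s u' v' = tangential_area s u v" "radial_area s u' v' = radial_area s u v"
    unfolding e area_change_basis by simp_all
  then show "k = tangential_curvature s * tangential_area s u v + radial_curvature s * radial_area s u v"
    unfolding k curvature_numerator_area[OF s \<phi> uv'] by simp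
qed

text \<open>
  Gram-Schmidt orthonormalization of a basis with respect to the metric at the point.
\<close>

lemma tangent_plane_orthonormal:
  fixes \<phi> :: "'h::real_inner"
  assumes s: "s \<in> I" and \<phi>: "\<phi> \<in> sphere 0 1"
    and P: "P \<in> tangent_planes M (s, \<phi>)"
  obtains u v where "P = span {u, v}" "metric (s, \<phi>) u u = 1" "metric (s, \<phi>) v v = 1" "metric (s, \<phi>) u v = 0"
    "u \<in> tangent_space M (s, \<phi>)" "v \<in> tangent_space M (s, \<phi>)"
proof -
  let ?G = "metric (s, \<phi>)"
  have P': "subspace P" "P \<subseteq> tangent_space M (s, \<phi>)" "dim P = 2"
    using P by (auto simp: tangent_planes_def)
  obtain B where B: "B \<subseteq> P" "independent B" "P \<subseteq> span B" "card B = dim P"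
    using basis_exists by blast
  obtain x y where xy: "B = {x, y}" "x \<noteq> y" using B(4) P'(3) by (auto simp: card_2_iff)
  have nz: "x \<noteq> 0" "y \<notin> span {x}"
    using B(2) dependent_zero[of B] independent_insert[of y "{x}"] xy by (auto simp: insert_commute)
  have pos: "0 < ?G w w" if "w \<noteq> 0" for w
  proof -
    have "fst w \<noteq> 0 \<or> snd w \<noteq> 0" using that by (simp add: prod_eq_iff)
    then show ?thesis
    proof
      assume "fst w \<noteq> 0"
      then have "0 < fst w * fst w" by (auto simp: zero_less_mult_iff linorder_neq_iff)
      then show ?thesis using a_pos[OF s] by (simp add: metric_def add_pos_nonneg)
    next
      assume "snd w \<noteq> 0"
      then show ?thesis using a_pos[OF s] by (simp add: metric_def add_nonneg_pos)
    qed
  qed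
  have Gs: "?G (c *\<^sub>R w) z = c * ?G w z" "?G z (c *\<^sub>R w) = c * ?G z w" "?G (w - w') z = ?G w z - ?G w' z"
    "?G z w = ?G w z" for c w w' z
    by (simp_all add: metric_def inner_diff_left inner_commute[of "snd z"] algebra_simps)
  have normalize: "?G (w /\<^sub>R sqrt (?G w w)) (w /\<^sub>R sqrt (?G w w)) = 1" if "w \<noteq> 0" for w
    using pos[OF that] unfolding Gs(1,2) by (simp add: field_simps)
  define u where "u = x /\<^sub>R sqrt (?G x x)"
  define w where "w = y - ?G y u *\<^sub>R u"
  define v where "v = w /\<^sub>R sqrt (?G w w)"
  have u1: "?G u u = 1" unfolding u_def by (rule normalize[OF nz(1)])
  have "w \<noteq> 0"
  proof
    assume "w = 0"
    then have "y = (?G y u / sqrt (?G x x)) *\<^sub>R x" by (simp add: w_def u_def divide_inverse)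
    moreover have "(?G y u / sqrt (?G x x)) *\<^sub>R x \<in> span {x}" by (intro span_scale span_base) simp
    ultimately show False using nz(2) by simp
  qed
  then have v1: "?G v v = 1" unfolding v_def by (rule normalize)
  have "?G w u = 0" unfolding w_def Gs(1,3) u1 by simp
  then have uv0: "?G u v = 0" unfolding v_def Gs(2) Gs(4)[of u w] by simp
  have xP: "x \<in> P" "y \<in> P" using B(1) xy by auto
  then have uP: "u \<in> P" unfolding u_def using P'(1) by (intro subspace_scale)
  then have vP: "v \<in> P" unfolding v_def w_def using P'(1) xP by (intro subspace_scale subspace_diff)
  have "x = sqrt (?G x x) *\<^sub>R u + 0 *\<^sub>R v" using pos[OF nz(1)] by (simp add: u_def)
  then have x: "x \<in> span {u, v}" unfolding in_span_pair by blast
  have w: "sqrt (?G w w) *\<^sub>R v = w" using pos[OF \<open>w \<noteq> 0\<close>] by (simp add: v_def)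
  have "y = ?G y u *\<^sub>R u + sqrt (?G w w) *\<^sub>R v" unfolding w by (simp add: w_def)
  then have y: "y \<in> span {u, v}" unfolding in_span_pair by blast
  have "P \<subseteq> span {u, v}"
    using B(3) x y xy span_minimal[of "{x, y}" "span {u, v}"] by auto
  moreover have "span {u, v} \<subseteq> P" by (rule span_minimal[OF _ P'(1)]) (use uP vP in simp)
  ultimately show thesis using that[of u v] u1 v1 uv0 uP vP P'(2) by blast
qed

lemma orthonormal_tangent_plane:
  fixes u v :: "real \<times> 'h::real_inner"
  assumes s: "s \<in> I" and \<phi>: "\<phi> \<in> sphere 0 1"
    and uv: "u \<in> tangent_space M (s, \<phi>)" "v \<in> tangent_space M (s, \<phi>)"
    and on: "metric (s, \<phi>) u u = 1" "metric (s, \<phi>) v v = 1" "metric (s, \<phi>) u v = 0"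
  shows "span {u, v} \<in> tangent_planes M (s, \<phi>)"
proof -
  interpret W: submanifold_connection "I \<times> sphere (0::'h) 1" metric \<Gamma> d\<Gamma> by (rule warped_connection)
  have "subspace (tangent_space M (s, \<phi>))"
    by (rule W.subspace_tangent) (use s \<phi> in simp)
  then have "span {u, v} \<subseteq> tangent_space M (s, \<phi>)"
    using uv by (intro span_minimal) auto
  moreover have nv: "v \<noteq> 0" using on(2) by (auto simp: metric_def)
  have "u \<notin> span {v}"
  proof
    assume "u \<in> span {v}"
    then obtain k where k: "u = k *\<^sub>R v" by (auto simp: span_singleton)
    have "metric (s, \<phi>) (k *\<^sub>R v) v = k * metric (s, \<phi>) v v" by (simp add: metric_def algebra_simps)
    then have "k = 0" using on k by simp
    then show False using on(1) k by (simp add: metric_def)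
  qed
  then have "independent {u, v}" "u \<noteq> v"
    using nv by (auto simp: independent_insert span_base)
  then have "dim (span {u, v}) = 2" by (simp add: dim_eq_card_independent)
  ultimately show ?thesis by (simp add: tangent_planes_def)
qed

text \<open>
  For an orthonormal basis the two parts of the area are nonnegative and add up to 1, so each sectional
  curvature is a convex combination of the two special ones.  Turning \<open>\<partial>\<^sub>s\<close> towards \<open>X\<close> while \<open>Y\<close> is kept
  fixed realizes every weight.
\<close>

lemma sectional_curvatures_warped:
  fixes \<phi> X Y :: "'h::real_inner"
  assumes s: "s \<in> I" and \<phi>: "\<phi> \<in> sphere 0 1"
    and T: "X \<in> tangent_space (sphere 0 1) \<phi>" "Y \<in> tangent_space (sphere 0 1) \<phi>"
    and on: "X \<bullet> Y = 0" "X \<bullet> X = 1 / a s" "Y \<bullet> Y = 1 / a s"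
  shows "sectional_curvature M metric (s, \<phi>) (span {(0, X), (0, Y)}) = tangential_curvature s"
    and "sectional_curvature M metric (s, \<phi>) (span {(1, 0), (0, Y)}) = radial_curvature s"
    and "sectional_curvature M metric (s, \<phi>) ` tangent_planes M (s, \<phi>)
      = closed_segment (tangential_curvature s) (radial_curvature s)"
proof -
  have a: "0 < a s" by (rule a_pos[OF s])
  have mem: "(c, k *\<^sub>R V) \<in> tangent_space M (s, \<phi>)" if "V \<in> tangent_space (sphere 0 1) \<phi>" for c k V
    using that tangent_space_product[OF s \<phi>] tangent_space_sphere[OF \<phi>] by simp
  \<comment> \<open>the planes that interpolate between the tangential and the radial one\<close>
  have mix: "sectional_curvature M metric (s, \<phi>) (span {(c, k *\<^sub>R X), (0, Y)})
      = tangential_curvature s * k\<^sup>2 + radial_curvature s * c\<^sup>2"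
    and plane: "span {(c, k *\<^sub>R X), (0, Y)} \<in> tangent_planes M (s, \<phi>)"
    if "c\<^sup>2 + k\<^sup>2 = 1" for c k
  proof -
    have 1: "metric (s, \<phi>) (c, k *\<^sub>R X) (c, k *\<^sub>R X) = 1" "metric (s, \<phi>) (0, Y) (0, Y) = 1"
      "metric (s, \<phi>) (c, k *\<^sub>R X) (0, Y) = 0"
      using that a by (simp_all add: metric_def on power2_eq_square)
    have 2: "(0, Y) \<in> tangent_space M (s, \<phi>)" using mem[OF T(2), of 0 1] by simp
    have 3: "tangential_area s (c, k *\<^sub>R X) (0, Y) = k\<^sup>2" "radial_area s (c, k *\<^sub>R X) (0, Y) = c\<^sup>2"
      using a by (simp_all add: tangential_area_def radial_area_def on power2_eq_square)
    show "sectional_curvature M metric (s, \<phi>) (span {(c, k *\<^sub>R X), (0, Y)})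
      = tangential_curvature s * k\<^sup>2 + radial_curvature s * c\<^sup>2"
      unfolding sectional_curvature_warped[OF s \<phi> mem[OF T(1)] 2 1] 3 ..
    show "span {(c, k *\<^sub>R X), (0, Y)} \<in> tangent_planes M (s, \<phi>)"
      by (rule orthonormal_tangent_plane[OF s \<phi> mem[OF T(1)] 2 1])
  qed
  show "sectional_curvature M metric (s, \<phi>) (span {(0, X), (0, Y)}) = tangential_curvature s"
    using mix[of 0 1] by simp
  show "sectional_curvature M metric (s, \<phi>) (span {(1, 0), (0, Y)}) = radial_curvature s"
    using mix[of 1 0] by simp
  show "sectional_curvature M metric (s, \<phi>) ` tangent_planes M (s, \<phi>)
      = closed_segment (tangential_curvature s) (radial_curvature s)"
  proof (intro set_eqI iffI)
    fix k assume "k \<in> sectional_curvature M metric (s, \<phi>) ` tangent_planes M (s, \<phi>)"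
    then obtain P where P: "P \<in> tangent_planes M (s, \<phi>)"
      and k: "k = sectional_curvature M metric (s, \<phi>) P" by blast
    obtain u v where uv: "P = span {u, v}" "metric (s, \<phi>) u u = 1" "metric (s, \<phi>) v v = 1" "metric (s, \<phi>) u v = 0"
      "u \<in> tangent_space M (s, \<phi>)" "v \<in> tangent_space M (s, \<phi>)"
      using tangent_plane_orthonormal[OF s \<phi> P] by blast
    define t where "t = radial_area s u v"
    have t: "tangential_area s u v = 1 - t"
      using area_decomposition[of s u v \<phi>] uv(2-4) by (simp add: t_def)
    have "0 \<le> t" "t \<le> 1" using area_nonneg[OF s, of u v] t by (simp_all add: t_def)
    moreover have "k = (1 - t) *\<^sub>R tangential_curvature s + t *\<^sub>R radial_curvature s"
      unfolding k uv(1) sectional_curvature_warped[OF s \<phi> uv(5,6,2,3,4)] t by (simp add: t_def mult.commute)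
    ultimately show "k \<in> closed_segment (tangential_curvature s) (radial_curvature s)"
      unfolding closed_segment_def by blast
  next
    fix k assume "k \<in> closed_segment (tangential_curvature s) (radial_curvature s)"
    then obtain t where t: "0 \<le> t" "t \<le> 1" and k: "k = (1 - t) *\<^sub>R tangential_curvature s + t *\<^sub>R radial_curvature s"
      unfolding closed_segment_def by blast
    have sq: "(sqrt t)\<^sup>2 + (sqrt (1 - t))\<^sup>2 = 1" using t by simp
    have "k = sectional_curvature M metric (s, \<phi>) (span {(sqrt t, sqrt (1 - t) *\<^sub>R X), (0, Y)})"
      unfolding mix[OF sq] k using t by (simp add: mult.commute)
    then show "k \<in> sectional_curvature M metric (s, \<phi>) ` tangent_planes M (s, \<phi>)"
      using plane[OF sq] by blast
  qed
qed

end

section \<open>Smooth functions of one real variable\<close>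

text \<open>
  Finitely many derivatives, so that closure properties can be shown by induction on their number; in
  particular, the regularity of an inverse function is bootstrapped from the equation for its
  derivative.
\<close>

definition n_differentiable :: "nat \<Rightarrow> real set \<Rightarrow> (real \<Rightarrow> real) \<Rightarrow> bool" where
  "n_differentiable n U f \<longleftrightarrow> (\<forall>k<n. \<forall>t\<in>U. ((deriv ^^ k) f) field_differentiable (at t))"

lemma n_differentiable_0 [simp]: "n_differentiable 0 U f"
  by (simp add: n_differentiable_def)

lemma n_differentiable_Suc:
  "n_differentiable (Suc n) U f \<longleftrightarrow> (\<forall>t\<in>U. f field_differentiable (at t)) \<and> n_differentiable n U (deriv f)"
  unfolding n_differentiable_def
  by (auto simp: less_Suc_eq_0_disj funpow_Suc_right simp del: funpow.simps(2))

lemma n_differentiable_SucD: "n_differentiable (Suc n) U f \<Longrightarrow> n_differentiable n U f"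
  by (simp add: n_differentiable_def)

lemma n_differentiable_Suc_deriv: "n_differentiable (Suc n) U f \<Longrightarrow> n_differentiable n U (deriv f)"
  by (simp add: n_differentiable_Suc)

lemma n_differentiable_subset: "n_differentiable n U f \<Longrightarrow> V \<subseteq> U \<Longrightarrow> n_differentiable n V f"
  by (auto simp: n_differentiable_def)

lemma n_differentiable_deriv:
  "n_differentiable (Suc n) U f \<Longrightarrow> t \<in> U \<Longrightarrow> (f has_real_derivative deriv f t) (at t)"
  by (simp add: n_differentiable_Suc field_differentiable_derivI)

lemma n_differentiable_cong:
  assumes "open U" "\<And>t. t \<in> U \<Longrightarrow> f t = g t" "n_differentiable n U f"
  shows "n_differentiable n U g"
  using assms(2,3)
proof (induction n arbitrary: f g)
  case (Suc n)
  have ev: "\<forall>\<^sub>F x in nhds t. f x = g x" if "t \<in> U" for t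
    using eventually_nhds_in_open[OF assms(1) that] by eventually_elim (rule Suc.prems(1))
  show ?case
    unfolding n_differentiable_Suc
  proof
    show "\<forall>t\<in>U. g field_differentiable at t"
    proof
      fix t assume t: "t \<in> U"
      have "(f has_real_derivative deriv f t) (at t)"
        by (rule n_differentiable_deriv[OF Suc.prems(2) t])
      then have "(g has_real_derivative deriv f t) (at t)"
        using DERIV_cong_ev[OF refl ev[OF t] refl] by blast
      then show "g field_differentiable at t" by (auto simp: field_differentiable_def)
    qed
    have "deriv f t = deriv g t" if "t \<in> U" for t
      by (rule deriv_cong_ev[OF ev[OF that] refl])
    then show "n_differentiable n U (deriv g)"
      by (rule Suc.IH) (use Suc.prems(2) in \<open>simp_all add: n_differentiable_Suc\<close>)
  qed
qed simp

lemma n_differentiable_SucI: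
  assumes "open U" "\<And>t. t \<in> U \<Longrightarrow> (f has_real_derivative f' t) (at t)" "n_differentiable n U f'"
  shows "n_differentiable (Suc n) U f"
  unfolding n_differentiable_Suc
proof
  show "\<forall>t\<in>U. f field_differentiable at t"
    using assms(2) by (auto simp: field_differentiable_def)
  show "n_differentiable n U (deriv f)"
    by (rule n_differentiable_cong[OF assms(1) _ assms(3)]) (simp add: DERIV_imp_deriv[OF assms(2)])
qed

lemma n_differentiable_const: "open U \<Longrightarrow> n_differentiable n U (\<lambda>t. c)"
proof (induction n arbitrary: c)
  case (Suc n)
  show ?case
    by (rule n_differentiable_SucI[where f' = "\<lambda>t. 0"]) (use Suc in auto)
qed simp

lemma n_differentiable_ident: "open U \<Longrightarrow> n_differentiable n U (\<lambda>t. t)"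
  by (cases n) (auto intro!: n_differentiable_SucI[where f' = "\<lambda>t. 1"] n_differentiable_const)

lemma n_differentiable_add:
  assumes "open U"
  shows "n_differentiable n U f \<Longrightarrow> n_differentiable n U g \<Longrightarrow> n_differentiable n U (\<lambda>t. f t + g t)"
proof (induction n arbitrary: f g)
  case (Suc n)
  show ?case
  proof (rule n_differentiable_SucI[OF assms])
    show "((\<lambda>t. f t + g t) has_real_derivative deriv f t + deriv g t) (at t)" if "t \<in> U" for t
      by (rule DERIV_add[OF n_differentiable_deriv[OF Suc.prems(1) that] n_differentiable_deriv[OF Suc.prems(2) that]])
    show "n_differentiable n U (\<lambda>t. deriv f t + deriv g t)"
      by (rule Suc.IH[OF n_differentiable_Suc_deriv[OF Suc.prems(1)] n_differentiable_Suc_deriv[OF Suc.prems(2)]])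
  qed
qed simp

lemma n_differentiable_mult:
  assumes "open U"
  shows "n_differentiable n U f \<Longrightarrow> n_differentiable n U g \<Longrightarrow> n_differentiable n U (\<lambda>t. f t * g t)"
proof (induction n arbitrary: f g)
  case (Suc n)
  have "n_differentiable n U (\<lambda>t. deriv f t * g t)" "n_differentiable n U (\<lambda>t. deriv g t * f t)"
    by (rule Suc.IH[OF n_differentiable_Suc_deriv[OF Suc.prems(1)] n_differentiable_SucD[OF Suc.prems(2)]]
        Suc.IH[OF n_differentiable_Suc_deriv[OF Suc.prems(2)] n_differentiable_SucD[OF Suc.prems(1)]])+
  then have "n_differentiable n U (\<lambda>t. deriv f t * g t + deriv g t * f t)"
    by (rule n_differentiable_add[OF assms])
  moreover have "((\<lambda>t. f t * g t) has_real_derivative deriv f t * g t + deriv g t * f t) (at t)" if "t \<in> U" for t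
    by (rule DERIV_mult[OF n_differentiable_deriv[OF Suc.prems(1) that] n_differentiable_deriv[OF Suc.prems(2) that]])
  ultimately show ?case by (intro n_differentiable_SucI[OF assms])
qed simp

lemma n_differentiable_compose:
  assumes "open U" "\<And>t. t \<in> U \<Longrightarrow> g t \<in> V"
  shows "n_differentiable n V f \<Longrightarrow> n_differentiable n U g \<Longrightarrow> n_differentiable n U (\<lambda>t. f (g t))"
proof (induction n arbitrary: f)
  case (Suc n)
  have "n_differentiable n U (\<lambda>t. deriv f (g t))"
    by (rule Suc.IH[OF n_differentiable_Suc_deriv[OF Suc.prems(1)] n_differentiable_SucD[OF Suc.prems(2)]])
  then have "n_differentiable n U (\<lambda>t. deriv f (g t) * deriv g t)"
    by (rule n_differentiable_mult[OF assms(1)]) (rule n_differentiable_Suc_deriv[OF Suc.prems(2)])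
  moreover have "((\<lambda>t. f (g t)) has_real_derivative deriv f (g t) * deriv g t) (at t)" if "t \<in> U" for t
    by (rule DERIV_chain2[OF n_differentiable_deriv[OF Suc.prems(1) assms(2)[OF that]]
          n_differentiable_deriv[OF Suc.prems(2) that]])
  ultimately show ?case by (intro n_differentiable_SucI[OF assms(1)])
qed simp

lemma n_differentiable_inverse:
  assumes "open U" "\<And>t. t \<in> U \<Longrightarrow> f t \<noteq> 0" "n_differentiable n U f"
  shows "n_differentiable n U (\<lambda>t. inverse (f t))"
  using assms(3)
proof (induction n)
  case (Suc n)
  have inv: "n_differentiable n U (\<lambda>t. inverse (f t))" by (rule Suc.IH[OF n_differentiable_SucD[OF Suc.prems]])
  have "n_differentiable n U (\<lambda>t. (-1) * ((inverse (f t) * deriv f t) * inverse (f t)))"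
    by (intro n_differentiable_mult n_differentiable_const inv assms(1)
        n_differentiable_Suc_deriv[OF Suc.prems])
  moreover have "((\<lambda>t. inverse (f t)) has_real_derivative (-1) * ((inverse (f t) * deriv f t) * inverse (f t))) (at t)"
    if "t \<in> U" for t
    using DERIV_inverse'[OF n_differentiable_deriv[OF Suc.prems that] assms(2)[OF that]] by simp
  ultimately show ?case by (intro n_differentiable_SucI[OF assms(1)])
qed simp

lemma n_differentiable_sqrt:
  assumes "open U" "\<And>t. t \<in> U \<Longrightarrow> 0 < f t" "n_differentiable n U f"
  shows "n_differentiable n U (\<lambda>t. sqrt (f t))"
  using assms(3)
proof (induction n)
  case (Suc n)
  have sq: "n_differentiable n U (\<lambda>t. sqrt (f t))" by (rule Suc.IH[OF n_differentiable_SucD[OF Suc.prems]])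
  have "n_differentiable n U (\<lambda>t. (inverse (sqrt (f t)) * (1 / 2)) * deriv f t)"
    by (intro n_differentiable_mult n_differentiable_const n_differentiable_inverse sq assms(1)
        n_differentiable_Suc_deriv[OF Suc.prems]) (use assms(2) in force)
  moreover have "((\<lambda>t. sqrt (f t)) has_real_derivative (inverse (sqrt (f t)) * (1 / 2)) * deriv f t) (at t)"
    if "t \<in> U" for t
    using DERIV_chain2[OF DERIV_real_sqrt[OF assms(2)[OF that]] n_differentiable_deriv[OF Suc.prems that]] by simp
  ultimately show ?case by (intro n_differentiable_SucI[OF assms(1)])
qed simp

text \<open>
  On the real line the derivative of order \<open>k\<close> acts on \<open>k\<close> directions by multiplying them all.
\<close>

lemma n_differentiable_imp_smooth_on_open:
  assumes U: "open U" and f: "\<And>n. n_differentiable n U f"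
  shows "smooth_on_open U f"
proof -
  define F where "F k = (deriv ^^ k) f" for k
  have F: "(F k has_real_derivative F (Suc k) t) (at t)" if "t \<in> U" for k t
    using f[of "Suc k"] that by (auto simp: n_differentiable_def F_def intro: field_differentiable_derivI)
  define D where "D t vs = F (length vs) t * prod_list vs" for t and vs :: "real list"
  have norm_D: "norm (c * prod_list vs) = norm c * norm_prod vs" for c and vs :: "real list"
    by (induction vs arbitrary: c) (auto simp: abs_mult)
  have "deriv_family U D"
    unfolding deriv_family_def
  proof (intro ballI allI conjI impI)
    fix t k assume t: "t \<in> U"
    show "bounded_multilinear k (D t)"
      unfolding bounded_multilinear_def
    proof (intro conjI allI impI)
      show "linear (\<lambda>v. D t (us @ v # ws))" for us ws
        by (intro linearI) (simp_all add: D_def algebra_simps)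
      show "\<exists>K. \<forall>vs. length vs = k \<longrightarrow> norm (D t vs) \<le> K * norm_prod vs"
        by (rule exI[of _ "norm (F k t)"]) (auto simp: D_def norm_D simp del: real_norm_def)
    qed
    fix \<epsilon> :: real assume "0 < \<epsilon>"
    have "(F k has_derivative (\<lambda>h. h * F (Suc k) t)) (at t)"
      using F[OF t, of k] by (simp add: has_field_derivative_def mult.commute[of "F (Suc k) t"] mult_commute_abs)
    then obtain d where d: "0 < d" "\<And>y. norm (y - t) < d \<Longrightarrow>
        norm (F k y - F k t - (y - t) * F (Suc k) t) \<le> \<epsilon> * norm (y - t)"
      unfolding has_derivative_at_alt using \<open>0 < \<epsilon>\<close> by blast
    have "norm (D y vs - D t vs - D t ((y - t) # vs)) \<le> \<epsilon> * norm (y - t) * norm_prod vs"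
      if "dist y t < d" "length vs = k" for y vs
    proof -
      have "D y vs - D t vs - D t ((y - t) # vs) = (F k y - F k t - (y - t) * F (Suc k) t) * prod_list vs"
        using that(2) by (simp add: D_def algebra_simps)
      then have "norm (D y vs - D t vs - D t ((y - t) # vs))
          = norm (F k y - F k t - (y - t) * F (Suc k) t) * norm_prod vs"
        by (simp only: norm_D)
      also have "\<dots> \<le> \<epsilon> * norm (y - t) * norm_prod vs"
        by (intro mult_right_mono prod_list_norm_nonneg d(2)) (use that(1) in \<open>simp add: dist_norm\<close>)
      finally show ?thesis .
    qed
    then show "\<exists>\<delta>>0. \<forall>y\<in>U. dist y t < \<delta> \<longrightarrow> (\<forall>vs. length vs = k \<longrightarrow>
        norm (D y vs - D t vs - D t ((y - t) # vs)) \<le> \<epsilon> * norm (y - t) * norm_prod vs)"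
      using d(1) by (intro exI[of _ d]) simp
  qed
  then show ?thesis
    by (rule smooth_on_openI[OF U, rotated]) (simp add: D_def F_def)
qed

lemma deriv_family_n_differentiable:
  fixes D :: "real \<Rightarrow> real list \<Rightarrow> real"
  assumes D: "deriv_family U D" and U: "open U" and f: "\<And>t. t \<in> U \<Longrightarrow> D t (replicate k 1) = f t"
  shows "n_differentiable n U f"
  using f
proof (induction n arbitrary: f k)
  case (Suc n)
  have "(f has_real_derivative D t (replicate (Suc k) 1)) (at t)" if t: "t \<in> U" for t
  proof -
    have lin: "linear (\<lambda>h. D t (h # replicate k 1))"
      using bounded_multilinear_head[of "replicate k 1", OF deriv_family_multilinear[OF D t]]
      by (rule bounded_linear.linear)
    have eq: "(\<lambda>h. D t (h # replicate k 1)) = (*) (D t (replicate (Suc k) 1))"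
    proof
      show "D t (h # replicate k 1) = D t (replicate (Suc k) 1) * h" for h
        using linear_scale[OF lin, of h 1]
        unfolding real_scaleR_def mult_1_right replicate_Suc mult.commute[of h] .
    qed
    have "((\<lambda>y. D y (replicate k 1)) has_derivative (*) (D t (replicate (Suc k) 1))) (at t)"
      using deriv_family_has_derivative[OF D U t] unfolding eq[symmetric] .
    then have "(f has_derivative (*) (D t (replicate (Suc k) 1))) (at t)"
      by (rule has_derivative_transform_within_open[OF _ U t]) (rule Suc.prems)
    then show ?thesis by (simp add: has_field_derivative_def)
  qed
  then show ?case
    by (rule n_differentiable_SucI[OF U _ Suc.IH[of "Suc k", OF refl]])
qed simp

lemma smooth_on_imp_n_differentiable:
  fixes f :: "real \<Rightarrow> real"
  assumes f: "smooth_on U f" and U: "open U"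
  shows "n_differentiable n U f"
proof -
  have loc: "\<exists>V. t \<in> V \<and> n_differentiable n V f" if t: "t \<in> U" for t
  proof -
    obtain V g where V: "t \<in> V" "smooth_on_open V g" "\<forall>x\<in>U \<inter> V. f x = g x"
      using smooth_onE[OF f t] by blast
    obtain D where "open V" and D: "\<forall>x\<in>V. D x [] = g x" "deriv_family V D"
      using smooth_on_openE[OF V(2)] by blast
    have "n_differentiable n V g"
      by (rule deriv_family_n_differentiable[OF D(2) \<open>open V\<close>, of 0]) (use D(1) in simp)
    then have "n_differentiable n (U \<inter> V) g" by (rule n_differentiable_subset) simp
    then have "n_differentiable n (U \<inter> V) f"
      by (rule n_differentiable_cong[rotated 2]) (use U \<open>open V\<close> V(3) in auto)
    then show ?thesis using t V(1) by blast
  qed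
  show ?thesis
    unfolding n_differentiable_def
  proof (intro allI impI ballI)
    fix k t assume "k < n" "t \<in> U"
    then show "((deriv ^^ k) f) field_differentiable at t"
      using loc[of t] unfolding n_differentiable_def by blast
  qed
qed

section \<open>The arc length coordinate\<close>

locale conformal_coefficients =
  fixes C1 C2 :: "real \<Rightarrow> real"
  assumes smooth_C1: "smooth_on {0<..} C1" and smooth_C2: "smooth_on {0<..} C2"
    and C1_pos: "0 < m \<Longrightarrow> 0 < C1 m"
    and C2_bound: "0 < m \<Longrightarrow> - (1 / m) * C1 m < C2 m"
begin

lemma g2_pos: "0 < r \<Longrightarrow> 0 < g2 C1 C2 r"
proof -
  assume r: "0 < r"
  then have r2: "0 < r\<^sup>2" by simp
  have "- (1 / r\<^sup>2) * C1 (r\<^sup>2) * r\<^sup>2 < C2 (r\<^sup>2) * r\<^sup>2"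
    by (rule mult_strict_right_mono[OF C2_bound[OF r2] r2])
  then show ?thesis using r by (simp add: g2_def)
qed

lemma n_differentiable_square_comp:
  assumes "smooth_on {0<..} f"
  shows "n_differentiable n {0<..} (\<lambda>r. f (r\<^sup>2))"
proof -
  have pos: "r * r \<in> {0<..}" if "r \<in> {0<..}" for r :: real using that by simp
  show ?thesis
    unfolding power2_eq_square
    by (rule n_differentiable_compose[OF open_greaterThan pos
          smooth_on_imp_n_differentiable[OF assms open_greaterThan]
          n_differentiable_mult[OF open_greaterThan n_differentiable_ident[OF open_greaterThan]
            n_differentiable_ident[OF open_greaterThan]]])
qed

lemmas n_differentiable_rules = n_differentiable_mult[OF open_greaterThan]
  n_differentiable_add[OF open_greaterThan] n_differentiable_const[OF open_greaterThan]
  n_differentiable_ident[OF open_greaterThan]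
  n_differentiable_square_comp[OF smooth_C1] n_differentiable_square_comp[OF smooth_C2]

lemma n_differentiable_g2: "n_differentiable n {0<..} (g2 C1 C2)"
proof -
  have "n_differentiable n {0<..} (\<lambda>r. 4 * (C1 (r\<^sup>2) + C2 (r\<^sup>2) * (r * r)))"
    by (intro n_differentiable_rules)
  then show ?thesis by (simp add: g2_def[abs_def] power2_eq_square)
qed

lemma W_deriv:
  assumes r: "0 < r"
  shows "(W_fun C1 C2 has_real_derivative sqrt (g2 C1 C2 r)) (at r)"
proof -
  have cont: "continuous_on {0<..} (\<lambda>\<rho>. sqrt (g2 C1 C2 \<rho>))"
    by (intro continuous_on_real_sqrt continuous_at_imp_continuous_on ballI
        DERIV_isCont[OF n_differentiable_deriv[OF n_differentiable_g2]])
  define l u where "l = min 1 r / 2" and "u = max 1 r + 1"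
  have lu: "0 < l" "l < 1" "l < r" "1 < u" "r < u" using r by (auto simp: l_def u_def)
  have "continuous_on {l..u} (\<lambda>\<rho>. sqrt (g2 C1 C2 \<rho>))"
    by (rule continuous_on_subset[OF cont]) (use lu in auto)
  then have "((\<lambda>u. LBINT y=ereal 1..ereal u. sqrt (g2 C1 C2 y)) has_vector_derivative sqrt (g2 C1 C2 r)) (at r within {l..u})"
    by (rule interval_integral_FTC2[rotated 2]) (use lu in linarith)+
  moreover have "at r within {l..u} = at r" by (rule at_within_interior) (use lu in simp)
  ultimately show ?thesis
    unfolding W_fun_def[abs_def] has_real_derivative_iff_has_vector_derivative by (simp only:)
qed

lemma W_strict_mono:
  assumes "0 < r" "r < r'"
  shows "W_fun C1 C2 r < W_fun C1 C2 r'"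
proof (rule DERIV_pos_imp_increasing[OF assms(2)])
  show "\<exists>y. (W_fun C1 C2 has_real_derivative y) (at x) \<and> 0 < y" if "r \<le> x" "x \<le> r'" for x
    using W_deriv[of x] g2_pos[of x] that assms(1) by (intro exI[of _ "sqrt (g2 C1 C2 x)"]) auto
qed

lemma W_mono: "0 < r \<Longrightarrow> r \<le> r' \<Longrightarrow> W_fun C1 C2 r \<le> W_fun C1 C2 r'"
  using W_strict_mono by (cases "r = r'") (auto intro: less_imp_le)

lemma r_fun_W:
  assumes "0 < r"
  shows "r_fun C1 C2 (W_fun C1 C2 r) = r"
proof -
  have "inj_on (W_fun C1 C2) {0<..}"
  proof (rule inj_onI)
    fix x y assume "x \<in> {0<..}" "y \<in> {0<..}" "W_fun C1 C2 x = W_fun C1 C2 y"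
    then show "x = y" using W_strict_mono[of x y] W_strict_mono[of y x] by (cases x y rule: linorder_cases) auto
  qed
  then show ?thesis unfolding r_fun_def by (rule inv_into_f_f) (use assms in simp)
qed

text \<open>
  \<open>W\<close> is increasing, so its one-sided limits exist as extended reals and are the bounds of its range.
\<close>

lemma W_minus_eq: "W_minus C1 C2 = (INF r\<in>{0<..}. ereal (W_fun C1 C2 r))" (is "_ = ?L")
  unfolding W_minus_def
proof (rule tendsto_Lim)
  show "((\<lambda>r. ereal (W_fun C1 C2 r)) \<longlongrightarrow> ?L) (at_right 0)"
  proof (rule order_tendstoI)
    fix c assume c: "c < ?L"
    have "\<forall>\<^sub>F r in at_right (0::real). 0 < r" by (rule eventually_at_right_less)
    then show "\<forall>\<^sub>F r in at_right 0. c < ereal (W_fun C1 C2 r)"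
    proof eventually_elim
      case (elim r)
      have "?L \<le> ereal (W_fun C1 C2 r)" by (rule INF_lower) (use elim in simp)
      then show ?case using c by simp
    qed
  next
    fix c assume "?L < c"
    then obtain r0 where r0: "0 < r0" "ereal (W_fun C1 C2 r0) < c" by (auto simp: INF_less_iff)
    have "\<forall>\<^sub>F r in at_right (0::real). r \<in> {0<..<r0}" by (rule eventually_at_right_real[OF r0(1)])
    then show "\<forall>\<^sub>F r in at_right 0. ereal (W_fun C1 C2 r) < c"
    proof eventually_elim
      case (elim r)
      then have "ereal (W_fun C1 C2 r) \<le> ereal (W_fun C1 C2 r0)" using W_mono[of r r0] by simp
      then show ?case using r0(2) by (rule le_less_trans)
    qed
  qed
qed simp

lemma W_plus_eq: "W_plus C1 C2 = (SUP r\<in>{0<..}. ereal (W_fun C1 C2 r))" (is "_ = ?L")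
  unfolding W_plus_def
proof (rule tendsto_Lim)
  show "((\<lambda>r. ereal (W_fun C1 C2 r)) \<longlongrightarrow> ?L) at_top"
  proof (rule order_tendstoI)
    fix c assume c: "?L < c"
    have "\<forall>\<^sub>F r in at_top. (0::real) < r" by (rule eventually_gt_at_top)
    then show "\<forall>\<^sub>F r in at_top. ereal (W_fun C1 C2 r) < c"
    proof eventually_elim
      case (elim r)
      have "ereal (W_fun C1 C2 r) \<le> ?L" by (rule SUP_upper) (use elim in simp)
      then show ?case using c by simp
    qed
  next
    fix c assume "c < ?L"
    then obtain r0 where r0: "0 < r0" "c < ereal (W_fun C1 C2 r0)" by (auto simp: less_SUP_iff)
    have "\<forall>\<^sub>F r in at_top. r0 \<le> r" by (rule eventually_ge_at_top)
    then show "\<forall>\<^sub>F r in at_top. c < ereal (W_fun C1 C2 r)"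
    proof eventually_elim
      case (elim r)
      then have "ereal (W_fun C1 C2 r0) \<le> ereal (W_fun C1 C2 r)" using W_mono[of r0 r] r0(1) by simp
      with r0(2) show ?case by (rule less_le_trans)
    qed
  qed
qed simp

lemma W_surj:
  assumes "s \<in> W_interval C1 C2"
  obtains r where "0 < r" "W_fun C1 C2 r = s"
proof -
  have "W_minus C1 C2 < ereal s" "ereal s < W_plus C1 C2"
    using assms by (auto simp: W_interval_def)
  then obtain r1 r2 where r: "0 < r1" "W_fun C1 C2 r1 < s" "0 < r2" "s < W_fun C1 C2 r2"
    unfolding W_minus_eq W_plus_eq by (auto simp: INF_less_iff less_SUP_iff)
  have "r1 \<le> r2" using W_mono[of r2 r1] r by (cases "r1 \<le> r2") auto
  have "continuous_on {r1..r2} (W_fun C1 C2)"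
    using r(1) by (intro continuous_at_imp_continuous_on) (auto intro!: DERIV_isCont W_deriv)
  from IVT'[OF _ _ \<open>r1 \<le> r2\<close> this, of s] r obtain x where "r1 \<le> x" "W_fun C1 C2 x = s" by auto
  then show thesis using r(1) by (intro that[of x]) linarith+
qed

lemma open_W_interval: "open (W_interval C1 C2)"
proof -
  have "W_interval C1 C2 = ereal -` {W_minus C1 C2<..<W_plus C1 C2}"
    by (auto simp: W_interval_def)
  moreover have "open (ereal -` {W_minus C1 C2<..<W_plus C1 C2})"
    by (intro open_vimage) (auto intro: continuous_on_ereal)
  ultimately show ?thesis by simp
qed

lemma r_fun_pos: "s \<in> W_interval C1 C2 \<Longrightarrow> 0 < r_fun C1 C2 s"
  using W_surj r_fun_W by metis

lemma r_fun_deriv: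
  assumes "s \<in> W_interval C1 C2"
  shows "(r_fun C1 C2 has_real_derivative inverse (sqrt (g2 C1 C2 (r_fun C1 C2 s)))) (at s)"
proof -
  obtain r where r: "0 < r" "W_fun C1 C2 r = s" using W_surj[OF assms] by blast
  have "(r_fun C1 C2 has_derivative (*) (inverse (sqrt (g2 C1 C2 r)))) (at (W_fun C1 C2 r))"
  proof (rule has_derivative_inverse_strong[of "{0<..}" r "W_fun C1 C2" "r_fun C1 C2"])
    show "continuous_on {0<..} (W_fun C1 C2)"
      by (intro continuous_at_imp_continuous_on ballI DERIV_isCont[OF W_deriv]) simp
    show "(W_fun C1 C2 has_derivative (*) (sqrt (g2 C1 C2 r))) (at r)"
      using W_deriv[OF r(1)] by (simp add: has_field_derivative_def)
    show "(*) (sqrt (g2 C1 C2 r)) \<circ> (*) (inverse (sqrt (g2 C1 C2 r))) = id"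
      using g2_pos[OF r(1)] by (simp add: fun_eq_iff)
  qed (use r(1) r_fun_W in auto)
  then have "(r_fun C1 C2 has_real_derivative inverse (sqrt (g2 C1 C2 r))) (at (W_fun C1 C2 r))"
    by (simp add: has_field_derivative_def)
  then show ?thesis using r r_fun_W[OF r(1)] by simp
qed

text \<open>
  The derivative of \<open>r\<close> is a smooth function of \<open>r\<close> itself, which yields one more derivative at each
  step.
\<close>

lemma n_differentiable_r_fun: "n_differentiable n (W_interval C1 C2) (r_fun C1 C2)"
proof (induction n)
  case (Suc n)
  have "n_differentiable n {0<..} (\<lambda>r. inverse (sqrt (g2 C1 C2 r)))"
    by (rule n_differentiable_inverse[OF open_greaterThan _
          n_differentiable_sqrt[OF open_greaterThan _ n_differentiable_g2]])
      (use g2_pos in \<open>auto simp: less_imp_neq[THEN not_sym]\<close>)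
  from n_differentiable_compose[OF open_W_interval _ this Suc.IH]
  have "n_differentiable n (W_interval C1 C2) (\<lambda>s. inverse (sqrt (g2 C1 C2 (r_fun C1 C2 s))))"
    using r_fun_pos by simp
  from n_differentiable_SucI[OF open_W_interval r_fun_deriv this] show ?case .
qed simp

lemma n_differentiable_a_fun: "n_differentiable n (W_interval C1 C2) (a_fun C1 C2)"
proof -
  have "n_differentiable n {0<..} (\<lambda>r. 4 * C1 (r\<^sup>2) * (r * r))"
    by (intro n_differentiable_rules)
  from n_differentiable_compose[OF open_W_interval _ this n_differentiable_r_fun]
  show ?thesis using r_fun_pos by (simp add: a_fun_def[abs_def] power2_eq_square)
qed

lemma a_fun_pos: "s \<in> W_interval C1 C2 \<Longrightarrow> 0 < a_fun C1 C2 s"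
  using r_fun_pos[of s] C1_pos[of "(r_fun C1 C2 s)\<^sup>2"] by (simp add: a_fun_def)

end

section \<open>Orthonormal functions on the manifold\<close>

lemma smooth_on_imp_continuous_on: "smooth_on N f \<Longrightarrow> continuous_on N f"
  unfolding continuous_on_eq_continuous_within
  by (blast intro: has_derivative_continuous smooth_on_has_derivative)

lemma L2_inner_abs:
  assumes "square_integrable f" "square_integrable g"
  shows "abs_L2 f \<bullet> abs_L2 g = (\<integral>x. f x * g x \<partial>mu0)"
  unfolding inner_L2_def using assms by (intro L2_inner.abs_eq) (simp_all add: L2_rel_def)

lemma space_mu0: "space (mu0 :: 'm::borel_measure_space measure) = UNIV"
  using sets_eq_imp_space_eq[OF sets_mu0] by simp

lemma square_integrable_indicator:
  fixes B :: "'m::borel_measure_space set"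
  assumes B: "B \<in> sets mu0" and fin: "emeasure (mu0 :: 'm measure) UNIV = 1"
  shows "square_integrable (\<lambda>x. c * indicator B x)"
proof -
  interpret finite_measure "mu0 :: 'm measure"
    by (rule finite_measureI) (simp add: space_mu0 fin)
  have "integrable mu0 (\<lambda>x. c\<^sup>2 * indicator B x :: real)"
    using B by (intro integrable_mult_right integrable_real_indicator) (auto simp: emeasure_eq_measure)
  moreover have "(\<lambda>x. (c * indicator B x :: real)\<^sup>2) = (\<lambda>x. c\<^sup>2 * indicator B x)"
    by (auto simp: fun_eq_iff indicator_def)
  ultimately show ?thesis
    using B unfolding square_integrable_def by (auto intro: borel_measurable_times borel_measurable_indicator)
qed

lemma L2_orthonormal_of_disjoint:
  fixes B1 B2 B3 :: "'m::borel_measure_space set"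
  assumes B: "B1 \<in> sets mu0" "B2 \<in> sets mu0" "B3 \<in> sets mu0"
    and disj: "B1 \<inter> B2 = {}" "B1 \<inter> B3 = {}" "B2 \<inter> B3 = {}"
    and pos: "emeasure mu0 B1 > 0" "emeasure mu0 B2 > 0" "emeasure mu0 B3 > 0"
    and fin: "emeasure (mu0 :: 'm measure) UNIV = 1"
  obtains e1 e2 e3 :: "'m L2" where "e1 \<bullet> e1 = 1" "e2 \<bullet> e2 = 1" "e3 \<bullet> e3 = 1"
    "e1 \<bullet> e2 = 0" "e1 \<bullet> e3 = 0" "e2 \<bullet> e3 = 0"
proof -
  interpret finite_measure "mu0 :: 'm measure"
    by (rule finite_measureI) (simp add: space_mu0 fin)
  define e where "e B = (abs_L2 (\<lambda>x. (1 / sqrt (measure mu0 B)) * indicator B x) :: 'm L2)" for B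
  have one: "e B \<bullet> e B = 1" if "B \<in> sets mu0" "emeasure mu0 B > 0" for B
  proof -
    have m: "0 < measure mu0 B" using that(2) by (simp add: emeasure_eq_measure)
    have "e B \<bullet> e B = (\<integral>x. (1 / measure mu0 B) * indicator B x \<partial>mu0)"
      unfolding e_def L2_inner_abs[OF square_integrable_indicator[OF that(1) fin] square_integrable_indicator[OF that(1) fin]]
      using m by (intro Bochner_Integration.integral_cong) (auto simp: indicator_def)
    also have "\<dots> = 1" using m that(1) by (simp add: space_mu0)
    finally show ?thesis .
  qed
  have zero: "e B \<bullet> e B' = 0" if "B \<in> sets mu0" "B' \<in> sets mu0" "B \<inter> B' = {}" for B B'
  proof -
    have "e B \<bullet> e B' = (\<integral>x. 0 \<partial>(mu0 :: 'm measure))"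
      unfolding e_def L2_inner_abs[OF square_integrable_indicator[OF that(1) fin] square_integrable_indicator[OF that(2) fin]]
      using that(3) by (intro Bochner_Integration.integral_cong) (auto simp: indicator_def)
    then show ?thesis by simp
  qed
  show thesis
    by (rule that[of "e B1" "e B2" "e B3"]) (intro one zero B disj pos)+
qed

text \<open>
  A point of the quadrant may lie on its boundary; pushing it along \<open>One\<close> moves it into the interior,
  where three small balls side by side fit.
\<close>

lemma three_disjoint_balls:
  fixes T :: "'e::euclidean_space set"
  assumes "open T" "z \<in> T" "z \<in> corner_model"
  obtains c1 c2 c3 d where "0 < d" "ball c1 d \<union> ball c2 d \<union> ball c3 d \<subseteq> T \<inter> corner_model"
    "ball c1 d \<inter> ball c2 d = {}" "ball c1 d \<inter> ball c3 d = {}" "ball c2 d \<inter> ball c3 d = {}"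
proof -
  obtain e where e: "0 < e" "ball z e \<subseteq> T" using assms(1,2) open_contains_ball by blast
  define w where "w = (e / (2 * norm (One :: 'e))) *\<^sub>R (One :: 'e)"
  have One: "0 < norm (One :: 'e)" using One_non_0 by simp
  have w: "norm w < e" using e One by (simp add: w_def)
  have wb: "0 < w \<bullet> b" if "b \<in> Basis" for b
    using that e One by (simp add: w_def)
  define O' where "O' = {x :: 'e. \<forall>b\<in>Basis. 0 < x \<bullet> b} \<inter> T"
  have "open {x :: 'e. \<forall>b\<in>Basis. 0 < x \<bullet> b}"
  proof -
    have "{x :: 'e. \<forall>b\<in>Basis. 0 < x \<bullet> b} = (\<Inter>b\<in>Basis. {x. 0 < x \<bullet> b})" by blast
    then show ?thesis
      by (simp add: open_INT open_Collect_less continuous_on_inner continuous_on_const continuous_on_id)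
  qed
  then have "open O'" unfolding O'_def using assms(1) by blast
  moreover have "z + w \<in> O'"
    using assms(3) wb w e(2) by (auto simp: O'_def corner_model_def inner_add_left add_nonneg_pos dist_norm subset_iff)
  ultimately obtain r where r: "0 < r" "ball (z + w) r \<subseteq> O'" using open_contains_ball by blast
  obtain b :: 'e where b: "b \<in> Basis" using nonempty_Basis by blast
  then have nb: "norm b = 1" by simp
  define d where "d = r / 4"
  have d: "0 < d" using r by (simp add: d_def)
  define c where "c k = z + w + (k * (2 * d)) *\<^sub>R b" for k :: real
  have sub: "ball (c k) d \<subseteq> T \<inter> corner_model" if "\<bar>k\<bar> \<le> 1" for k
  proof -
    have "dist (z + w) (c k) + d \<le> r"
    proof -
      have "dist (z + w) (c k) = \<bar>k\<bar> * (2 * d)" using d nb by (simp add: c_def dist_norm abs_mult)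
      moreover have "\<bar>k\<bar> * (2 * d) \<le> 1 * (2 * d)" using that d by (intro mult_right_mono) auto
      moreover have "r = 4 * d" by (simp add: d_def)
      ultimately show ?thesis using d by linarith
    qed
    then have "dist (z + w) y < r" if "dist (c k) y < d" for y
      using dist_triangle[of "z + w" y "c k"] that by linarith
    then have "ball (c k) d \<subseteq> ball (z + w) r" by auto
    moreover have "O' \<subseteq> T \<inter> corner_model" by (auto simp: O'_def corner_model_def less_imp_le)
    ultimately show ?thesis using r(2) by blast
  qed
  have dis: "ball (c k) d \<inter> ball (c l) d = {}" if "1 \<le> \<bar>k - l\<bar>" for k l
  proof -
    have "c k - c l = ((k - l) * (2 * d)) *\<^sub>R b" by (simp add: c_def algebra_simps)
    then have "dist (c k) (c l) = \<bar>k - l\<bar> * (2 * d)" using d nb by (simp add: dist_norm abs_mult)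
    then have "2 * d \<le> dist (c k) (c l)" using that d by (simp add: mult_right_mono[of 1, simplified])
    then show ?thesis by (intro disjoint_ballI) simp
  qed
  show thesis
    by (rule that[OF d, of "c (-1)" "c 0" "c 1"]) (use sub[of "-1"] sub[of 0] sub[of 1] in \<open>auto intro!: dis\<close>)
qed

text \<open>
  The measure of the preimage is the Lebesgue integral of a positive function over a nonempty open set.
\<close>

lemma positive_density_chart_preimage:
  fixes x :: "'m::t2_space \<Rightarrow> 'e::euclidean_space" and \<mu> :: "'m measure"
  assumes c: "corner_chart (U, x)" and \<mu>: "smooth_positive_density A \<mu>" and A: "(U, x) \<in> A"
    and Q: "open Q" "Q \<subseteq> x ` U" "Q \<noteq> {}"
  shows "U \<inter> x -` Q \<in> sets borel" "0 < emeasure \<mu> (U \<inter> x -` Q)"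
proof -
  have U: "open U" and h: "homeomorphism U (x ` U) x (inv_into U x)"
    using c by (auto simp: corner_chart_def)
  have "continuous_on U x" using h by (simp add: homeomorphism_def)
  then have "open (U \<inter> x -` Q)" using U Q(1) by (rule continuous_open_preimage)
  then show B: "U \<inter> x -` Q \<in> sets borel" by simp
  obtain \<rho> :: "'e \<Rightarrow> real" where \<rho>: "smooth_on (x ` U) \<rho>" "\<forall>z\<in>x ` U. 0 < \<rho> z"
    and em: "\<forall>B\<in>sets borel. B \<subseteq> U \<longrightarrow> emeasure \<mu> B = (\<integral>\<^sup>+z. ennreal (\<rho> z) * indicator (x ` B) z \<partial>lborel)"
    using \<mu> A unfolding smooth_positive_density_def by blast
  have im: "x ` (U \<inter> x -` Q) = Q" using Q(2) by blast
  have "continuous_on Q \<rho>" using continuous_on_subset[OF smooth_on_imp_continuous_on[OF \<rho>(1)] Q(2)] .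
  then have "(\<lambda>z. indicator Q z *\<^sub>R \<rho> z) \<in> borel_measurable borel"
    by (rule borel_measurable_continuous_on_indicator[rotated]) (use Q(1) in simp)
  then have meas: "(\<lambda>z. ennreal (indicator Q z *\<^sub>R \<rho> z)) \<in> borel_measurable lborel" by simp
  have ind: "(\<lambda>z. ennreal (\<rho> z) * indicator Q z) = (\<lambda>z. ennreal (indicator Q z *\<^sub>R \<rho> z))"
    by (auto simp: fun_eq_iff indicator_def)
  have "emeasure \<mu> (U \<inter> x -` Q) = (\<integral>\<^sup>+z. ennreal (indicator Q z *\<^sub>R \<rho> z) \<partial>lborel)"
    using em B by (simp add: im ind)
  moreover have "\<dots> \<noteq> 0"
  proof
    assume "(\<integral>\<^sup>+z. ennreal (indicator Q z *\<^sub>R \<rho> z) \<partial>lborel) = 0"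
    then have "AE z in lborel. ennreal (indicator Q z *\<^sub>R \<rho> z) = 0"
      using nn_integral_0_iff_AE[OF meas] by simp
    then have "AE z in lborel. z \<notin> Q"
    proof eventually_elim
      case (elim z)
      then show ?case
        using bspec[OF \<rho>(2) subsetD[OF Q(2)], of z] by (auto simp: indicator_def ennreal_eq_0_iff split: if_splits)
    qed
    then have "emeasure lborel Q = 0"
      using Q(1) by (subst (asm) AE_iff_measurable[of Q]) auto
    moreover have "emeasure lborel Q \<noteq> 0"
      using open_not_negligible[OF Q(1,3)] Q(1)
      by (simp add: negligible_iff_null_sets null_sets_def emeasure_completion[symmetric] main_part_sets)
    ultimately show False by simp
  qed
  ultimately show "0 < emeasure \<mu> (U \<inter> x -` Q)" by (simp add: zero_less_iff_neq_zero)
qed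

text \<open>
  Normalized indicator functions of three disjoint sets of positive measure inside one chart.  They
  guarantee that the tangent spaces of the sphere have dimension at least 2, so that tangent planes of
  the sphere exist.
\<close>

lemma L2_three_orthonormal:
  fixes A :: "('m::{t2_space, borel_measure_space}, 'e::euclidean_space) atlas"
  assumes A: "compact_manifold_with_corners A" and \<mu>: "smooth_positive_density A (mu0 :: 'm measure)"
    and fin: "emeasure (mu0 :: 'm measure) UNIV = 1"
  obtains e1 e2 e3 :: "'m L2" where "e1 \<bullet> e1 = 1" "e2 \<bullet> e2 = 1" "e3 \<bullet> e3 = 1"
    "e1 \<bullet> e2 = 0" "e1 \<bullet> e3 = 0" "e2 \<bullet> e3 = 0"
proof -
  have "(undefined :: 'm) \<in> (\<Union>(U, x)\<in>A. U)"
    using A by (simp add: compact_manifold_with_corners_def)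
  then obtain U x where Ux: "(U, x) \<in> A" "undefined \<in> U" by auto
  have c: "corner_chart (U, x)"
    using A Ux(1) by (auto simp: compact_manifold_with_corners_def)
  then obtain T where T: "open T" "x ` U = corner_model \<inter> T"
    by (auto simp: corner_chart_def openin_open)
  have "x undefined \<in> x ` U" using Ux(2) by (rule imageI)
  then have "x undefined \<in> T" "x undefined \<in> corner_model" using T(2) by auto
  then obtain c1 c2 c3 d where d: "0 < d" and sub: "ball c1 d \<union> ball c2 d \<union> ball c3 d \<subseteq> T \<inter> corner_model"
    and dis: "ball c1 d \<inter> ball c2 d = {}" "ball c1 d \<inter> ball c3 d = {}" "ball c2 d \<inter> ball c3 d = {}"
    using three_disjoint_balls[OF T(1)] by metis
  have bb: "ball c d \<noteq> {}" for c :: 'e using d by simp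
  have s: "ball c1 d \<subseteq> x ` U" "ball c2 d \<subseteq> x ` U" "ball c3 d \<subseteq> x ` U" using sub T(2) by auto
  note P = positive_density_chart_preimage[OF c \<mu> Ux(1) open_ball _ bb]
  show thesis
    by (rule L2_orthonormal_of_disjoint[of "U \<inter> x -` ball c1 d" "U \<inter> x -` ball c2 d" "U \<inter> x -` ball c3 d"])
      (use P[OF s(1)] P[OF s(2)] P[OF s(3)] dis fin that in \<open>auto simp: sets_mu0\<close>)
qed

section \<open>The Levi-Civita derivative and the curvature of the extended metric\<close>

theorem mainTheorem2:
  fixes A :: "('m::{t2_space, borel_measure_space}, 'e::euclidean_space) atlas"
    and C1 C2 a a\<^sub>s a\<^sub>s\<^sub>s b\<^sub>s :: "real \<Rightarrow> real"
    and I :: "real set"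
    and S :: "'m L2 set"
    and G :: "real \<times> 'm L2 \<Rightarrow> real \<times> 'm L2 \<Rightarrow> real \<times> 'm L2 \<Rightarrow> real"
    and G\<^sub>S :: "'m L2 \<Rightarrow> 'm L2 \<Rightarrow> 'm L2 \<Rightarrow> real"
  assumes "compact_manifold_with_corners A"
    and "smooth_positive_density A (mu0 :: 'm measure)"
    and "emeasure (mu0 :: 'm measure) UNIV = 1"
    and "smooth_on {0<..} C1" and "smooth_on {0<..} C2"
    and "\<And>m. 0 < m \<Longrightarrow> 0 < C1 m"
    and "\<And>m. 0 < m \<Longrightarrow> - (1 / m) * C1 m < C2 m"
    and I_def: "I = W_interval C1 C2"
    and S_def: "S = L2_sphere"
    and a_def: "a = a_fun C1 C2"
    and a\<^sub>s_def: "a\<^sub>s = deriv a"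
    and a\<^sub>s\<^sub>s_def: "a\<^sub>s\<^sub>s = deriv (deriv a)"
    and b\<^sub>s_def: "b\<^sub>s = deriv (\<lambda>s. a\<^sub>s s / (2 * a s))"
    and G_def: "G = warped_metric a"
    and G\<^sub>S_def: "G\<^sub>S = sphere_metric"
  shows
    \<comment> \<open>(i) covariant derivative\<close>
    "is_levi_civita S G\<^sub>S (levi_civita S G\<^sub>S) \<and>
     is_levi_civita (I \<times> S) G (levi_civita (I \<times> S) G) \<and>
     (\<forall>f g X Y. smooth_on (I \<times> S) f \<and> smooth_on (I \<times> S) g \<and>
        smooth_on (I \<times> S) X \<and> smooth_on (I \<times> S) Y \<and>
        (\<forall>s\<in>I. \<forall>\<phi>\<in>S. X (s, \<phi>) \<in> tangent_space S \<phi> \<and> Y (s, \<phi>) \<in> tangent_space S \<phi>) \<longrightarrow>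
        (\<forall>s\<in>I. \<forall>\<phi>\<in>S.
          levi_civita (I \<times> S) G (\<lambda>p. (f p, X p)) (\<lambda>p. (g p, Y p)) (s, \<phi>) =
            (f (s, \<phi>) * deriv (\<lambda>t. g (t, \<phi>)) s
               + deriv_on S (\<lambda>\<psi>. g (s, \<psi>)) \<phi> (X (s, \<phi>))
               - a\<^sub>s s / 2 * (X (s, \<phi>) \<bullet> Y (s, \<phi>)),
             (a\<^sub>s s / (2 * a s)) *\<^sub>R (f (s, \<phi>) *\<^sub>R Y (s, \<phi>) + g (s, \<phi>) *\<^sub>R X (s, \<phi>))
               + f (s, \<phi>) *\<^sub>R vector_derivative (\<lambda>t. Y (t, \<phi>)) (at s)
               + levi_civita S G\<^sub>S (\<lambda>\<psi>. X (s, \<psi>)) (\<lambda>\<psi>. Y (s, \<psi>)) \<phi>))) \<and>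
     \<comment> \<open>(ii) curvature tensor and numerator of the sectional curvature\<close>
     (\<forall>s\<in>I. \<forall>\<phi>\<in>S. \<forall>f g h :: real.
        \<forall>X\<in>tangent_space S \<phi>. \<forall>Y\<in>tangent_space S \<phi>. \<forall>Z\<in>tangent_space S \<phi>.
          curvature (I \<times> S) G (s, \<phi>) (f, X) (g, Y) (h, Z) =
            ((a\<^sub>s\<^sub>s s / 2 - (a\<^sub>s s)\<^sup>2 / (4 * a s)) * ((g *\<^sub>R X - f *\<^sub>R Y) \<bullet> Z),
             curvature S G\<^sub>S \<phi> X Y Z
               - ((b\<^sub>s s + (a\<^sub>s s)\<^sup>2 / (4 * (a s)\<^sup>2)) * h) *\<^sub>R (g *\<^sub>R X - f *\<^sub>R Y)
               + ((a\<^sub>s s)\<^sup>2 / (4 * a s)) *\<^sub>R ((X \<bullet> Z) *\<^sub>R Y - (Y \<bullet> Z) *\<^sub>R X))) \<and>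
     (\<forall>s\<in>I. \<forall>\<phi>\<in>S. \<forall>f g :: real. \<forall>X\<in>tangent_space S \<phi>. \<forall>Y\<in>tangent_space S \<phi>.
          G (s, \<phi>) (curvature (I \<times> S) G (s, \<phi>) (f, X) (g, Y) (g, Y)) (f, X) =
            a s * (curvature S G\<^sub>S \<phi> X Y Y \<bullet> X)
              - (a\<^sub>s\<^sub>s s / 2 - (a\<^sub>s s)\<^sup>2 / (4 * a s))
                  * ((g *\<^sub>R X - f *\<^sub>R Y) \<bullet> (g *\<^sub>R X - f *\<^sub>R Y))
              + (a\<^sub>s s)\<^sup>2 / 4 * ((X \<bullet> Y)\<^sup>2 - (Y \<bullet> Y) * (X \<bullet> X))) \<and>
     \<comment> \<open>(iii) sectional curvatures of the two kinds of planes; that of an arbitrary tangent plane is a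
       convex combination of the two, and all convex combinations occur\<close>
     (\<forall>s\<in>I. \<forall>\<phi>\<in>S. \<forall>X\<in>tangent_space S \<phi>. \<forall>Y\<in>tangent_space S \<phi>.
        X \<bullet> Y = 0 \<and> X \<bullet> X = 1 / a s \<and> Y \<bullet> Y = 1 / a s \<longrightarrow>
          sectional_curvature (I \<times> S) G (s, \<phi>) (span {(0, X), (0, Y)}) =
            1 / a s - (a\<^sub>s s)\<^sup>2 / (4 * (a s)\<^sup>2) \<and>
          sectional_curvature (I \<times> S) G (s, \<phi>) (span {(1, 0), (0, Y)}) =
            - (a\<^sub>s\<^sub>s s / (2 * a s)) + (a\<^sub>s s)\<^sup>2 / (4 * (a s)\<^sup>2)) \<and>
     (\<forall>s\<in>I. \<forall>\<phi>\<in>S.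
        sectional_curvature (I \<times> S) G (s, \<phi>) ` tangent_planes (I \<times> S) (s, \<phi>) =
          closed_segment (1 / a s - (a\<^sub>s s)\<^sup>2 / (4 * (a s)\<^sup>2))
                         (- (a\<^sub>s\<^sub>s s / (2 * a s)) + (a\<^sub>s s)\<^sup>2 / (4 * (a s)\<^sup>2)))"
proof -
  interpret C: conformal_coefficients C1 C2
    by unfold_locales (use assms(4-7) in auto)
  have I: "open I" unfolding I_def by (rule C.open_W_interval)
  have a: "n_differentiable n I a" for n
    unfolding I_def a_def by (rule C.n_differentiable_a_fun)
  have a_pos: "0 < a s" if "s \<in> I" for s
    using C.a_fun_pos that by (simp add: I_def a_def)
  have as: "n_differentiable n I a\<^sub>s" for n
    unfolding a\<^sub>s_def by (rule n_differentiable_Suc_deriv[OF a])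
  have b: "n_differentiable n I (\<lambda>s. a\<^sub>s s / (2 * a s))" for n
    unfolding divide_inverse
    by (rule n_differentiable_mult[OF I as n_differentiable_inverse[OF I _
            n_differentiable_mult[OF I n_differentiable_const[OF I] a]]])
      (use a_pos in force)
  note smooth = smooth_on_open_imp_smooth_on[OF n_differentiable_imp_smooth_on_open[OF I] subset_refl]
  interpret W: warped_product I a a\<^sub>s a\<^sub>s\<^sub>s b\<^sub>s
  proof
    show "(a has_real_derivative a\<^sub>s s) (at s)" if "s \<in> I" for s
      unfolding a\<^sub>s_def by (rule n_differentiable_deriv[OF a that])
    show "(a\<^sub>s has_real_derivative a\<^sub>s\<^sub>s s) (at s)" if "s \<in> I" for s
      using n_differentiable_deriv[OF as that] by (simp add: a\<^sub>s\<^sub>s_def a\<^sub>s_def)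
    show "((\<lambda>s. a\<^sub>s s / (2 * a s)) has_real_derivative b\<^sub>s s) (at s)" if "s \<in> I" for s
      unfolding b\<^sub>s_def by (rule n_differentiable_deriv[OF b that])
  qed (fact I a_pos smooth[OF a] smooth[OF as] smooth[OF b])+
  have G: "G = W.metric"
    by (simp add: G_def warped_metric_def W.metric_def fun_eq_iff)
  have GS: "G\<^sub>S = (\<lambda>_. (\<bullet>))"
    by (simp add: G\<^sub>S_def sphere_metric_def fun_eq_iff)
  interpret NS: submanifold_connection "sphere (0 :: 'm L2) 1" "\<lambda>_. (\<bullet>)" "\<lambda>p u v. (u \<bullet> v) *\<^sub>R p"
    "\<lambda>p u v z. (v \<bullet> z) *\<^sub>R u"
    by (rule sphere_connection)
  interpret NW: submanifold_connection "I \<times> sphere (0 :: 'm L2) 1" W.metric W.\<Gamma> W.d\<Gamma>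
    by (rule W.warped_connection)
  obtain e1 e2 e3 :: "'m L2" where e: "e1 \<bullet> e1 = 1" "e2 \<bullet> e2 = 1" "e3 \<bullet> e3 = 1"
    "e1 \<bullet> e2 = 0" "e1 \<bullet> e3 = 0" "e2 \<bullet> e3 = 0"
    using L2_three_orthonormal[OF assms(1-3)] by blast
  have segment: "sectional_curvature (I \<times> S) G (s, \<phi>) ` tangent_planes (I \<times> S) (s, \<phi>) =
      closed_segment (W.tangential_curvature s) (W.radial_curvature s)"
    if s: "s \<in> I" and \<phi>: "\<phi> \<in> S" for s \<phi>
  proof -
    obtain x y where xy: "\<phi> \<bullet> x = 0" "\<phi> \<bullet> y = 0" "x \<bullet> y = 0" "x \<bullet> x = 1" "y \<bullet> y = 1"
      using orthonormal_pair_perp[OF e, of \<phi>] by blast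
    have \<phi>': "\<phi> \<in> sphere 0 1" using \<phi> S_def by simp
    define c where "c = 1 / sqrt (a s)"
    have c: "c * c = 1 / a s" using a_pos[OF s] by (simp add: c_def)
    have T: "c *\<^sub>R x \<in> tangent_space (sphere 0 1) \<phi>" "c *\<^sub>R y \<in> tangent_space (sphere 0 1) \<phi>"
      using xy by (simp_all add: tangent_space_sphere[OF \<phi>'])
    have on: "c *\<^sub>R x \<bullet> c *\<^sub>R y = 0" "c *\<^sub>R x \<bullet> c *\<^sub>R x = 1 / a s" "c *\<^sub>R y \<bullet> c *\<^sub>R y = 1 / a s"
      using xy c by simp_all
    show ?thesis
      unfolding G S_def by (rule W.sectional_curvatures_warped(3)[OF s \<phi>' T on])
  qed
  show ?thesis
  proof (intro conjI allI ballI impI, goal_cases)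
    case 1
    show ?case unfolding S_def GS by (rule NS.is_levi_civita_levi_civita)
  next
    case 2
    show ?case unfolding S_def G by (rule NW.is_levi_civita_levi_civita)
  next
    case (3 f g X Y s \<phi>)
    then show ?case unfolding G GS S_def by (intro W.levi_civita_warped) blast+
  next
    case (4 s \<phi> f g h X Y Z)
    then show ?case unfolding G GS S_def by (rule W.curvature_warped)
  next
    case (5 s \<phi> f g X Y)
    then show ?case unfolding G GS S_def by (rule W.curvature_numerator_warped)
  next
    case (6 s \<phi> X Y)
    then show ?case
      using W.sectional_curvatures_warped(1)[OF 6(1-4)[unfolded S_def]]
      unfolding G S_def W.tangential_curvature_def by blast
  next
    case (7 s \<phi> X Y)
    then show ?case
      using W.sectional_curvatures_warped(2)[OF 7(1-4)[unfolded S_def]]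
      unfolding G S_def W.radial_curvature_def by blast
  next
    case (8 s \<phi>)
    then show ?case by (rule segment[unfolded W.tangential_curvature_def W.radial_curvature_def])
  qed
qed

end
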